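(* Let $l\ge4$ be an integer. For a condition $P$ on positive integers $l_1,\dots,l_n$, write $\sum_{P}$ for the sum over all integers $l_1\ge2$, $l_2,\dots,l_n\ge1$ with $l_1+\cdots+l_n=l$ satisfying $P$ (the depth $n$ being determined by the summand). (i) If $l$ is even, then \[ \sum_{l_1,l_2,l_3\text{ even}}\zeta(l_1,l_2,l_3)=\tfrac58\zeta(l)-\tfrac14\zeta(l-2)\zeta(2), \] \[ \Big(\sum_{\substack{l_1\text{ even}\\ l_2,l_3\text{ odd}}}+\sum_{\substack{l_2\text{ even}\\ l_1,l_3\text{ odd}}}+\sum_{\substack{l_3\text{ even}\\ l_1,l_2\text{ odd}}}\Big)\zeta(l_1,l_2,l_3)=\tfrac38\zeta(l)+\tfrac14\zeta(l-2)\zeta(2), \] \[ \Big(\sum_{\substack{l_1\text{ even}\\ l_2,l_3\text{ odd}}}-\sum_{\substack{l_3\text{ even}\\ l_1,l_2\text{ odd}}}\Big)\zeta(l_1,l_2,l_3)=-\tfrac14\zeta(l)+\tfrac12\zeta(l-2)\zeta(2). \] (ii) If $l$ is odd, then \[ \sum_{l_1,l_2,l_3\text{ odd}}\zeta(l_1,l_2,l_3)+\tfrac12\sum_{\substack{l_2\text{ even}\\ l_1\text{ odd}}}\zeta(l_1,l_2)=\tfrac38\zeta(l)-\tfrac14\zeta(2,l-2), \] \[ \sum_{\substack{l_1,l_3\text{ even}\\ l_2\text{ odd}}}\zeta(l_1,l_2,l_3)+\tfrac12\sum_{\substack{l_2\text{ even}\\ l_1\text{ odd}}}\zeta(l_1,l_2)=\tfrac58\zeta(l)+\tfrac14\zeta(2,l-2),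 \] \[ \Big(\sum_{\substack{l_1,l_2\text{ even}\\ l_3\text{ odd}}}+\sum_{\substack{l_2,l_3\text{ even}\\ l_1\text{ odd}}}\Big)\zeta(l_1,l_2,l_3)+\sum_{\substack{l_1\text{ even}\\ l_2\text{ odd}}}\zeta(l_1,l_2)=\zeta(l). \]
   Context: For positive integers $l_1\ge2,l_2,\dots,l_n$, the multiple zeta value is $\zeta(l_1,\dots,l_n)=\sum_{m_1>\cdots>m_n>0}\frac{1}{m_1^{l_1}\cdots m_n^{l_n}}$; $\zeta(l)$ is the Riemann zeta value. *)

theory Defs
  imports "HOL-Analysis.Analysis"
begin

definition zeta_val :: "nat \<Rightarrow> real" where
  "zeta_val k = (\<Sum>m. 1 / real (Suc m) ^ k)"

text \<open>
  The list \<open>ls\<close> holds the exponents. The value is the multiple zeta value only when the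
  series converges, i.e. when all entries are positive and the first one is at least 2;
  all terms are nonnegative, so the unordered sum is the usual one.
\<close>
definition mzv :: "nat list \<Rightarrow> real" where
  "mzv ls =
     (\<Sum>\<^sub>\<infinity>ms\<in>{ms :: nat list. length ms = length ls \<and> sorted_wrt (>) ms \<and> (\<forall>m\<in>set ms. m > 0)}.
        1 / (\<Prod>i<length ls. real (ms ! i) ^ (ls ! i)))"

definition mzv_sum2 :: "nat \<Rightarrow> (nat \<Rightarrow> nat \<Rightarrow> bool) \<Rightarrow> real" where
  "mzv_sum2 l P =
     (\<Sum>(a, b)\<in>{(a, b). a \<ge> 2 \<and> b \<ge> 1 \<and> a + b = l \<and> P a b}. mzv [a, b])"

definition mzv_sum3 :: "nat \<Rightarrow> (nat \<Rightarrow> nat \<Rightarrow> nat \<Rightarrow> bool) \<Rightarrow> real" where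
  "mzv_sum3 l P =
     (\<Sum>(a, b, c)\<in>{(a, b, c). a \<ge> 2 \<and> b \<ge> 1 \<and> c \<ge> 1 \<and> a + b + c = l \<and> P a b c}. mzv [a, b, c])"

lemma finite_mzv_sum2_index:
  "finite {(a, b). a \<ge> 2 \<and> b \<ge> 1 \<and> a + b = (l :: nat) \<and> P a b}"
  by (rule finite_subset[of _ "{..l} \<times> {..l}"]) auto

lemma finite_mzv_sum3_index:
  "finite {(a, b, c). a \<ge> 2 \<and> b \<ge> 1 \<and> c \<ge> 1 \<and> a + b + c = (l :: nat) \<and> P a b c}"
  by (rule finite_subset[of _ "{..l} \<times> {..l} \<times> {..l}"]) auto

lemma mzv_singleton:
  assumes "k \<ge> 2"
  shows "mzv [k] = zeta_val k"
proof -
  have summ: "summable (\<lambda>m. 1 / real (Suc m) ^ k)"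
    using inverse_power_summable[OF assms, where 'a = real]
    by (subst (asm) summable_Suc_iff[symmetric]) (simp add: field_simps)
  have img: "{ms :: nat list. length ms = length [k] \<and> sorted_wrt (>) ms \<and> (\<forall>m\<in>set ms. m > 0)}
      = (\<lambda>m. [Suc m]) ` UNIV"
    by (auto simp: length_Suc_conv image_iff gr0_conv_Suc)
  have "mzv [k] = (\<Sum>\<^sub>\<infinity>m. 1 / real (Suc m) ^ k)"
    unfolding mzv_def img by (subst infsum_reindex) (auto simp: inj_on_def o_def)
  also have "\<dots> = zeta_val k"
    unfolding zeta_val_def
    by (rule infsumI, rule norm_summable_imp_has_sum) (use summ in \<open>auto intro: summable_sums\<close>)
  finally show ?thesis .
qed

end

theory Submission
  imports Defs
begin

text \<open>
  For a fixed weight, summing \<open>1 / (p^a n^b k^c)\<close> over the admissible exponents gives a rational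
  function of \<open>p > n > k\<close>, which partial fractions write as a sum of a power of \<open>1/k\<close>, of \<open>1/n\<close> and
  of \<open>1/p\<close>, each with a coefficient that does not depend on the weight. Collecting all terms
  that carry the power of one fixed integer leaves coefficients built from harmonic numbers,
  which collapse to short expressions in \<open>1/k\<close>, \<open>\<zeta>(2)\<close> and \<open>\<Sum>i\<le>k. 1/i^2\<close>. This evaluates the sum
  over all exponents, the sum over all even exponents and, in odd weight, the sum of type
  (even, odd, even) together with half of the depth two sum. The one further relation needed in
  each parity is a rearrangement: \<open>\<Sum> F(m,k) (H(m) - H(k-1))\<close> over \<open>m > k\<close>, with \<open>F\<close> a depth two
  restricted sum of weight \<open>l - 1\<close>, equals a combination of depth three restricted sums of weight \<open>l\<close>.
\<close>

section \<open>Harmonic numbers and finite sums\<close>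

text \<open>Two obstacles shape the proof. The first is convergence. The partial fraction terms have
  opposite signs, so each is summed separately against a nonnegative kernel. In the unrestricted
  sums the exclusion of exponent 1 at the largest variable supplies the \<open>- 1 / p\<close> that
  makes the sum over p telescope. Powers of the fixed integer k are traded between the kernel and
  the prefactor so that the prefactor has exponent at least 2 while the coefficient grows at most
  like (log k)^2. The second is that parity conditions replace n - k by n^2 - k^2 = (n - k)(n + k),
  which brings in harmonic numbers at 2k. In the all-even sum they cancel among the three residues.
  In type (even, odd, even) a remainder (H(2k) - H(k)) / (2 k^2), times 1 / k^(l-3), survives; half
  of the depth two sum of type (odd, even) contributes its negative, which explains the factor 1/2.
  The rearrangement is Hoffman's relation for zeta(a, b), with zeta(a, 1, b) added to both sides,
  summed over a parity class of pairs (a, b).\<close>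

definition harm2 :: "nat \<Rightarrow> real" where
  "harm2 n = (\<Sum>i=1..n. 1 / real i ^ 2)"

abbreviation H :: "nat \<Rightarrow> real" where "H \<equiv> harm"

lemma H_0 [simp]: "H 0 = 0"
  by (simp add: harm_expand)

lemma H_Suc: "H (Suc n) = H n + 1 / (real n + 1)"
  by (simp add: harm_Suc field_simps)

lemma harm2_0 [simp]: "harm2 0 = 0"
  by (simp add: harm2_def)

lemma harm2_Suc: "harm2 (Suc n) = harm2 n + 1 / (real n + 1) ^ 2"
  by (simp add: harm2_def add.commute)

lemma H_conv_pred: "n > 0 \<Longrightarrow> H n = H (n - 1) + 1 / real n"
  by (cases n) (auto simp: H_Suc)

lemma sum_recip: "(\<Sum>i=1..n. 1 / real i) = H n"
  unfolding harm_def by (rule sum.cong) (auto simp: divide_inverse)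

text \<open>Expanding H i makes the left side the sum of 1/(i j) over j <= i <= n, which is half of
  the full square plus the diagonal.\<close>

lemma sum_H_div: "(\<Sum>i=1..n. H i / real i) = (H n ^ 2 + harm2 n) / 2"
proof (induction n)
  case (Suc n)
  define x where "x = 1 / (real n + 1)"
  have "H (Suc n) = H n + x" "harm2 (Suc n) = harm2 n + x ^ 2"
       "H (Suc n) / real (Suc n) = H (Suc n) * x"
    by (simp_all add: H_Suc harm2_Suc x_def power_one_over add.commute)
  with Suc show ?case
    by (simp add: power2_eq_square algebra_simps)
qed simp

lemma sum_recip_shift: "(\<Sum>i=1..n. 1 / (real c + real i)) = H (c + n) - H c"
  by (induction n) (simp_all add: H_Suc add_ac)

text \<open>This is the sum of 1/(i j) over i + j <= s. Passing to s + 1 adds the antidiagonal i + j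
  = s + 1, where 1/(i j) splits into partial fractions and contributes 2 H(s) / (s + 1).\<close>

lemma sum_H_reflect: "(\<Sum>i\<in>{0<..<s}. H (s - i) / real i) = H s ^ 2 - harm2 s"
proof (induction s)
  case (Suc s)
  have split: "1 / (real i * (real s + 1 - real i)) = (1 / real i + 1 / (real s + 1 - real i)) / (real s + 1)"
    if "i \<in> {0<..<Suc s}" for i
    using that by (simp add: divide_simps of_nat_diff)
  have refl: "(\<Sum>i\<in>{0<..<Suc s}. 1 / (real s + 1 - real i)) = (\<Sum>i\<in>{0<..<Suc s}. 1 / real i)"
    by (rule sum.reindex_bij_witness[of _ "\<lambda>i. Suc s - i" "\<lambda>i. Suc s - i"]) (auto simp: of_nat_diff)
  have HS: "(\<Sum>i\<in>{0<..<Suc s}. 1 / real i) = H s"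
    unfolding harm_def by (rule sum.cong) (auto simp: divide_inverse)
  have "(\<Sum>i\<in>{0<..<Suc s}. H (Suc s - i) / real i)
      = (\<Sum>i\<in>{0<..<Suc s}. H (s - i) / real i + 1 / (real i * (real s + 1 - real i)))"
  proof (rule sum.cong)
    fix i assume i: "i \<in> {0<..<Suc s}"
    then have "H (Suc s - i) = H (s - i) + 1 / (real s + 1 - real i)"
      by (simp add: Suc_diff_le H_Suc of_nat_diff algebra_simps)
    then show "H (Suc s - i) / real i = H (s - i) / real i + 1 / (real i * (real s + 1 - real i))"
      by (simp add: add_divide_distrib mult.commute)
  qed simp
  also have "\<dots> = (\<Sum>i\<in>{0<..<Suc s}. H (s - i) / real i) + 2 * H s / (real s + 1)"
    by (simp add: sum.distrib split refl HS flip: sum_divide_distrib)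
  also have "(\<Sum>i\<in>{0<..<Suc s}. H (s - i) / real i) = (\<Sum>i\<in>{0<..<s}. H (s - i) / real i)"
    by (rule sum.mono_neutral_right) (auto simp: not_less less_Suc_eq_le)
  also have "\<dots> = H s ^ 2 - harm2 s" by (fact Suc.IH)
  finally have *: "(\<Sum>i\<in>{0<..<Suc s}. H (Suc s - i) / real i)
      = H s ^ 2 - harm2 s + 2 * H s / (real s + 1)" .
  define x where "x = 1 / (real s + 1)"
  have "H (Suc s) = H s + x" "harm2 (Suc s) = harm2 s + x ^ 2" "2 * H s / (real s + 1) = 2 * H s * x"
    by (simp_all add: H_Suc harm2_Suc x_def power_one_over)
  with * show ?case
    by (simp add: power2_eq_square algebra_simps)
qed simp

text \<open>Induction on k moves both the range and the shift. H(2k+1) enters with opposite signs,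
  from the shifted range and from the new last term, so nothing at 2k survives.\<close>

lemma sum_H_double: "(\<Sum>i=1..k. H (k + i) / real i) = H k ^ 2 + harm2 k / 2"
proof (induction k)
  case (Suc k)
  have split: "H (Suc k + i) / real i
      = H (k + i) / real i + (1 / real i - 1 / (real (Suc k) + real i)) / (real k + 1)"
    if "i \<in> {1..k}" for i
  proof -
    have "H (Suc k + i) = H (k + i) + 1 / (real k + real i + 1)"
      by (simp add: H_Suc)
    then have "H (Suc k + i) / real i = H (k + i) / real i + 1 / (real i * (real k + real i + 1))"
      using that by (simp add: add_divide_distrib mult.commute)
    also have "1 / (real i * (real k + real i + 1))
        = (1 / real i - 1 / (real (Suc k) + real i)) / (real k + 1)"
      using that by (simp add: divide_simps) (simp add: algebra_simps)
    finally show ?thesis .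
  qed
  have "(\<Sum>i=1..Suc k. H (Suc k + i) / real i)
      = (\<Sum>i=1..k. H (Suc k + i) / real i) + H (Suc (Suc (k + k))) / (real k + 1)"
    by (simp add: add_ac)
  also have "(\<Sum>i=1..k. H (Suc k + i) / real i) = (\<Sum>i=1..k. H (k + i) / real i + (1 / real i - 1 / (real (Suc k) + real i)) / (real k + 1))"
    by (rule sum.cong[OF refl split])
  also have "(\<Sum>i=1..k. H (k + i) / real i + (1 / real i - 1 / (real (Suc k) + real i)) / (real k + 1))
      = H k ^ 2 + harm2 k / 2 + (H k - (H (Suc (k + k)) - H (Suc k))) / (real k + 1)"
    unfolding sum.distrib sum_divide_distrib[symmetric] sum_subtractf sum_recip sum_recip_shift Suc.IH
    by simp
  finally have *: "(\<Sum>i=1..Suc k. H (Suc k + i) / real i)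
      = H k ^ 2 + harm2 k / 2 + (H k - (H (Suc (k + k)) - H (Suc k))) / (real k + 1)
        + H (Suc (Suc (k + k))) / (real k + 1)" .
  define x where "x = 1 / (real k + 1)"
  define y where "y = 1 / (real (k + k) + 1)"
  have half: "1 / (real (Suc (k + k)) + 1) = x / 2" by (simp add: x_def field_simps)
  have "H (Suc k) = H k + x" "harm2 (Suc k) = harm2 k + x ^ 2"
    "H (Suc (k + k)) = H (k + k) + y" "H (Suc (Suc (k + k))) = H (k + k) + y + x / 2"
    "\<And>z. z / (real k + 1) = z * x"
    by (simp_all only: H_Suc harm2_Suc half) (simp_all add: x_def y_def power_one_over)
  with * show ?case
    by (simp add: power2_eq_square algebra_simps add_divide_distrib)
qed simp

text \<open>Exchange of summation: H n - H (j - 1) is the sum of 1/i over j <= i <= n, and summing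
  1/(c + j) over j <= i gives H (c + i) - H c.\<close>

lemma sum_H_tail_div:
  "(\<Sum>j=1..n. (H n - H (j - 1)) / (real c + real j)) = (\<Sum>i=1..n. (H (c + i) - H c) / real i)"
proof (induction n)
  case (Suc n)
  have "(\<Sum>j=1..Suc n. (H (Suc n) - H (j - 1)) / (real c + real j))
      = (\<Sum>j=1..n. (H n - H (j - 1)) / (real c + real j) + (1 / (real n + 1)) * (1 / (real c + real j)))
        + (1 / (real n + 1)) * (1 / (real c + real (Suc n)))"
    by (simp add: H_Suc diff_divide_distrib add_divide_distrib sum.distrib sum_subtractf)
  also have "\<dots> = (\<Sum>i=1..n. (H (c + i) - H c) / real i)
      + (1 / (real n + 1)) * (\<Sum>j=1..Suc n. 1 / (real c + real j))"
    unfolding sum.distrib sum_distrib_left[symmetric] Suc.IH by (simp add: algebra_simps)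
  finally show ?case unfolding sum_recip_shift by (simp add: add.commute)
qed simp

lemma greaterThanLessThan_conv_atLeastAtMost: "{0<..<k} = {1..k - 1}" for k :: nat
  by auto

lemma sum_H_plus:
  assumes "k > 0"
  shows "(\<Sum>j\<in>{0<..<k}. (H k - H (j - 1)) / (real k + real j)) = harm2 k / 2 - 1 / (2 * real k ^ 2)"
proof -
  have ins: "{1..k} = insert k {0<..<k}" using assms by auto
  \<comment> \<open>With shift and length both equal to k, \<open>sum_H_tail_div\<close> reduces to
    \<open>sum_H_double\<close> and the squares of H k cancel. The extra term j = k, split off
    afterwards, equals 1/(2 k^2).\<close>
  have "(\<Sum>j=1..k. (H k - H (j - 1)) / (real k + real j)) = harm2 k / 2"
  proof -
    have "(\<Sum>i=1..k. H k / real i) = H k * (\<Sum>i=1..k. 1 / real i)"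
      by (simp add: sum_distrib_left)
    then show ?thesis
      unfolding sum_H_tail_div unfolding diff_divide_distrib sum_subtractf sum_H_double sum_recip
      by (simp add: power2_eq_square)
  qed
  moreover have "(\<Sum>j=1..k. (H k - H (j - 1)) / (real k + real j))
      = (\<Sum>j\<in>{0<..<k}. (H k - H (j - 1)) / (real k + real j)) + (H k - H (k - 1)) / (2 * real k)"
    unfolding ins by (subst sum.insert) auto
  moreover have "H k - H (k - 1) = 1 / real k" using H_conv_pred[OF assms] by simp
  ultimately show ?thesis by (simp add: power2_eq_square)
qed

lemma sum_recip_prod_reflect:
  "(\<Sum>i\<in>{0<..<k}. 1 / (real i * (real k - real i))) = 2 * H (k - 1) / real k"
proof -
  have "(\<Sum>i\<in>{0<..<k}. 1 / (real i * (real k - real i)))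
      = (\<Sum>i\<in>{0<..<k}. (1 / real i + 1 / (real k - real i)) / real k)"
    by (rule sum.cong) (auto simp: divide_simps)
  also have "\<dots> = ((\<Sum>i\<in>{0<..<k}. 1 / real i) + (\<Sum>i\<in>{0<..<k}. 1 / (real k - real i))) / real k"
    by (simp add: sum.distrib flip: sum_divide_distrib)
  also have "(\<Sum>i\<in>{0<..<k}. 1 / (real k - real i)) = (\<Sum>i\<in>{0<..<k}. 1 / real i)"
    by (rule sum.reindex_bij_witness[of _ "\<lambda>i. k - i" "\<lambda>i. k - i"]) (auto simp: of_nat_diff)
  also have "(\<Sum>i\<in>{0<..<k}. 1 / real i) = H (k - 1)"
    unfolding harm_def greaterThanLessThan_conv_atLeastAtMost by (simp add: divide_inverse)
  finally show ?thesis by simp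
qed

text \<open>The reflection j = k - i moves the subtraction from the denominator into the harmonic
  number; restoring its last term then gives the sums in \<open>sum_H_reflect\<close> and
  \<open>sum_recip_prod_reflect\<close>.\<close>

lemma sum_H_minus:
  assumes "k > 0"
  shows "(\<Sum>j\<in>{0<..<k}. (H k - H (j - 1)) / (real k - real j)) = harm2 k + H k / real k - 2 / real k ^ 2"
proof -
  have Hk: "(\<Sum>i\<in>{0<..<k}. 1 / real i) = H (k - 1)"
    unfolding harm_def greaterThanLessThan_conv_atLeastAtMost by (simp add: divide_inverse)
  have "(\<Sum>j\<in>{0<..<k}. (H k - H (j - 1)) / (real k - real j))
      = (\<Sum>i\<in>{0<..<k}. (H k - H (k - i - 1)) / real i)"
    by (rule sum.reindex_bij_witness[of _ "\<lambda>i. k - i" "\<lambda>i. k - i"]) (auto simp: of_nat_diff)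
  also have "\<dots> = (\<Sum>i\<in>{0<..<k}. H k * (1 / real i) - H (k - i) / real i + 1 / (real i * (real k - real i)))"
  proof (rule sum.cong)
    fix i assume i: "i \<in> {0<..<k}"
    then have "H (k - i) = H (k - i - 1) + 1 / (real k - real i)"
      by (subst H_conv_pred) (auto simp: of_nat_diff)
    then show "(H k - H (k - i - 1)) / real i
        = H k * (1 / real i) - H (k - i) / real i + 1 / (real i * (real k - real i))"
      by (simp add: diff_divide_distrib add_divide_distrib mult.commute)
  qed simp
  also have "\<dots> = H k * H (k - 1) - (H k ^ 2 - harm2 k) + 2 * H (k - 1) / real k"
    unfolding sum.distrib sum_subtractf sum_H_reflect sum_recip_prod_reflect
      sum_distrib_left[symmetric] Hk ..
  also have "H (k - 1) = H k - 1 / real k" using H_conv_pred[OF assms] by simp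
  finally show ?thesis
    by (simp add: power2_eq_square algebra_simps diff_divide_distrib)
qed

section \<open>Finite sums symmetric about an integer, and harmonic numbers at twice that
  integer\<close>

lemma sum_reflect: "(\<Sum>i\<in>{0<..<s}. f (s - i)) = (\<Sum>i\<in>{0<..<s}. f i)" for s :: nat
  by (rule sum.reindex_bij_witness[of _ "\<lambda>i. s - i" "\<lambda>i. s - i"]) auto

lemma harm2_conv_pred: "n > 0 \<Longrightarrow> harm2 n = harm2 (n - 1) + 1 / real n ^ 2"
  by (cases n) (auto simp: harm2_Suc add.commute)

text \<open>The denominators k - j and k + j fill the interval from k - n to k + n except for its
  centre k.\<close>

lemma sum_recip_sides:
  "n < k \<Longrightarrow> (\<Sum>j=1..n. 1 / (real k - real j) + 1 / (real k + real j))
     = H (k - 1) - H (k - n - 1) + H (k + n) - H k"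
proof (induction n)
  case (Suc n)
  have "H (k - n - 1) = H (k - Suc n - 1) + 1 / (real k - real (Suc n))"
    using Suc.prems by (subst H_conv_pred) (auto simp: of_nat_diff)
  moreover have "H (k + Suc n) = H (k + n) + 1 / (real k + real (Suc n))"
    by (simp add: H_Suc add_ac)
  ultimately show ?case using Suc by simp
qed simp

lemma sum_recip_sq_sides:
  "n < k \<Longrightarrow> (\<Sum>j=1..n. 1 / (real k - real j) ^ 2 + 1 / (real k + real j) ^ 2)
     = harm2 (k - 1) - harm2 (k - n - 1) + harm2 (k + n) - harm2 k"
proof (induction n)
  case (Suc n)
  have "harm2 (k - n - 1) = harm2 (k - Suc n - 1) + 1 / (real k - real (Suc n)) ^ 2"
    using Suc.prems by (subst harm2_conv_pred) (auto simp: of_nat_diff)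
  moreover have "harm2 (k + Suc n) = harm2 (k + n) + 1 / (real k + real (Suc n)) ^ 2"
    by (simp add: harm2_Suc add_ac)
  ultimately show ?case using Suc by simp
qed simp

lemma recip_diff_sq:
  assumes "real j < real k"
  shows "1 / (real k ^ 2 - real j ^ 2) = (1 / (real k - real j) + 1 / (real k + real j)) / (2 * real k)"
proof -
  have "real k ^ 2 - real j ^ 2 = (real k - real j) * (real k + real j)"
    by (simp add: power2_eq_square algebra_simps)
  then show ?thesis
    using assms by (simp add: divide_simps)
qed

text \<open>The constant 3/2 is 1 + 1/2: the missing centre costs 1/k, and H(2k-1) falls short of
  H(2k) by 1/(2k).\<close>

lemma sum_recip_diff_sq:
  assumes "k > 0"
  shows "(\<Sum>j\<in>{0<..<k}. 1 / (real k ^ 2 - real j ^ 2)) = (H (2 * k) - 3 / (2 * real k)) / (2 * real k)"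
proof -
  have "(\<Sum>j\<in>{0<..<k}. 1 / (real k ^ 2 - real j ^ 2))
      = (\<Sum>j=1..k-1. (1 / (real k - real j) + 1 / (real k + real j)) / (2 * real k))"
    unfolding greaterThanLessThan_conv_atLeastAtMost using assms by (intro sum.cong recip_diff_sq) auto
  also have "\<dots> = (H (k - 1) - H (k - (k - 1) - 1) + H (k + (k - 1)) - H k) / (2 * real k)"
    by (subst sum_recip_sides[symmetric]) (use assms in \<open>auto simp: sum_divide_distrib\<close>)
  also have "k + (k - 1) = 2 * k - 1" using assms by simp
  also have "H (k - 1) - H (k - (k - 1) - 1) + H (2 * k - 1) - H k = H (2 * k) - 3 / (2 * real k)"
    using assms H_conv_pred[of k] H_conv_pred[of "2 * k"] by simp
  finally show ?thesis .
qed

text \<open>Squaring the partial fraction leaves a cross term that is again a multiple of 1/(k^2 -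
  j^2); it produces the part with H(2k). The constant 5/4 is 1 + 1/4, from the missing centre and
  from the end 2k.\<close>

lemma sum_recip_diff_sq_sq:
  assumes "k > 0"
  shows "(\<Sum>j\<in>{0<..<k}. (1 / (real k ^ 2 - real j ^ 2)) ^ 2)
    = (harm2 (2 * k) - 5 / (4 * real k ^ 2) + (H (2 * k) - 3 / (2 * real k)) / real k) / (4 * real k ^ 2)"
proof -
  have "(\<Sum>j\<in>{0<..<k}. (1 / (real k ^ 2 - real j ^ 2)) ^ 2)
      = (\<Sum>j=1..k-1. ((1 / (real k - real j) ^ 2 + 1 / (real k + real j) ^ 2)
           + 2 * (1 / (real k ^ 2 - real j ^ 2))) / (4 * real k ^ 2))"
    unfolding greaterThanLessThan_conv_atLeastAtMost
  proof (intro sum.cong refl)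
    fix j assume "j \<in> {1..k-1}"
    then have j: "real j < real k" using assms by auto
    define a where "a = 1 / (real k - real j)"
    define b where "b = 1 / (real k + real j)"
    have ab: "2 * (1 / (real k ^ 2 - real j ^ 2)) = 2 * (a * b)"
      using j by (simp add: a_def b_def power2_eq_square) (simp add: algebra_simps)
    have "(1 / (real k ^ 2 - real j ^ 2)) ^ 2 = (a + b) ^ 2 / (4 * real k ^ 2)"
      unfolding recip_diff_sq[OF j] a_def b_def by (simp add: power_divide power_mult_distrib)
    also have "(a + b) ^ 2 = a ^ 2 + b ^ 2 + 2 * (a * b)"
      by (simp add: power2_eq_square algebra_simps)
    finally show "(1 / (real k ^ 2 - real j ^ 2)) ^ 2
       = ((1 / (real k - real j) ^ 2 + 1 / (real k + real j) ^ 2)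
           + 2 * (1 / (real k ^ 2 - real j ^ 2))) / (4 * real k ^ 2)"
      unfolding ab by (simp add: a_def b_def power_one_over)
  qed
  also have "\<dots> = ((harm2 (k - 1) - harm2 (k - (k - 1) - 1) + harm2 (k + (k - 1)) - harm2 k)
      + 2 * (\<Sum>j=1..k-1. 1 / (real k ^ 2 - real j ^ 2))) / (4 * real k ^ 2)"
    by (subst sum_recip_sq_sides[symmetric])
       (use assms in \<open>simp_all add: sum.distrib sum_distrib_left flip: sum_divide_distrib\<close>)
  also have "k + (k - 1) = 2 * k - 1" using assms by simp
  also have "harm2 (k - 1) - harm2 (k - (k - 1) - 1) + harm2 (2 * k - 1) - harm2 k
      = harm2 (2 * k) - 5 / (4 * real k ^ 2)"
    using assms harm2_conv_pred[of k] harm2_conv_pred[of "2 * k"]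
    by (simp add: power_mult_distrib field_simps)
  finally show ?thesis
    by (simp only: sum_recip_diff_sq[OF assms] flip: greaterThanLessThan_conv_atLeastAtMost) (simp add: diff_divide_distrib)
qed

text \<open>The range i < k is half of 0 < i < 2k, and the summand is almost invariant under i -> 2k
  - i, both of its factors changing sign. Over the full range the sum has a closed form, so the half
  sum follows by division by two, after correcting for the asymmetry.\<close>

lemma sum_H_skew:
  assumes "k > 0"
  shows "(\<Sum>i\<in>{0<..<k}. (1 / real i - 1 / (2 * real k - real i)) * (H (2 * k - i - 1) - H i))
    = (H (2 * k) ^ 2 - harm2 (2 * k)) / 2 - harm2 k + 1 / (2 * real k ^ 2)" (is "sum ?t _ = _")
proof -
  define s where "s = 2 * k"
  have s: "s > 0" "real s = 2 * real k" using assms by (auto simp: s_def)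
  define t where "t = (\<lambda>i. (1 / real i - 1 / real (s - i)) * (H (s - i - 1) - H i))"
  have Hs: "H (s - 1) = H s - 1 / (2 * real k)" and H2s: "harm2 (s - 1) = harm2 s - 1 / (4 * real k ^ 2)"
    using H_conv_pred[OF s(1)] harm2_conv_pred[OF s(1)] s by (auto simp: power_mult_distrib)
  have S1: "(\<Sum>i\<in>{0<..<s}. H i / real i) = (H (s - 1) ^ 2 + harm2 (s - 1)) / 2"
    unfolding greaterThanLessThan_conv_atLeastAtMost by (rule sum_H_div)
  have S2: "(\<Sum>i\<in>{0<..<s}. 1 / real i ^ 2) = harm2 (s - 1)"
    unfolding greaterThanLessThan_conv_atLeastAtMost harm2_def ..
  have "(\<Sum>i\<in>{0<..<s}. t i) = (\<Sum>i\<in>{0<..<s}. H (s - i) / real i - 1 / (real i * (real s - real i))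
       - H i / real i - (H (s - i) / real (s - i) - 1 / real (s - i) ^ 2) + H (s - (s - i)) / real (s - i))"
  proof (rule sum.cong[OF refl])
    fix i assume i: "i \<in> {0<..<s}"
    define b where "b = real (s - i)"
    have b: "b > 0" "real s - real i = b" using i by (auto simp: b_def of_nat_diff)
    have H: "H (s - i) = H (s - i - 1) + 1 / b"
      using i H_conv_pred[of "s - i"] by (simp add: b_def)
    show "t i = H (s - i) / real i - 1 / (real i * (real s - real i))
       - H i / real i - (H (s - i) / real (s - i) - 1 / real (s - i) ^ 2) + H (s - (s - i)) / real (s - i)"
      unfolding t_def H b using i b
      by (simp add: algebra_simps diff_divide_distrib add_divide_distrib power2_eq_square flip: b_def)
  qed
  also have "\<dots> = (H s ^ 2 - harm2 s) - 2 * H (s - 1) / real s - (H (s - 1) ^ 2 + harm2 (s - 1)) / 2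
      - ((H (s - 1) ^ 2 + harm2 (s - 1)) / 2 - harm2 (s - 1)) + (H s ^ 2 - harm2 s)"
    unfolding sum.distrib sum_subtractf sum_reflect[of "\<lambda>i. H i / real i"]
      sum_reflect[of "\<lambda>i. 1 / real i ^ 2"] sum_reflect[of "\<lambda>i. H (s - i) / real i"]
      sum_H_reflect sum_recip_prod_reflect S1 S2 ..
  finally have full: "(\<Sum>i\<in>{0<..<s}. t i) = 2 * (H s ^ 2 - harm2 s) - H (s - 1) / real k - H (s - 1) ^ 2"
    by (simp add: s(2) algebra_simps add_divide_distrib diff_divide_distrib)
  have "{0<..<s} = {0<..<k} \<union> insert k {k<..<s}" using assms by (auto simp: s_def)
  then have "(\<Sum>i\<in>{0<..<s}. t i) = (\<Sum>i\<in>{0<..<k}. t i) + (\<Sum>i\<in>insert k {k<..<s}. t i)"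
    by (simp only:) (rule sum.union_disjoint, auto)
  also have "(\<Sum>i\<in>insert k {k<..<s}. t i) = t k + (\<Sum>i\<in>{k<..<s}. t i)"
    by (subst sum.insert) auto
  also have "t k = 0" by (simp add: t_def s_def)
  also have "(\<Sum>i\<in>{k<..<s}. t i) = (\<Sum>i\<in>{0<..<k}. t (s - i))"
    by (rule sum.reindex_bij_witness[of _ "\<lambda>i. s - i" "\<lambda>i. s - i"]) (auto simp: s_def)
  \<comment> \<open>The defect of the symmetry comes from the off-by-one between H (s - i - 1) and H
    i. It is (1/i - 1/(s-i)) (1/i + 1/(s-i)), a difference of squares.\<close>
  also have "\<dots> = (\<Sum>i\<in>{0<..<k}. t i + (1 / real i ^ 2 - 1 / (real s - real i) ^ 2))"
  proof (rule sum.cong[OF refl])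
    fix i assume "i \<in> {0<..<k}"
    then have i: "0 < i" "i < s" "real (s - i) = real s - real i" by (auto simp: s_def of_nat_diff)
    then have H: "H (s - i - 1) = H (s - i) - 1 / (real s - real i)" "H (i - 1) = H i - 1 / real i"
      using H_conv_pred[of "s - i"] H_conv_pred[of i] by auto
    have e: "s - (s - i) - 1 = i - 1" "s - (s - i) = i" using i by auto
    show "t (s - i) = t i + (1 / real i ^ 2 - 1 / (real s - real i) ^ 2)"
      unfolding t_def e i(3) H
      by (simp add: algebra_simps power2_eq_square diff_divide_distrib add_divide_distrib)
  qed
  also have "\<dots> = (\<Sum>i\<in>{0<..<k}. t i) + ((\<Sum>i\<in>{0<..<k}. 1 / real i ^ 2) - (\<Sum>i\<in>{0<..<k}. 1 / (real s - real i) ^ 2))"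
    by (simp add: sum.distrib sum_subtractf)
  also have "(\<Sum>i\<in>{0<..<k}. 1 / (real s - real i) ^ 2) = (\<Sum>j=1..k-1. 1 / (real k + real j) ^ 2)"
    by (rule sum.reindex_bij_witness[of _ "\<lambda>j. k - j" "\<lambda>j. k - j"]) (auto simp: s of_nat_diff)
  also have "\<dots> = harm2 (2 * k - 1) - harm2 k"
  proof -
    have "(\<Sum>j=1..n. 1 / (real k + real j) ^ 2) = harm2 (k + n) - harm2 k" for n
      by (induction n) (auto simp: harm2_Suc add_ac)
    from this[of "k - 1"] show ?thesis using assms by (simp add: mult_2)
  qed
  also have "(\<Sum>i\<in>{0<..<k}. 1 / real i ^ 2) = harm2 (k - 1)"
    unfolding greaterThanLessThan_conv_atLeastAtMost harm2_def ..
  finally have "2 * (\<Sum>i\<in>{0<..<k}. t i) = 2 * (H s ^ 2 - harm2 s) - H (s - 1) / real k - H (s - 1) ^ 2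
      - (harm2 (k - 1) - (harm2 (s - 1) - harm2 k))"
    unfolding full by (simp add: s_def)
  also have "harm2 (k - 1) = harm2 k - 1 / real k ^ 2"
    using harm2_conv_pred[OF assms] by simp
  finally have "2 * (\<Sum>i\<in>{0<..<k}. t i) = H s ^ 2 - harm2 s - 2 * harm2 k + 1 / real k ^ 2"
    unfolding Hs H2s
    by (simp add: algebra_simps power2_eq_square diff_divide_distrib)
  moreover have "(\<Sum>i\<in>{0<..<k}. t i) = sum ?t {0<..<k}"
    by (rule sum.cong) (auto simp: t_def s_def of_nat_diff)
  ultimately show ?thesis unfolding s_def by (simp add: field_simps)
qed

text \<open>The inner sum is given by \<open>sum_recip_sides\<close>, and i = k - n then leads to
  \<open>sum_H_skew\<close> up to a shift by 1/k in the second factor. Divided by 4k, this is the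
  residue at the largest variable for type (even, odd, even).\<close>

lemma sum_nested_diff_sq:
  assumes "k > 0"
  shows "(\<Sum>n\<in>{0<..<k}. (1 / (real k - real n) - 1 / (real k + real n)) *
           (\<Sum>j\<in>{0<..<n}. 1 / (real k - real j) + 1 / (real k + real j)))
    = (H (2 * k) ^ 2 - harm2 (2 * k)) / 2 - harm2 k + H (2 * k) / real k - 2 * H k / real k + 1 / real k ^ 2"
proof -
  have "(\<Sum>n\<in>{0<..<k}. (1 / (real k - real n) - 1 / (real k + real n)) *
           (\<Sum>j\<in>{0<..<n}. 1 / (real k - real j) + 1 / (real k + real j)))
    = (\<Sum>n\<in>{0<..<k}. (1 / (real k - real n) - 1 / (real k + real n)) *
         (H (k - 1) - H (k - n) + H (k + n - 1) - H k))"
  proof (rule sum.cong[OF refl])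
    fix n assume n: "n \<in> {0<..<k}"
    then have "(\<Sum>j=1..n-1. 1 / (real k - real j) + 1 / (real k + real j))
        = H (k - 1) - H (k - (n - 1) - 1) + H (k + (n - 1)) - H k"
      by (intro sum_recip_sides) auto
    moreover have "k - (n - 1) - 1 = k - n" "k + (n - 1) = k + n - 1" using n by auto
    ultimately show "(1 / (real k - real n) - 1 / (real k + real n)) *
           (\<Sum>j\<in>{0<..<n}. 1 / (real k - real j) + 1 / (real k + real j))
        = (1 / (real k - real n) - 1 / (real k + real n)) *
         (H (k - 1) - H (k - n) + H (k + n - 1) - H k)"
      by (simp only: greaterThanLessThan_conv_atLeastAtMost)
  qed
  also have "\<dots> = (\<Sum>i\<in>{0<..<k}. (1 / real i - 1 / (2 * real k - real i)) *
      (H (2 * k - i - 1) - H i - 1 / real k))"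
  proof (rule sum.reindex_bij_witness[of _ "\<lambda>i. k - i" "\<lambda>i. k - i"])
    fix n assume n: "n \<in> {0<..<k}"
    have "2 * k - (k - n) - 1 = k + n - 1" "2 * real k - real (k - n) = real k + real n"
         "real (k - n) = real k - real n" "H (k - 1) = H k - 1 / real k"
      using n H_conv_pred[OF assms] by (auto simp: of_nat_diff)
    then show "(1 / real (k - n) - 1 / (2 * real k - real (k - n))) *
        (H (2 * k - (k - n) - 1) - H (k - n) - 1 / real k)
      = (1 / (real k - real n) - 1 / (real k + real n)) *
         (H (k - 1) - H (k - n) + H (k + n - 1) - H k)"
      by simp
  qed auto
  also have "\<dots> = (\<Sum>i\<in>{0<..<k}. (1 / real i - 1 / (2 * real k - real i)) * (H (2 * k - i - 1) - H i))
     - ((\<Sum>i\<in>{0<..<k}. 1 / real i) - (\<Sum>i\<in>{0<..<k}. 1 / (2 * real k - real i))) * (1 / real k)"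
    unfolding sum_subtractf[symmetric] sum_distrib_right
    by (intro sum.cong refl right_diff_distrib)
  also have "(\<Sum>i\<in>{0<..<k}. 1 / (2 * real k - real i)) = (\<Sum>j=1..k-1. 1 / (real k + real j))"
    by (rule sum.reindex_bij_witness[of _ "\<lambda>j. k - j" "\<lambda>j. k - j"]) (auto simp: of_nat_diff)
  also have "\<dots> = H (2 * k - 1) - H k"
    unfolding sum_recip_shift using assms by (simp add: mult_2)
  also have "(\<Sum>i\<in>{0<..<k}. 1 / real i) = H (k - 1)"
    unfolding greaterThanLessThan_conv_atLeastAtMost by (rule sum_recip)
  also have "H (k - 1) = H k - 1 / real k" using H_conv_pred[OF assms] by simp
  also have "H (2 * k - 1) = H (2 * k) - 1 / (2 * real k)"
    using H_conv_pred[of "2 * k"] assms by simp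
  finally show ?thesis
    unfolding sum_H_skew[OF assms]
    by (simp add: algebra_simps power2_eq_square diff_divide_distrib add_divide_distrib)
qed

section \<open>Series with harmonic numbers\<close>

lemma has_sum_shift: "(f has_sum S) {n<..} \<longleftrightarrow> ((\<lambda>j. f (n + j)) has_sum S) {0<..}" for n :: nat
  by (rule has_sum_reindex_bij_witness[of _ "\<lambda>j. n + j" "\<lambda>m. m - n"]) auto

lemma has_sum_Suc_iff: "(f has_sum S) {0<..} \<longleftrightarrow> ((\<lambda>j. f (Suc j)) has_sum S) UNIV"
  by (rule has_sum_reindex_bij_witness[of _ Suc "\<lambda>m. m - 1"]) auto

lemma has_sum_remove_first:
  fixes f :: "nat \<Rightarrow> real"
  assumes "(f has_sum S) {n<..}"
  shows "(f has_sum (S - f (Suc n))) {Suc n<..}"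
proof -
  have "{Suc n<..} = {n<..} - {Suc n}" by auto
  then show ?thesis
    using has_sum_Diff[OF assms has_sum_finite[of "{Suc n}" f]] by simp
qed

lemma has_sum_zeta_val:
  assumes "e \<ge> 2"
  shows "((\<lambda>k. 1 / real k ^ e) has_sum zeta_val e) {0<..}"
proof -
  have "summable (\<lambda>m. 1 / real (Suc m) ^ e)"
    using inverse_power_summable[OF assms, where 'a = real]
    by (subst (asm) summable_Suc_iff[symmetric]) (simp add: field_simps)
  then show ?thesis
    unfolding has_sum_Suc_iff zeta_val_def
    by (intro sums_nonneg_imp_has_sum summable_sums) auto
qed

lemma has_sum_recip_sq_tail: "((\<lambda>m. 1 / real m ^ 2) has_sum zeta_val 2 - harm2 k) {k<..}"
proof (induction k)
  case 0
  then show ?case using has_sum_zeta_val[of 2] by simp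
next
  case (Suc k)
  from has_sum_remove_first[OF this] show ?case by (simp add: harm2_Suc add.commute algebra_simps)
qed

lemma has_sum_telescope:
  assumes "a \<le> b"
  shows "((\<lambda>j. 1 / (real j + real a) - 1 / (real j + real b)) has_sum H b - H a) {0<..}"
  using assms
proof (induction b rule: dec_induct)
  case base
  then show ?case by (simp add: has_sum_0)
next
  case (step b)
  have "(\<lambda>j. 1 / (real (Suc j) + real b)) \<longlonglongrightarrow> 0"
    by real_asymp
  from telescope_sums'[OF this]
  have "((\<lambda>j. 1 / (real j + real b) - 1 / (real j + real (Suc b))) has_sum 1 / (real b + 1)) {0<..}"
    unfolding has_sum_Suc_iff
    by (intro sums_nonneg_imp_has_sum) (auto simp: add_ac divide_simps)
  from has_sum_add[OF step.IH this] show ?case by (simp add: H_Suc algebra_simps)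
qed

text \<open>Two values of r matter most: r = 0 gives the kernel left over when exponent 1 is
  excluded, and r = k gives the partial fractions of 2k / (m^2 - k^2).\<close>

lemma has_sum_telescope_tail:
  assumes "k \<le> n"
  shows "((\<lambda>m. 1 / (real m - real k) - 1 / (real m + real r)) has_sum H (n + r) - H (n - k)) {n<..}"
proof -
  have "n - k \<le> n + r" by simp
  from has_sum_telescope[OF this] show ?thesis
    by (subst has_sum_shift) (use assms in \<open>simp add: of_nat_diff add_ac add_diff_eq\<close>)
qed

text \<open>Raising s by one adds 1/(j (j + s + 1)), whose sum over j telescopes to H(s+1) / (s+1).
  The value is therefore the sum of H t / t over t <= s, as in \<open>sum_H_div\<close>.\<close>

lemma has_sum_H_diff_div:
  "((\<lambda>j. (H (j + s) - H j) / real j) has_sum (H s ^ 2 + harm2 s) / 2) {0<..}"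
proof (induction s)
  case (Suc s)
  have "((\<lambda>j. (H (j + s) - H j) / real j + 1 / (real s + 1) * (1 / (real j + real 0) - 1 / (real j + real (Suc s))))
      has_sum (H s ^ 2 + harm2 s) / 2 + 1 / (real s + 1) * (H (Suc s) - H 0)) {0<..}"
    by (intro has_sum_add Suc.IH has_sum_cmult_right has_sum_telescope) auto
  also have "?this \<longleftrightarrow> ((\<lambda>j. (H (j + Suc s) - H j) / real j) has_sum
      (H s ^ 2 + harm2 s) / 2 + 1 / (real s + 1) * (H (Suc s) - H 0)) {0<..}"
  proof (rule has_sum_cong)
    fix j :: nat assume "j \<in> {0<..}"
    then have "1 / (real s + 1) * (1 / (real j + real 0) - 1 / (real j + real (Suc s))) = 1 / (real j + real s + 1) / real j"
      by (simp add: divide_simps) (simp add: algebra_simps)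
    moreover have "H (j + Suc s) = H (j + s) + 1 / (real j + real s + 1)" by (simp add: H_Suc)
    ultimately show "(H (j + s) - H j) / real j + 1 / (real s + 1) * (1 / (real j + real 0) - 1 / (real j + real (Suc s)))
       = (H (j + Suc s) - H j) / real j"
      by (simp only: add_divide_distrib diff_divide_distrib)
  qed
  also have "(H s ^ 2 + harm2 s) / 2 + 1 / (real s + 1) * (H (Suc s) - H 0) = (H (Suc s) ^ 2 + harm2 (Suc s)) / 2"
  proof -
    define x where "x = 1 / (real s + 1)"
    have "H (Suc s) = H s + x" "harm2 (Suc s) = harm2 s + x ^ 2"
      by (simp_all add: H_Suc harm2_Suc x_def power_one_over)
    then show ?thesis unfolding x_def[symmetric]
      by (simp add: power2_eq_square algebra_simps add_divide_distrib)
  qed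
  finally show ?case .
qed (simp add: has_sum_0)

text \<open>Adding 1/(j (j + s)) turns H j into H (j - 1) and raises the sum to zeta(2), whatever s
  is. Dropping the term j = 1 and renaming j to j + 1 then gives the case s + 1.\<close>

lemma has_sum_H_diff_div_shift:
  assumes "s > 0"
  shows "((\<lambda>j. (H (j + s) - H j) / (real j + real s)) has_sum zeta_val 2 - H s / real s) {0<..}"
  using assms
proof (induction s rule: nat_induct_non_zero)
  case 1
  have "((\<lambda>j. 1 / real (1 + j) ^ 2) has_sum zeta_val 2 - harm2 1) {0<..}"
    using has_sum_recip_sq_tail[of 1] by (subst (asm) has_sum_shift)
  then show ?case
    by (simp add: H_Suc harm2_Suc power2_eq_square add_ac)
next
  case (Suc s)
  let ?g = "\<lambda>j. (H (j + s) - H (j - 1)) / (real j + real s)"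
  have "((\<lambda>j. (H (j + s) - H j) / (real j + real s) + 1 / real s * (1 / (real j + real 0) - 1 / (real j + real s)))
      has_sum (zeta_val 2 - H s / real s) + 1 / real s * (H s - H 0)) {0<..}"
    by (intro has_sum_add Suc.IH has_sum_cmult_right has_sum_telescope) auto
  also have "?this \<longleftrightarrow> (?g has_sum zeta_val 2) {0<..}"
  proof (rule has_sum_cong_neutral[THEN trans, OF _ _ _ arg_cong[where f = "\<lambda>x. (?g has_sum x) {0<..}"]], goal_cases)
    case (3 j)
    then have "j > 0" by simp
    then have "1 / real s * (1 / (real j + real 0) - 1 / (real j + real s)) = 1 / real j / (real j + real s)"
      using Suc.hyps by (simp add: divide_simps)
    moreover have "H (j - 1) = H j - 1 / real j" using H_conv_pred[OF \<open>j > 0\<close>] by simp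
    ultimately show ?case by (simp only: add_divide_distrib diff_divide_distrib)
  qed auto
  finally have "(?g has_sum zeta_val 2 - ?g 1) {1<..}"
    using has_sum_remove_first[where f = ?g and n = 0 and S = "zeta_val 2"] by simp
  then have "((\<lambda>j. ?g (1 + j)) has_sum zeta_val 2 - ?g 1) {0<..}"
    by (subst (asm) has_sum_shift)
  then show ?case by (simp add: add_ac)
qed

text \<open>These are the inner sums that appear when \<open>has_sum_H_kernel\<close> is summed in
  the other order. From k to k + 1 the numerator gains 1/(n + k) and 1/(n - k - 1); divided by n,
  both telescope, and the range loses n = k + 1.\<close>

lemma has_sum_H_diff_pred:
  assumes "k > 0"
  shows "((\<lambda>n. (H (n - 1 + k) - H (n - 1 - k)) / real n) has_sum
            zeta_val 2 + harm2 k / 2 - (H (2 * k) - H k) / real k) {k<..}"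
  using assms
proof (induction k rule: nat_induct_non_zero)
  case 1
  have "((\<lambda>n. 1 / real n ^ 2 + (1 / (real n - real 1) - 1 / (real n + real 0))) has_sum
       (zeta_val 2 - harm2 1) + (H (1 + 0) - H (1 - 1))) {1<..}"
    by (intro has_sum_add has_sum_recip_sq_tail has_sum_telescope_tail) auto
  also have "?this \<longleftrightarrow> ((\<lambda>n. (H (n - 1 + 1) - H (n - 1 - 1)) / real n) has_sum
       (zeta_val 2 - harm2 1) + (H (1 + 0) - H (1 - 1))) {1<..}"
  proof (rule has_sum_cong)
    fix n :: nat assume n: "n \<in> {1<..}"
    have "1 / (real n - 1) - 1 / real n = 1 / (real n - 1) / real n"
      using n by (simp add: divide_simps)
    moreover have "H n = H (n - 1) + 1 / real n" "H (n - 1) = H (n - 1 - 1) + 1 / (real n - 1)"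
      using n H_conv_pred[of n] H_conv_pred[of "n - 1"] by (auto simp: of_nat_diff)
    ultimately show "1 / real n ^ 2 + (1 / (real n - real 1) - 1 / (real n + real 0))
        = (H (n - 1 + 1) - H (n - 1 - 1)) / real n"
      using n by (simp add: add_divide_distrib power2_eq_square)
  qed
  finally show ?case by (simp add: harm2_Suc H_Suc numeral_2_eq_2)
next
  case (Suc k)
  let ?f = "\<lambda>k n. (H (n - 1 + k) - H (n - 1 - k)) / real n"
  let ?G = "zeta_val 2 + harm2 k / 2 - (H (2 * k) - H k) / real k"
  have "((\<lambda>n. ?f k n + 1 / real k * (1 / (real n - real 0) - 1 / (real n + real k))
        + 1 / (real k + 1) * (1 / (real n - real (Suc k)) - 1 / (real n + real 0))) has_sum
      (?G - ?f k (Suc k)) + 1 / real k * (H (Suc k + k) - H (Suc k - 0))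
        + 1 / (real k + 1) * (H (Suc k + 0) - H (Suc k - Suc k))) {Suc k<..}"
    by (intro has_sum_add has_sum_remove_first Suc.IH has_sum_cmult_right has_sum_telescope_tail) auto
  also have "?this \<longleftrightarrow> (?f (Suc k) has_sum
      (?G - ?f k (Suc k)) + 1 / real k * (H (Suc k + k) - H (Suc k - 0))
        + 1 / (real k + 1) * (H (Suc k + 0) - H (Suc k - Suc k))) {Suc k<..}"
  proof (rule has_sum_cong)
    fix n :: nat assume n: "n \<in> {Suc k<..}"
    have "1 / real k * (1 / (real n - real 0) - 1 / (real n + real k)) = 1 / (real n + real k) / real n"
      using n Suc.hyps by (simp add: divide_simps)
    moreover have "1 / (real k + 1) * (1 / (real n - real (Suc k)) - 1 / (real n + real 0))
      = 1 / (real n - real (Suc k)) / real n"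
      using n by (simp add: divide_simps)
    moreover have "H (n - 1 + Suc k) = H (n - 1 + k) + 1 / (real n + real k)"
      using n H_conv_pred[of "n - 1 + Suc k"] by (simp add: of_nat_diff)
    moreover have "H (n - 1 - k) = H (n - 1 - Suc k) + 1 / (real n - real (Suc k))"
      using n H_conv_pred[of "n - 1 - k"] by (simp add: of_nat_diff)
    ultimately show "?f k n + 1 / real k * (1 / (real n - real 0) - 1 / (real n + real k))
        + 1 / (real k + 1) * (1 / (real n - real (Suc k)) - 1 / (real n + real 0)) = ?f (Suc k) n"
      by (simp add: add_divide_distrib diff_divide_distrib)
  qed
  also have "(?G - ?f k (Suc k)) + 1 / real k * (H (Suc k + k) - H (Suc k - 0))
        + 1 / (real k + 1) * (H (Suc k + 0) - H (Suc k - Suc k))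
      = zeta_val 2 + harm2 (Suc k) / 2 - (H (2 * Suc k) - H (Suc k)) / real (Suc k)"
  proof -
    define x where "x = 1 / (real k + 1)"
    define y where "y = 1 / (2 * real k + 1)"
    define z where "z = 1 / real k"
    \<comment> \<open>This identity among the reciprocals of k, k + 1 and 2k + 1 is the only
      relation that the remaining comparison needs; otherwise they act as independent
      variables.\<close>
    have xyz: "z * y - z * x + x * y = 0"
      using Suc.hyps by (simp add: x_def y_def z_def divide_simps)
    have H: "H (Suc k) = H k + x" "harm2 (Suc k) = harm2 k + x ^ 2" "H (Suc k + k) = H (2 * k) + y"
      "H (2 * Suc k) = H (2 * k) + y + x / 2"
      by (simp_all add: H_Suc harm2_Suc x_def y_def power_one_over mult_2[symmetric])
    have d: "a / real k = a * z" "a / real (Suc k) = a * x" "a / (1 + real k) = a * x" for a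
      by (simp_all add: z_def x_def add.commute)
    have "(?G - ?f k (Suc k)) + 1 / real k * (H (Suc k + k) - H (Suc k - 0))
        + 1 / (real k + 1) * (H (Suc k + 0) - H (Suc k - Suc k))
      = zeta_val 2 + harm2 k / 2 - (H (2 * k) - H k) * z - H (2 * k) * x + z * (H (Suc k + k) - H (Suc k))
         + x * H (Suc k)"
      by (simp add: d mult_2 flip: x_def z_def)
    also have "\<dots> = zeta_val 2 + (harm2 k + x ^ 2) / 2 - (H (2 * k) + y + x / 2 - (H k + x)) * x
        + (z * y - z * x + x * y)"
      unfolding H by (simp add: algebra_simps power2_eq_square add_divide_distrib)
    also have "\<dots> = zeta_val 2 + harm2 (Suc k) / 2 - (H (2 * Suc k) - H (Suc k)) / real (Suc k)"
      unfolding xyz d H by simp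
    finally show ?thesis .
  qed
  finally show ?case .
qed

section \<open>Interchange of summation, and the kernel with a harmonic weight\<close>

lemma has_sum_Sigma_nonneg:
  fixes f :: "'a \<Rightarrow> 'b \<Rightarrow> real"
  assumes "\<And>x. x \<in> A \<Longrightarrow> (f x has_sum g x) (B x)" "(g has_sum S) A"
    and "\<And>x y. x \<in> A \<Longrightarrow> y \<in> B x \<Longrightarrow> f x y \<ge> 0"
  shows "((\<lambda>(x, y). f x y) has_sum S) (Sigma A B)"
proof (rule has_sum_SigmaI[where g = g])
  show "(\<lambda>(x, y). f x y) summable_on Sigma A B"
    by (rule summable_on_SigmaI[where g = g]) (use assms in \<open>auto simp: summable_on_def\<close>)
qed (use assms in auto)

text \<open>Tonelli's theorem for two fibrations of the same set of pairs; nonnegativity supplies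
  the joint summability.\<close>

lemma has_sum_swap_nonneg:
  fixes f :: "'a \<Rightarrow> 'b \<Rightarrow> real"
  assumes "\<And>x. x \<in> A \<Longrightarrow> (f x has_sum g x) (B x)" "(g has_sum S) A"
    and "\<And>y. y \<in> A' \<Longrightarrow> ((\<lambda>x. f x y) has_sum h y) (B' y)"
    and "\<And>x y. x \<in> A \<and> y \<in> B x \<longleftrightarrow> y \<in> A' \<and> x \<in> B' y"
    and "\<And>x y. x \<in> A \<Longrightarrow> y \<in> B x \<Longrightarrow> f x y \<ge> 0"
  shows "(h has_sum S) A'"
proof -
  have "((\<lambda>(x, y). f x y) has_sum S) (Sigma A B)"
    by (rule has_sum_Sigma_nonneg[OF assms(1,2,5)])
  also have "?this \<longleftrightarrow> ((\<lambda>(y, x). f x y) has_sum S) (Sigma A' B')"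
    by (rule has_sum_reindex_bij_witness[of _ "\<lambda>(y, x). (x, y)" "\<lambda>(x, y). (y, x)"]) (use assms(4) in auto)
  finally show ?thesis
    by (rule has_sum_SigmaD) (use assms(3) in auto)
qed

text \<open>Write H m - H k as the sum of 1/n over k < n <= m and sum over m >= n first: the kernel
  telescopes there, and \<open>has_sum_H_diff_pred\<close> handles the sum over n.\<close>

lemma has_sum_H_kernel:
  assumes "k > 0"
  shows "((\<lambda>m. (H m - H (k - 1)) * (1 / (real m - real k) - 1 / (real m + real k)))
            has_sum zeta_val 2 + harm2 k / 2 + H k / real k) {k<..}"
proof -
  let ?c = "\<lambda>m. 1 / (real m - real k) - 1 / (real m + real k)"
  have "((\<lambda>m. ?c m * (H m - H k)) has_sum zeta_val 2 + harm2 k / 2 - (H (2 * k) - H k) / real k) {k<..}"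
  proof (rule has_sum_swap_nonneg[where f = "\<lambda>n m. 1 / real n * ?c m" and A = "{k<..}" and B = "\<lambda>n. {n..}"
        and B' = "\<lambda>m. {k<..m}" and g = "\<lambda>n. (H (n - 1 + k) - H (n - 1 - k)) / real n"])
    fix n assume n: "n \<in> {k<..}"
    then have "{n..} = {n - 1<..}" by auto
    then show "((\<lambda>m. 1 / real n * ?c m) has_sum (H (n - 1 + k) - H (n - 1 - k)) / real n) {n..}"
      using has_sum_cmult_right[OF has_sum_telescope_tail[of k "n - 1" k], of "1 / real n"] n by simp
  next
    fix m assume m: "m \<in> {k<..}"
    have "(\<Sum>n\<in>{k<..m}. 1 / real n) = (\<Sum>i=1..m-k. 1 / (real k + real i))"
      by (rule sum.reindex_bij_witness[of _ "\<lambda>i. k + i" "\<lambda>n. n - k"]) auto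
    also have "\<dots> = H m - H k"
      using m by (subst sum_recip_shift) simp
    finally have "(\<Sum>n\<in>{k<..m}. 1 / real n) = H m - H k" .
    then have "(\<Sum>n\<in>{k<..m}. 1 / real n * ?c m) = ?c m * (H m - H k)"
      unfolding sum_distrib_right[symmetric] by simp
    then show "((\<lambda>n. 1 / real n * ?c m) has_sum ?c m * (H m - H k)) {k<..m}"
      by (intro has_sum_finiteI) auto
  next
    fix n m assume "n \<in> {k<..}" "m \<in> {n..}"
    then show "1 / real n * ?c m \<ge> 0"
      by (intro mult_nonneg_nonneg) (auto intro!: divide_left_mono)
  qed (use has_sum_H_diff_pred[OF assms] in auto)
  \<comment> \<open>Replacing H k by H (k - 1) adds 1/k times the kernel, whose sum is H(2k); this
    cancels the H(2k)/k found so far.\<close>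
  from has_sum_add[OF this has_sum_cmult_right[OF has_sum_telescope_tail[of k k k], of "1 / real k"]]
  have "((\<lambda>m. ?c m * (H m - H k) + 1 / real k * ?c m) has_sum
     zeta_val 2 + harm2 k / 2 + H k / real k) {k<..}"
    by (simp add: diff_divide_distrib mult_2 add.assoc)
  moreover have "(\<lambda>m. (H m - H (k - 1)) * ?c m) = (\<lambda>m. ?c m * (H m - H k) + 1 / real k * ?c m)"
  proof
    fix m
    have "H m - H (k - 1) = (H m - H k) + 1 / real k" using H_conv_pred[OF assms] by simp
    then show "(H m - H (k - 1)) * ?c m = ?c m * (H m - H k) + 1 / real k * ?c m"
      by (simp only: distrib_right mult.commute)
  qed
  ultimately show ?thesis by simp
qed

section \<open>Sums over chains of integers\<close>

text \<open>The squared harmonic number at 2k serves as (log k)^2. It is at least 1 for positive k,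
  so it also bounds constants and first powers, and it dominates all the residue coefficients
  below.\<close>

definition log_bounded :: "(nat \<Rightarrow> real) \<Rightarrow> bool" where
  "log_bounded f \<longleftrightarrow> (\<exists>C. \<forall>k>0. \<bar>f k\<bar> \<le> C * H (2 * k) ^ 2)"

lemma H_ge_1: "n > 0 \<Longrightarrow> H n \<ge> 1"
  using harm_mono[of 1 n, where 'a = real] by (simp add: harm_expand)

lemma H_sq_ge_1: "k > 0 \<Longrightarrow> H (2 * k) ^ 2 \<ge> 1"
  using H_ge_1[of "2 * k"] by simp

lemma H_le_H_sq:
  assumes "k > 0" "n \<le> 2 * k"
  shows "H n \<le> H (2 * k) ^ 2"
proof -
  have "H n \<le> H (2 * k)" using assms by (intro harm_mono)
  also have "\<dots> \<le> H (2 * k) ^ 2"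
    using H_ge_1[of "2 * k"] assms by (simp add: power2_eq_square)
  finally show ?thesis .
qed

lemma harm2_nonneg: "harm2 n \<ge> 0"
  by (simp add: harm2_def sum_nonneg)

lemma harm2_le_H: "harm2 n \<le> H n"
proof (induction n)
  case (Suc n)
  have "1 / (real n + 1) ^ 2 \<le> 1 / (real n + 1)"
    by (simp add: divide_simps power2_eq_square)
  with Suc show ?case by (simp add: harm2_Suc H_Suc)
qed simp

lemma log_bounded_const: "log_bounded (\<lambda>_. c)"
  unfolding log_bounded_def
proof (intro exI[of _ "\<bar>c\<bar>"] allI impI)
  fix k :: nat assume "k > 0"
  from mult_left_mono[OF H_sq_ge_1[OF this], of "\<bar>c\<bar>"] show "\<bar>c\<bar> \<le> \<bar>c\<bar> * H (2 * k) ^ 2" by simp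
qed

lemma log_bounded_H: "log_bounded H" and log_bounded_H2: "log_bounded (\<lambda>k. H (2 * k))"
  unfolding log_bounded_def
  by (rule exI[of _ 1], auto intro!: H_le_H_sq)+

lemma log_bounded_H_sq: "log_bounded (\<lambda>k. H (2 * k) ^ 2)"
  unfolding log_bounded_def by (rule exI[of _ 1]) auto

lemma log_bounded_harm2: "log_bounded harm2" "log_bounded (\<lambda>k. harm2 (2 * k))"
  unfolding log_bounded_def
  by (rule exI[of _ 1], auto simp: harm2_nonneg intro!: order_trans[OF harm2_le_H H_le_H_sq])+

lemma log_bounded_mult_H: "log_bounded (\<lambda>k. H k * H k)"
  unfolding log_bounded_def
  by (rule exI[of _ 1]) (auto simp: power2_eq_square harm_nonneg intro!: mult_mono harm_mono)

lemma log_bounded_le: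
  assumes "log_bounded g" "\<And>k. k > 0 \<Longrightarrow> \<bar>f k\<bar> \<le> \<bar>g k\<bar>"
  shows "log_bounded f"
  using assms unfolding log_bounded_def by (meson order_trans)

lemma log_bounded_cmult:
  assumes "log_bounded f"
  shows "log_bounded (\<lambda>k. c * f k)"
proof -
  from assms obtain C where C: "\<And>k. k > 0 \<Longrightarrow> \<bar>f k\<bar> \<le> C * H (2 * k) ^ 2"
    by (auto simp: log_bounded_def)
  show ?thesis unfolding log_bounded_def
    by (rule exI[of _ "\<bar>c\<bar> * C"]) (use C in \<open>auto simp: abs_mult mult.assoc intro!: mult_left_mono\<close>)
qed

lemma log_bounded_add:
  assumes "log_bounded f" "log_bounded g"
  shows "log_bounded (\<lambda>k. f k + g k)"
proof -
  from assms obtain C D where CD: "\<And>k. k > 0 \<Longrightarrow> \<bar>f k\<bar> \<le> C * H (2 * k) ^ 2"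
    "\<And>k. k > 0 \<Longrightarrow> \<bar>g k\<bar> \<le> D * H (2 * k) ^ 2"
    by (auto simp: log_bounded_def)
  show ?thesis unfolding log_bounded_def
  proof (intro exI[of _ "C + D"] allI impI)
    fix k :: nat assume "k > 0"
    from CD[OF this] show "\<bar>f k + g k\<bar> \<le> (C + D) * H (2 * k) ^ 2"
      by (simp add: distrib_right)
  qed
qed

lemma log_bounded_diff: "log_bounded f \<Longrightarrow> log_bounded g \<Longrightarrow> log_bounded (\<lambda>k. f k - g k)"
  using log_bounded_add[of f "\<lambda>k. -1 * g k"] log_bounded_cmult[of g "-1"] by simp

lemma log_bounded_divide_const: "log_bounded f \<Longrightarrow> log_bounded (\<lambda>k. f k / c)"
  using log_bounded_cmult[of f "1 / c"] by simp

lemma log_bounded_divide_power: "log_bounded f \<Longrightarrow> log_bounded (\<lambda>k. f k / real k ^ j)"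
proof (erule log_bounded_le)
  fix k :: nat assume "k > 0"
  then have "1 \<le> real k ^ j" by simp
  then show "\<bar>f k / real k ^ j\<bar> \<le> \<bar>f k\<bar>"
    by (simp add: abs_div divide_le_eq mult_left_le_one_le mult_right_le_one_le)
       (metis abs_ge_zero mult.right_neutral mult_left_mono)
qed

lemma log_bounded_divide: "log_bounded f \<Longrightarrow> log_bounded (\<lambda>k. f k / real k)"
  using log_bounded_divide_power[of f 1] by simp

lemmas log_bounded_intros = log_bounded_const log_bounded_H log_bounded_H2 log_bounded_H_sq
  log_bounded_harm2 log_bounded_add log_bounded_diff log_bounded_cmult log_bounded_divide_const
  log_bounded_divide_power log_bounded_divide log_bounded_mult_H

lemma H_le_ln: "n > 0 \<Longrightarrow> H n \<le> 1 + ln (real n)"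
  using euler_mascheroni_sequence_decreasing[of 1 n] by (simp add: harm_expand)

text \<open>The logarithmic bound on H makes the terms O(k^(-3/2)).\<close>

lemma summable_H_sq: "(\<lambda>k. H (2 * k) ^ 2 / real k ^ 2) summable_on {0<..}"
proof -
  have "summable (\<lambda>k. (1 + ln (real (2 * k))) ^ 2 / real k ^ 2)"
  proof (rule summable_comparison_test_bigo)
    show "summable (\<lambda>k. norm (real k powr (- 3 / 2)))"
      by (simp add: summable_real_powr_iff)
    show "(\<lambda>k. (1 + ln (real (2 * k))) ^ 2 / real k ^ 2) \<in> O(\<lambda>k. real k powr (- 3 / 2))"
      by real_asymp
  qed
  then have "(\<lambda>k. (1 + ln (real (2 * k))) ^ 2 / real k ^ 2) summable_on {0<..}"
    by (intro summable_on_subset_banach[OF summable_nonneg_imp_summable_on]) auto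
  then show ?thesis
  proof (rule summable_on_comparison_test)
    fix k :: nat assume "k \<in> {0<..}"
    then show "H (2 * k) ^ 2 / real k ^ 2 \<le> (1 + ln (real (2 * k))) ^ 2 / real k ^ 2"
      by (intro divide_right_mono power_mono H_le_ln) (auto simp: harm_nonneg)
  qed auto
qed

lemma summable_log_bounded:
  assumes "log_bounded f" "e \<ge> 2"
  shows "(\<lambda>k. 1 / real k ^ e * f k) summable_on {0<..}"
proof -
  from assms obtain C where C: "\<And>k. k > 0 \<Longrightarrow> \<bar>f k\<bar> \<le> C * H (2 * k) ^ 2"
    by (auto simp: log_bounded_def)
  have "(\<lambda>k. norm (1 / real k ^ e * f k)) summable_on {0<..}"
  proof (rule summable_on_comparison_test[OF summable_on_cmult_right[OF summable_H_sq, of C]])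
    fix k :: nat assume k: "k \<in> {0<..}"
    then have "norm (1 / real k ^ e * f k) = \<bar>f k\<bar> / real k ^ e"
      by (simp add: abs_mult)
    also have "\<dots> \<le> (C * H (2 * k) ^ 2) / real k ^ 2"
      using k C[of k] assms(2) by (intro frac_le power_increasing) auto
    finally show "norm (1 / real k ^ e * f k) \<le> C * (H (2 * k) ^ 2 / real k ^ 2)" by simp
  qed auto
  then show ?thesis by (rule abs_summable_summable)
qed

section \<open>Series over decreasing pairs and triples\<close>

definition chains2 :: "(nat \<times> nat) set" where
  "chains2 = {(m, k). 0 < k \<and> k < m}"

definition chains3 :: "(nat \<times> nat \<times> nat) set" where
  "chains3 = {(p, n, k). 0 < k \<and> k < n \<and> n < p}"

lemma chains2_low:
  assumes "\<And>k. k > 0 \<Longrightarrow> ((\<lambda>m. f m k) has_sum g k) {k<..}" "(g has_sum S) {0<..}"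
    and "\<And>m k. 0 < k \<Longrightarrow> k < m \<Longrightarrow> f m k \<ge> (0::real)"
  shows "((\<lambda>(m, k). f m k) has_sum S) chains2"
proof -
  have "((\<lambda>(k, m). f m k) has_sum S) (Sigma {0<..} (\<lambda>k. {k<..}))"
    by (rule has_sum_Sigma_nonneg[where g = g]) (use assms in auto)
  also have "?this \<longleftrightarrow> ?thesis"
    by (rule has_sum_reindex_bij_witness[of _ "\<lambda>(m, k). (k, m)" "\<lambda>(k, m). (m, k)"]) (auto simp: chains2_def)
  finally show ?thesis .
qed

lemma chains2_high:
  assumes "((\<lambda>m. \<Sum>k\<in>{0<..<m}. f m k) has_sum S) {0<..}"
    and "\<And>m k. 0 < k \<Longrightarrow> k < m \<Longrightarrow> f m k \<ge> (0::real)"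
  shows "((\<lambda>(m, k). f m k) has_sum S) chains2"
proof -
  have "((\<lambda>(m, k). f m k) has_sum S) (Sigma {0<..} (\<lambda>m. {0<..<m}))"
    by (rule has_sum_Sigma_nonneg[OF has_sum_finite assms(1)]) (use assms in auto)
  also have "Sigma {0<..} (\<lambda>m. {0<..<m}) = chains2" by (auto simp: chains2_def)
  finally show ?thesis .
qed

lemma has_sum_diff:
  fixes f g :: "'a \<Rightarrow> real"
  assumes "(f has_sum a) A" "(g has_sum b) A"
  shows "((\<lambda>x. f x - g x) has_sum (a - b)) A"
  using has_sum_add[OF assms(1) has_sum_cmult_right[OF assms(2), of "-1"]] by simp

lemma infsum_diff:
  fixes f g :: "'a \<Rightarrow> real"
  assumes "f summable_on A" "g summable_on A"
  shows "(\<Sum>\<^sub>\<infinity>x\<in>A. f x - g x) = infsum f A - infsum g A"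
  by (intro infsumI has_sum_diff has_sum_infsum assms)

text \<open>The two signs are summed apart: where \<open>\<phi>\<close> sits at the smaller variable
  the infinite sum over the larger one is done first, and where it sits at the larger variable the
  inner sum is finite. Both results are then series in the variable carrying \<open>\<phi>\<close>
  and can be merged.\<close>

lemma chains2_residues:
  fixes \<phi> :: "nat \<Rightarrow> real"
  assumes "\<And>m k. 0 < k \<Longrightarrow> k < m \<Longrightarrow> a m k \<ge> 0" "\<And>m k. 0 < k \<Longrightarrow> k < m \<Longrightarrow> b m k \<ge> 0"
    and "\<And>k. \<phi> k \<ge> 0"
    and "\<And>k. k > 0 \<Longrightarrow> ((\<lambda>m. a m k) has_sum \<alpha> k) {k<..}"
    and "\<And>m. m > 0 \<Longrightarrow> (\<Sum>k\<in>{0<..<m}. b m k) = \<beta> m"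
    and "(\<lambda>k. \<phi> k * \<alpha> k) summable_on {0<..}" "(\<lambda>k. \<phi> k * \<beta> k) summable_on {0<..}"
  shows "((\<lambda>(m, k). \<phi> k * a m k - \<phi> m * b m k) has_sum (\<Sum>\<^sub>\<infinity>k\<in>{0<..}. \<phi> k * (\<alpha> k - \<beta> k))) chains2"
proof -
  have 1: "((\<lambda>(m, k). \<phi> k * a m k) has_sum (\<Sum>\<^sub>\<infinity>k\<in>{0<..}. \<phi> k * \<alpha> k)) chains2"
    by (rule chains2_low[OF has_sum_cmult_right[OF assms(4)] has_sum_infsum]) (use assms in auto)
  have "((\<lambda>m. \<Sum>k\<in>{0<..<m}. \<phi> m * b m k) has_sum (\<Sum>\<^sub>\<infinity>k\<in>{0<..}. \<phi> k * \<beta> k)) {0<..}"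
    using has_sum_infsum[OF assms(7)]
    by (rule has_sum_cong[THEN iffD1, rotated]) (use assms(5) in \<open>simp flip: sum_distrib_left\<close>)
  then have 2: "((\<lambda>(m, k). \<phi> m * b m k) has_sum (\<Sum>\<^sub>\<infinity>k\<in>{0<..}. \<phi> k * \<beta> k)) chains2"
    by (rule chains2_high) (use assms in auto)
  from has_sum_diff[OF 1 2] show ?thesis
    using infsum_diff[OF assms(6,7)] by (simp add: case_prod_unfold right_diff_distrib)
qed

text \<open>The first three forms fibre the triples over their least, middle and greatest entry; the
  last three leave k, n and p respectively as the innermost variable over a pair.\<close>

lemma chains3_reindex:
  "((\<lambda>(p, n, k). f p n k) has_sum S) chains3 \<longleftrightarrow> ((\<lambda>(k, n, p). f p n k) has_sum S) (SIGMA k:{0<..}. SIGMA n:{k<..}. {n<..})"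
  "((\<lambda>(p, n, k). f p n k) has_sum S) chains3 \<longleftrightarrow> ((\<lambda>(n, k, p). f p n k) has_sum S) (SIGMA n:{0<..}. SIGMA k:{0<..<n}. {n<..})"
  "((\<lambda>(p, n, k). f p n k) has_sum S) chains3 \<longleftrightarrow> ((\<lambda>(p, n, k). f p n k) has_sum S) (SIGMA p:{0<..}. SIGMA n:{0<..<p}. {0<..<n})"
  "((\<lambda>(p, n, k). f p n k) has_sum S) chains3 \<longleftrightarrow> ((\<lambda>((p, n), k). f p n k) has_sum S) (SIGMA (p, n):chains2. {0<..<n})"
  "((\<lambda>(p, n, k). f p n k) has_sum S) chains3 \<longleftrightarrow> ((\<lambda>((p, k), n). f p n k) has_sum S) (SIGMA (p, k):chains2. {k<..<p})"
  "((\<lambda>(p, n, k). f p n k) has_sum S) chains3 \<longleftrightarrow> ((\<lambda>((n, k), p). f p n k) has_sum S) (SIGMA (n, k):chains2. {n<..})"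
       apply (rule has_sum_reindex_bij_witness[of _ "\<lambda>(k, n, p). (p, n, k)" "\<lambda>(p, n, k). (k, n, p)"]; auto simp: chains3_def)
      apply (rule has_sum_reindex_bij_witness[of _ "\<lambda>(n, k, p). (p, n, k)" "\<lambda>(p, n, k). (n, k, p)"]; auto simp: chains3_def)
     apply (rule has_sum_reindex_bij_witness[of _ "\<lambda>(p, n, k). (p, n, k)" "\<lambda>(p, n, k). (p, n, k)"]; auto simp: chains3_def)
    apply (rule has_sum_reindex_bij_witness[of _ "\<lambda>((p, n), k). (p, n, k)" "\<lambda>(p, n, k). ((p, n), k)"]; auto simp: chains3_def chains2_def)
   apply (rule has_sum_reindex_bij_witness[of _ "\<lambda>((p, k), n). (p, n, k)" "\<lambda>(p, n, k). ((p, k), n)"]; auto simp: chains3_def chains2_def)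
  apply (rule has_sum_reindex_bij_witness[of _ "\<lambda>((n, k), p). (p, n, k)" "\<lambda>(p, n, k). ((n, k), p)"]; auto simp: chains3_def chains2_def)
  done

lemma chains3_low:
  assumes "\<And>n k. 0 < k \<Longrightarrow> k < n \<Longrightarrow> ((\<lambda>p. f p n k) has_sum g n k) {n<..}"
    and "\<And>k. k > 0 \<Longrightarrow> ((\<lambda>n. g n k) has_sum h k) {k<..}" "(h has_sum S) {0<..}"
    and "\<And>p n k. 0 < k \<Longrightarrow> k < n \<Longrightarrow> n < p \<Longrightarrow> f p n k \<ge> (0::real)"
  shows "((\<lambda>(p, n, k). f p n k) has_sum S) chains3"
  unfolding chains3_reindex(1)
proof (rule has_sum_Sigma_nonneg[where g = h and f = "\<lambda>k (n, p). f p n k"])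
  fix k :: nat assume "k \<in> {0<..}"
  then show "((\<lambda>(n, p). f p n k) has_sum h k) (SIGMA n:{k<..}. {n<..})"
    by (intro has_sum_Sigma_nonneg[where g = "\<lambda>n. g n k"]) (use assms in auto)
qed (use assms in auto)

lemma chains3_mid:
  assumes "\<And>n k. 0 < k \<Longrightarrow> k < n \<Longrightarrow> ((\<lambda>p. f p n k) has_sum g n k) {n<..}"
    and "((\<lambda>n. \<Sum>k\<in>{0<..<n}. g n k) has_sum S) {0<..}"
    and "\<And>p n k. 0 < k \<Longrightarrow> k < n \<Longrightarrow> n < p \<Longrightarrow> f p n k \<ge> (0::real)"
  shows "((\<lambda>(p, n, k). f p n k) has_sum S) chains3"
  unfolding chains3_reindex(2)
proof (rule has_sum_Sigma_nonneg[where f = "\<lambda>n (k, p). f p n k", OF _ assms(2)])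
  fix n :: nat assume "n \<in> {0<..}"
  then show "((\<lambda>(k, p). f p n k) has_sum (\<Sum>k\<in>{0<..<n}. g n k)) (SIGMA k:{0<..<n}. {n<..})"
    by (intro has_sum_Sigma_nonneg[where g = "\<lambda>k. g n k"]) (use assms in auto)
qed (use assms in auto)

lemma chains3_high:
  assumes "((\<lambda>p. \<Sum>n\<in>{0<..<p}. \<Sum>k\<in>{0<..<n}. f p n k) has_sum S) {0<..}"
    and "\<And>p n k. 0 < k \<Longrightarrow> k < n \<Longrightarrow> n < p \<Longrightarrow> f p n k \<ge> (0::real)"
  shows "((\<lambda>(p, n, k). f p n k) has_sum S) chains3"
  unfolding chains3_reindex(3)
proof (rule has_sum_Sigma_nonneg[where f = "\<lambda>p (n, k). f p n k", OF _ assms(1)])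
  fix p :: nat assume "p \<in> {0<..}"
  then show "((\<lambda>(n, k). f p n k) has_sum (\<Sum>n\<in>{0<..<p}. \<Sum>k\<in>{0<..<n}. f p n k)) (SIGMA n:{0<..<p}. {0<..<n})"
    by (intro has_sum_Sigma_nonneg[where g = "\<lambda>n. \<Sum>k\<in>{0<..<n}. f p n k"]) (use assms in auto)
qed (use assms in auto)

text \<open>Same principle as \<open>chains2_residues\<close>, with \<open>\<phi>\<close> at the
  least, middle or greatest variable; the signs +, -, + are those of the partial fractions in three
  variables.\<close>

lemma chains3_residues:
  fixes \<phi> :: "nat \<Rightarrow> real"
  assumes "\<And>p n k. 0 < k \<Longrightarrow> k < n \<Longrightarrow> n < p \<Longrightarrow> a p n k \<ge> 0"
    and "\<And>p n k. 0 < k \<Longrightarrow> k < n \<Longrightarrow> n < p \<Longrightarrow> b p n k \<ge> 0"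
    and "\<And>p n k. 0 < k \<Longrightarrow> k < n \<Longrightarrow> n < p \<Longrightarrow> c p n k \<ge> 0" and "\<And>k. \<phi> k \<ge> 0"
    and "\<And>n k. 0 < k \<Longrightarrow> k < n \<Longrightarrow> ((\<lambda>p. a p n k) has_sum a' n k) {n<..}"
    and "\<And>k. k > 0 \<Longrightarrow> ((\<lambda>n. a' n k) has_sum \<alpha> k) {k<..}"
    and "\<And>n k. 0 < k \<Longrightarrow> k < n \<Longrightarrow> ((\<lambda>p. b p n k) has_sum b' n k) {n<..}"
    and "\<And>n. n > 0 \<Longrightarrow> (\<Sum>k\<in>{0<..<n}. b' n k) = \<beta> n"
    and "\<And>p. p > 0 \<Longrightarrow> (\<Sum>n\<in>{0<..<p}. \<Sum>k\<in>{0<..<n}. c p n k) = \<gamma> p"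
    and "(\<lambda>k. \<phi> k * \<alpha> k) summable_on {0<..}" "(\<lambda>k. \<phi> k * \<beta> k) summable_on {0<..}"
      "(\<lambda>k. \<phi> k * \<gamma> k) summable_on {0<..}"
  shows "((\<lambda>(p, n, k). \<phi> k * a p n k - \<phi> n * b p n k + \<phi> p * c p n k) has_sum
           (\<Sum>\<^sub>\<infinity>k\<in>{0<..}. \<phi> k * (\<alpha> k - \<beta> k + \<gamma> k))) chains3"
proof -
  have 1: "((\<lambda>(p, n, k). \<phi> k * a p n k) has_sum (\<Sum>\<^sub>\<infinity>k\<in>{0<..}. \<phi> k * \<alpha> k)) chains3"
    by (rule chains3_low[OF has_sum_cmult_right[OF assms(5)] has_sum_cmult_right[OF assms(6)] has_sum_infsum])
       (use assms in auto)
  have "((\<lambda>n. \<Sum>k\<in>{0<..<n}. \<phi> n * b' n k) has_sum (\<Sum>\<^sub>\<infinity>k\<in>{0<..}. \<phi> k * \<beta> k)) {0<..}"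
    using has_sum_infsum[OF assms(11)]
    by (rule has_sum_cong[THEN iffD1, rotated]) (use assms(8) in \<open>simp flip: sum_distrib_left\<close>)
  then have 2: "((\<lambda>(p, n, k). \<phi> n * b p n k) has_sum (\<Sum>\<^sub>\<infinity>k\<in>{0<..}. \<phi> k * \<beta> k)) chains3"
    by (intro chains3_mid[where g = "\<lambda>n k. \<phi> n * b' n k"] has_sum_cmult_right) (use assms in auto)
  have "((\<lambda>p. \<Sum>n\<in>{0<..<p}. \<Sum>k\<in>{0<..<n}. \<phi> p * c p n k) has_sum (\<Sum>\<^sub>\<infinity>k\<in>{0<..}. \<phi> k * \<gamma> k)) {0<..}"
    using has_sum_infsum[OF assms(12)]
    by (rule has_sum_cong[THEN iffD1, rotated]) (use assms(9) in \<open>simp flip: sum_distrib_left\<close>)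
  then have 3: "((\<lambda>(p, n, k). \<phi> p * c p n k) has_sum (\<Sum>\<^sub>\<infinity>k\<in>{0<..}. \<phi> k * \<gamma> k)) chains3"
    by (rule chains3_high) (use assms in auto)
  have "(\<Sum>\<^sub>\<infinity>k\<in>{0<..}. \<phi> k * \<alpha> k) - (\<Sum>\<^sub>\<infinity>k\<in>{0<..}. \<phi> k * \<beta> k) + (\<Sum>\<^sub>\<infinity>k\<in>{0<..}. \<phi> k * \<gamma> k)
      = (\<Sum>\<^sub>\<infinity>k\<in>{0<..}. \<phi> k * (\<alpha> k - \<beta> k + \<gamma> k))"
    using infsum_diff[OF assms(10,11)]
      infsum_add[OF has_sum_imp_summable[OF has_sum_diff[OF has_sum_infsum[OF assms(10)] has_sum_infsum[OF assms(11)]]] assms(12)]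
    by (simp add: algebra_simps)
  then show ?thesis
    using has_sum_add[OF has_sum_diff[OF 1 2] 3] by (simp add: case_prod_unfold)
qed

lemma has_sum_over_chains2:
  assumes "\<And>m k. 0 < k \<Longrightarrow> k < m \<Longrightarrow> (f m k has_sum g m k) (B m k)"
    and "((\<lambda>(m, k). g m k) has_sum S) chains2"
    and "\<And>m k i. 0 < k \<Longrightarrow> k < m \<Longrightarrow> i \<in> B m k \<Longrightarrow> f m k i \<ge> (0::real)"
  shows "((\<lambda>((m, k), i). f m k i) has_sum S) (SIGMA (m, k):chains2. B m k)"
proof -
  have "((\<lambda>(x, i). (case x of (m, k) \<Rightarrow> f m k) i) has_sum S) (SIGMA x:chains2. case x of (m, k) \<Rightarrow> B m k)"
    by (rule has_sum_Sigma_nonneg[OF _ assms(2)]) (use assms(1,3) in \<open>auto simp: chains2_def\<close>)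
  then show ?thesis by (simp add: case_prod_unfold)
qed

text \<open>The first and last of the four sums coincide after summing over \<open>n\<close>, so only the two
  harmonic numbers coming from the other two remain.\<close>
lemma chains3_to_chains2:
  fixes F :: "nat \<Rightarrow> nat \<Rightarrow> real"
  assumes nonneg: "\<And>m k. F m k \<ge> 0" and summable: "(\<lambda>(m, k). F m k * H m) summable_on chains2"
  shows "((\<lambda>(p, n, k). (F p k - F p n) / (real n - real k)
             + (F n k * (1 / (real p - real n) - 1 / real p) - F p k / (real p - real n)))
          has_sum (\<Sum>\<^sub>\<infinity>(m, k)\<in>chains2. F m k * (H m - H (k - 1)))) chains3"
proof -
  \<comment> \<open>Each harmonic number met below lies between 0 and H m, so the one summability
    hypothesis dominates all the series.\<close>
  have summ: "(\<lambda>(m, k). F m k * G m k) summable_on chains2"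
    if "\<And>m k. (m, k) \<in> chains2 \<Longrightarrow> 0 \<le> G m k \<and> G m k \<le> H m" for G
    by (rule summable_on_comparison_test[OF summable]) (use that nonneg in \<open>auto intro!: mult_left_mono\<close>)
  define A where "A = (\<Sum>\<^sub>\<infinity>(m, k)\<in>chains2. F m k * H (m - 1 - k))"
  have A: "((\<lambda>(m, k). F m k * H (m - 1 - k)) has_sum A) chains2"
    unfolding A_def by (intro has_sum_infsum summ) (auto simp: harm_nonneg intro!: harm_mono)
  define B where "B = (\<Sum>\<^sub>\<infinity>(m, k)\<in>chains2. F m k * H (k - 1))"
  have B: "((\<lambda>(m, k). F m k * H (k - 1)) has_sum B) chains2"
    unfolding B_def by (intro has_sum_infsum summ) (auto simp: harm_nonneg chains2_def intro!: harm_mono)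
  define C where "C = (\<Sum>\<^sub>\<infinity>(m, k)\<in>chains2. F m k * H m)"
  have C: "((\<lambda>(m, k). F m k * H m) has_sum C) chains2"
    unfolding C_def by (intro has_sum_infsum summable)
  have sums: "(\<Sum>n\<in>{k<..<p}. 1 / (real n - real k)) = H (p - 1 - k)"
    "(\<Sum>n\<in>{k<..<p}. 1 / (real p - real n)) = H (p - 1 - k)" if "k < p" for k p
  proof -
    have "(\<Sum>n\<in>{k<..<p}. 1 / (real n - real k)) = (\<Sum>i=1..p-1-k. 1 / real i)"
      by (rule sum.reindex_bij_witness[of _ "\<lambda>i. k + i" "\<lambda>n. n - k"]) (auto simp: of_nat_diff)
    then show "(\<Sum>n\<in>{k<..<p}. 1 / (real n - real k)) = H (p - 1 - k)" by (simp only: sum_recip)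
    have "(\<Sum>n\<in>{k<..<p}. 1 / (real p - real n)) = (\<Sum>i=1..p-1-k. 1 / real i)"
      by (rule sum.reindex_bij_witness[of _ "\<lambda>i. p - i" "\<lambda>n. p - n"]) (auto simp: of_nat_diff)
    then show "(\<Sum>n\<in>{k<..<p}. 1 / (real p - real n)) = H (p - 1 - k)" by (simp only: sum_recip)
  qed
  have sums0: "(\<Sum>k\<in>{0<..<n}. 1 / (real n - real k)) = H (n - 1)" if "n > 0" for n
    using sums(2)[OF that] by simp
  have 1: "((\<lambda>(p, n, k). F p k * (1 / (real n - real k))) has_sum A) chains3"
    unfolding chains3_reindex(5)
  proof (rule has_sum_over_chains2[OF _ A], goal_cases)
    case 1
    then show ?case by (intro has_sum_finiteI) (auto simp only: sum_distrib_left[symmetric] sums sums0 diff_zero)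
  qed (auto intro!: divide_nonneg_nonneg nonneg)
  have 4: "((\<lambda>(p, n, k). F p k * (1 / (real p - real n))) has_sum A) chains3"
    unfolding chains3_reindex(5)
  proof (rule has_sum_over_chains2[OF _ A], goal_cases)
    case 1
    then show ?case by (intro has_sum_finiteI) (auto simp only: sum_distrib_left[symmetric] sums sums0 diff_zero)
  qed (auto intro!: divide_nonneg_nonneg nonneg)
  have 2: "((\<lambda>(p, n, k). F p n * (1 / (real n - real k))) has_sum B) chains3"
    unfolding chains3_reindex(4)
  proof (rule has_sum_over_chains2[OF _ B], goal_cases)
    case 1
    then show ?case by (intro has_sum_finiteI) (auto simp only: sum_distrib_left[symmetric] sums sums0 diff_zero)
  qed (auto intro!: divide_nonneg_nonneg nonneg)
  have 3: "((\<lambda>(p, n, k). F n k * (1 / (real p - real n) - 1 / real p)) has_sum C) chains3"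
    unfolding chains3_reindex(6)
  proof (rule has_sum_over_chains2[OF _ C])
    fix n k :: nat assume "0 < k" "k < n"
    show "((\<lambda>p. F n k * (1 / (real p - real n) - 1 / real p)) has_sum F n k * H n) {n<..}"
      using has_sum_telescope_tail[of n n 0] by (intro has_sum_cmult_right) simp
  qed (auto intro!: mult_nonneg_nonneg nonneg divide_left_mono)
  have "(\<Sum>\<^sub>\<infinity>(m, k)\<in>chains2. F m k * (H m - H (k - 1))) = C - B"
    using has_sum_diff[OF C B] by (intro infsumI) (simp add: case_prod_unfold right_diff_distrib)
  then show ?thesis
    using has_sum_add[OF has_sum_diff[OF 1 2] has_sum_diff[OF 3 4]]
    by (simp add: case_prod_unfold diff_divide_distrib)
qed

section \<open>Partial fractions for sums over exponents\<close>

text \<open>Evaluated at x = 1/m and y = 1/k, this is the summand at (m, k) of the series for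
  \<open>mzv_sum2\<close>: the finite sum over exponents is taken inside the infinite one.\<close>

definition pow_sum2 :: "nat \<Rightarrow> (nat \<Rightarrow> nat \<Rightarrow> bool) \<Rightarrow> real \<Rightarrow> real \<Rightarrow> real" where
  "pow_sum2 l P x y = (\<Sum>(a, b)\<in>{(a, b). a \<ge> 2 \<and> b \<ge> 1 \<and> a + b = l \<and> P a b}. x ^ a * y ^ b)"

definition pow_sum3 :: "nat \<Rightarrow> (nat \<Rightarrow> nat \<Rightarrow> nat \<Rightarrow> bool) \<Rightarrow> real \<Rightarrow> real \<Rightarrow> real \<Rightarrow> real" where
  "pow_sum3 l P x y z =
     (\<Sum>(a, b, c)\<in>{(a, b, c). a \<ge> 2 \<and> b \<ge> 1 \<and> c \<ge> 1 \<and> a + b + c = l \<and> P a b c}. x ^ a * y ^ b * z ^ c)"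

text \<open>A homogeneous geometric sum in y = 1/n and z = 1/k, driven by the relation y z = (z - y)
  / (n - k).\<close>

lemma geometric_recip:
  fixes n k :: real
  assumes "0 < k" "k < n"
  shows "(\<Sum>i=1..b. (1 / n) ^ i * (1 / k) ^ (b + 1 - i)) = ((1 / k) ^ b - (1 / n) ^ b) / (n - k)"
proof (induction b)
  case (Suc b)
  define y z where "y = 1 / n" and "z = 1 / k"
  have yz: "y * z = (z - y) / (n - k)" using assms by (simp add: y_def z_def divide_simps)
  have "(\<Sum>i=1..Suc b. y ^ i * z ^ (Suc b + 1 - i)) = (\<Sum>i=1..b. y ^ i * z ^ (Suc (b + 1 - i))) + y ^ b * (y * z)"
    by (simp add: Suc_diff_le)
  also have "(\<Sum>i=1..b. y ^ i * z ^ (Suc (b + 1 - i))) = (\<Sum>i=1..b. y ^ i * z ^ (b + 1 - i)) * z"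
    unfolding sum_distrib_right by (intro sum.cong refl) simp
  also have "\<dots> = (z ^ b - y ^ b) / (n - k) * z" using Suc.IH by (simp add: y_def z_def)
  also have "\<dots> + y ^ b * (y * z) = (z ^ Suc b - y ^ Suc b) / (n - k)"
    unfolding yz by (simp add: algebra_simps diff_divide_distrib add_divide_distrib)
  finally show ?case by (simp add: y_def z_def)
qed simp

text \<open>Even exponents make this \<open>geometric_recip\<close> at n^2 and k^2, which is how n^2
  - k^2 enters.\<close>

lemma geometric_recip_even:
  fixes n k :: real
  assumes "0 < k" "k < n" "even b"
  shows "(\<Sum>i=1..b div 2. (1 / n) ^ (2 * i) * (1 / k) ^ (b + 2 - 2 * i)) = ((1 / k) ^ b - (1 / n) ^ b) / (n ^ 2 - k ^ 2)"
proof -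
  from assms(3) obtain c where b: "b = 2 * c" by (elim evenE)
  have "b + 2 - 2 * i = 2 * (c + 1 - i)" for i using b by simp
  then have "(\<Sum>i=1..b div 2. (1 / n) ^ (2 * i) * (1 / k) ^ (b + 2 - 2 * i))
      = (\<Sum>i=1..c. (1 / n ^ 2) ^ i * (1 / k ^ 2) ^ (c + 1 - i))"
    by (simp only: b) (simp add: power_mult power_one_over)
  also have "\<dots> = ((1 / k ^ 2) ^ c - (1 / n ^ 2) ^ c) / (n ^ 2 - k ^ 2)"
    using assms by (intro geometric_recip power_strict_mono) auto
  finally show ?thesis by (simp add: b power_mult power_one_over)
qed

text \<open>Group the triples by (a, b + c - 1). As the condition depends only on this pair, each
  fibre is a complete geometric sum in the two smaller variables.\<close>

lemma pow_sum3_split_low: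
  assumes "0 < k" "k < n"
  shows "pow_sum3 l (\<lambda>a b c. P a (b + c - 1)) x (1 / n) (1 / k)
    = (pow_sum2 (l - 1) P x (1 / k) - pow_sum2 (l - 1) P x (1 / n)) / (n - k)"
proof -
  let ?I = "{(a, b). a \<ge> 2 \<and> b \<ge> 1 \<and> a + b = l - 1 \<and> P a b}"
  have fin: "finite ?I" by (rule finite_mzv_sum2_index)
  have "(pow_sum2 (l - 1) P x (1 / k) - pow_sum2 (l - 1) P x (1 / n)) / (n - k)
      = (\<Sum>(a, b)\<in>?I. \<Sum>i\<in>{1..b}. x ^ a * (1 / n) ^ i * (1 / k) ^ (b + 1 - i))"
    unfolding pow_sum2_def sum_subtractf[symmetric] sum_divide_distrib
  proof (rule sum.cong[OF refl], clarify)
    fix a b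
    show "(x ^ a * (1 / k) ^ b - x ^ a * (1 / n) ^ b) / (n - k) = (\<Sum>i=1..b. x ^ a * (1 / n) ^ i * (1 / k) ^ (b + 1 - i))"
      unfolding mult.assoc sum_distrib_left[symmetric] geometric_recip[OF assms]
      by (simp add: right_diff_distrib)
  qed
  also have "\<dots> = (\<Sum>((a, b), i)\<in>(SIGMA (a, b):?I. {1..b}). x ^ a * (1 / n) ^ i * (1 / k) ^ (b + 1 - i))"
    by (subst sum.Sigma[symmetric]) (use fin in \<open>auto simp: case_prod_unfold\<close>)
  also have "\<dots> = pow_sum3 l (\<lambda>a b c. P a (b + c - 1)) x (1 / n) (1 / k)"
    unfolding pow_sum3_def
    by (rule sum.reindex_bij_witness[of _ "\<lambda>(a, i, j). ((a, i + j - 1), i)" "\<lambda>((a, b), i). (a, i, b + 1 - i)"])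
       (auto simp: add_diff_eq)
  finally show ?thesis ..
qed

text \<open>Here the triples are grouped by (a + b - 1, c). The first exponent starts at 2, so the
  geometric sum lacks its first term, and this is the source of \<open>- 1 / p\<close>.\<close>

lemma pow_sum3_split_high:
  assumes "0 < n" "n < p"
  shows "pow_sum3 l (\<lambda>a b c. P (a + b - 1) c) (1 / p) (1 / n) z
    = pow_sum2 (l - 1) P (1 / n) z * (1 / (p - n) - 1 / p) - pow_sum2 (l - 1) P (1 / p) z / (p - n)"
proof -
  let ?I = "{(a, c). a \<ge> 2 \<and> c \<ge> 1 \<and> a + c = l - 1 \<and> P a c}"
  have fin: "finite ?I" by (rule finite_mzv_sum2_index)
  have "pow_sum2 (l - 1) P (1 / n) z * (1 / (p - n) - 1 / p) - pow_sum2 (l - 1) P (1 / p) z / (p - n)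
      = (\<Sum>(a, c)\<in>?I. \<Sum>i\<in>{2..a}. (1 / p) ^ i * (1 / n) ^ (a + 1 - i) * z ^ c)"
    unfolding pow_sum2_def sum_subtractf[symmetric] sum_divide_distrib sum_distrib_right
  proof (rule sum.cong[OF refl], clarify)
    fix a c :: nat assume a: "a \<ge> 2"
    have "{1..a} = insert 1 {2..a}" using a by auto
    then have "(\<Sum>i=1..a. (1 / p) ^ i * (1 / n) ^ (a + 1 - i))
        = (1 / p) * (1 / n) ^ a + (\<Sum>i=2..a. (1 / p) ^ i * (1 / n) ^ (a + 1 - i))"
      by (simp only:) (subst sum.insert, auto)
    then have e: "(\<Sum>i=2..a. (1 / p) ^ i * (1 / n) ^ (a + 1 - i)) = ((1 / n) ^ a - (1 / p) ^ a) / (p - n) - (1 / p) * (1 / n) ^ a"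
      unfolding geometric_recip[OF assms] by simp
    show "(1 / n) ^ a * z ^ c * (1 / (p - n) - 1 / p) - (1 / p) ^ a * z ^ c / (p - n)
        = (\<Sum>i=2..a. (1 / p) ^ i * (1 / n) ^ (a + 1 - i) * z ^ c)"
      unfolding sum_distrib_right[symmetric] e
      by (simp add: algebra_simps diff_divide_distrib add_divide_distrib)
  qed
  also have "\<dots> = (\<Sum>((a, c), i)\<in>(SIGMA (a, c):?I. {2..a}). (1 / p) ^ i * (1 / n) ^ (a + 1 - i) * z ^ c)"
    by (subst sum.Sigma[symmetric]) (use fin in \<open>auto simp: case_prod_unfold\<close>)
  also have "\<dots> = pow_sum3 l (\<lambda>a b c. P (a + b - 1) c) (1 / p) (1 / n) z"
    unfolding pow_sum3_def
    by (rule sum.reindex_bij_witness[of _ "\<lambda>(i, j, c). ((i + j - 1, c), i)" "\<lambda>((a, c), i). (i, a + 1 - i, c)"])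
       (auto simp: add_diff_eq)
  finally show ?thesis ..
qed

text \<open>The fibres are pairs of positive even exponents with sum b + 2, so merging them lowers
  the weight by 2 rather than by 1.\<close>

lemma pow_sum3_even_even_even:
  assumes "0 < k" "k < n" "even l"
  shows "pow_sum3 l (\<lambda>a b c. even a \<and> even b \<and> even c) x (1 / n) (1 / k)
    = (pow_sum2 (l - 2) (\<lambda>a b. even a \<and> even b) x (1 / k) - pow_sum2 (l - 2) (\<lambda>a b. even a \<and> even b) x (1 / n)) / (n ^ 2 - k ^ 2)"
proof -
  let ?I = "{(a, b). a \<ge> 2 \<and> b \<ge> 1 \<and> a + b = l - 2 \<and> even a \<and> even b}"
  have fin: "finite ?I" by (rule finite_mzv_sum2_index)
  have "(pow_sum2 (l - 2) (\<lambda>a b. even a \<and> even b) x (1 / k) - pow_sum2 (l - 2) (\<lambda>a b. even a \<and> even b) x (1 / n)) / (n ^ 2 - k ^ 2)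
      = (\<Sum>(a, b)\<in>?I. \<Sum>i\<in>{1..b div 2}. x ^ a * (1 / n) ^ (2 * i) * (1 / k) ^ (b + 2 - 2 * i))"
    unfolding pow_sum2_def sum_subtractf[symmetric] sum_divide_distrib
  proof (rule sum.cong[OF refl], clarify)
    fix a b :: nat assume "even b"
    show "(x ^ a * (1 / k) ^ b - x ^ a * (1 / n) ^ b) / (n ^ 2 - k ^ 2) = (\<Sum>i=1..b div 2. x ^ a * (1 / n) ^ (2 * i) * (1 / k) ^ (b + 2 - 2 * i))"
      unfolding mult.assoc sum_distrib_left[symmetric] geometric_recip_even[OF assms(1,2) \<open>even b\<close>]
      by (simp add: right_diff_distrib)
  qed
  also have "\<dots> = (\<Sum>((a, b), i)\<in>(SIGMA (a, b):?I. {1..b div 2}). x ^ a * (1 / n) ^ (2 * i) * (1 / k) ^ (b + 2 - 2 * i))"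
    by (subst sum.Sigma[symmetric]) (use fin in \<open>auto simp: case_prod_unfold\<close>)
  also have "\<dots> = pow_sum3 l (\<lambda>a b c. even a \<and> even b \<and> even c) x (1 / n) (1 / k)"
    unfolding pow_sum3_def
    by (rule sum.reindex_bij_witness[of _ "\<lambda>(a, i, j). ((a, i + j - 2), i div 2)" "\<lambda>((a, b), i). (a, 2 * i, b + 2 - 2 * i)"])
       (auto simp: add_diff_eq elim!: evenE)
  finally show ?thesis ..
qed

text \<open>The case l = 2, where there are no exponents and both sides vanish, is included because
  the all-even triple sum of weight 4 reduces to it.\<close>

lemma pow_sum2_even_even:
  assumes "0 < k" "k < m" "even l" "l \<ge> 2"
  shows "pow_sum2 l (\<lambda>a b. even a \<and> even b) (1 / m) (1 / k) = ((1 / k) ^ (l - 2) - (1 / m) ^ (l - 2)) / (m ^ 2 - k ^ 2)"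
proof -
  from assms(3) obtain c' where "l = 2 * c'" by (elim evenE)
  then have l: "l = 2 * (c' - 1) + 2" using assms(4) by simp
  have "pow_sum2 l (\<lambda>a b. even a \<and> even b) (1 / m) (1 / k)
      = (\<Sum>i=1..(l - 2) div 2. (1 / m) ^ (2 * i) * (1 / k) ^ (l - 2 + 2 - 2 * i))"
    unfolding pow_sum2_def
    by (rule sum.reindex_bij_witness[of _ "\<lambda>i. (2 * i, l - 2 + 2 - 2 * i)" "\<lambda>(a, b). a div 2"])
       (auto simp: l elim!: evenE, metis diff_add_inverse)
  also have "\<dots> = ((1 / k) ^ (l - 2) - (1 / m) ^ (l - 2)) / (m ^ 2 - k ^ 2)"
    using assms by (intro geometric_recip_even) auto
  finally show ?thesis .
qed

lemma pow_sum2_all: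
  assumes "0 < k" "k < m" "l \<ge> 2"
  shows "pow_sum2 l (\<lambda>_ _. True) (1 / m) (1 / k)
    = ((1 / k) ^ (l - 1) - (1 / m) ^ (l - 1)) / (m - k) - (1 / m) * (1 / k) ^ (l - 1)"
proof -
  have ins: "{1..l - 1} = insert 1 {2..l - 1}" using assms(3) by auto
  have "pow_sum2 l (\<lambda>_ _. True) (1 / m) (1 / k) = (\<Sum>i=2..l - 1. (1 / m) ^ i * (1 / k) ^ (l - 1 + 1 - i))"
    unfolding pow_sum2_def
    by (rule sum.reindex_bij_witness[of _ "\<lambda>i. (i, l - 1 + 1 - i)" "\<lambda>(a, b). a"]) (use assms(3) in auto)
  moreover have "(\<Sum>i=1..l - 1. (1 / m) ^ i * (1 / k) ^ (l - 1 + 1 - i))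
      = (1 / m) * (1 / k) ^ (l - 1) + (\<Sum>i=2..l - 1. (1 / m) ^ i * (1 / k) ^ (l - 1 + 1 - i))"
    unfolding ins by (subst sum.insert) auto
  ultimately show ?thesis unfolding geometric_recip[OF assms(1,2)] by simp
qed

lemma even_pred_pos: "even b \<Longrightarrow> Suc 0 \<le> b \<Longrightarrow> Suc 0 \<le> b - Suc 0" for b :: nat
  by (elim evenE) auto

lemma odd_pred_ge_2: "odd a \<Longrightarrow> 2 \<le> a \<Longrightarrow> 2 \<le> a - Suc 0" for a :: nat
  by (elim oddE) auto

text \<open>Raising the odd exponent by one reduces odd weight to the all-even case, at the price of
  one factor 1/y.\<close>

lemma pow_sum3_even_odd_even:
  assumes "y \<noteq> 0"
  shows "pow_sum3 l (\<lambda>a b c. even a \<and> odd b \<and> even c) x y z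
    = pow_sum3 (l + 1) (\<lambda>a b c. even a \<and> even b \<and> even c) x y z / y"
  unfolding pow_sum3_def sum_divide_distrib
  by (rule sum.reindex_bij_witness[of _ "\<lambda>(a, b, c). (a, b - 1, c)" "\<lambda>(a, b, c). (a, b + 1, c)"])
     (use assms in \<open>auto intro: even_pred_pos\<close>)

lemma pow_sum2_odd_even:
  "pow_sum2 l (\<lambda>a b. odd a \<and> even b) x y = x * pow_sum2 (l - 1) (\<lambda>a b. even a \<and> even b) x y"
  unfolding pow_sum2_def sum_distrib_left
  by (rule sum.reindex_bij_witness[of _ "\<lambda>(a, b). (a + 1, b)" "\<lambda>(a, b). (a - 1, b)"])
     (auto intro: odd_pred_ge_2 simp: power_Suc[symmetric] simp del: power_Suc)

lemma pow_sum2_even_odd: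
  assumes "y \<noteq> 0"
  shows "pow_sum2 l (\<lambda>a b. even a \<and> odd b) x y = pow_sum2 (l + 1) (\<lambda>a b. even a \<and> even b) x y / y"
  unfolding pow_sum2_def sum_divide_distrib
  by (rule sum.reindex_bij_witness[of _ "\<lambda>(a, b). (a, b - 1)" "\<lambda>(a, b). (a, b + 1)"])
     (use assms in \<open>auto intro: even_pred_pos\<close>)

section \<open>Multiple zeta values as sums over chains\<close>

lemma sum_cmult_recip:
  assumes "\<And>k. k \<in> {0<..<m} \<Longrightarrow> f k = c * (1 / real k)"
  shows "(\<Sum>k\<in>{0<..<m}. f k) = c * H (m - 1)"
proof -
  have "(\<Sum>k\<in>{0<..<m}. f k) = c * (\<Sum>k=1..m-1. 1 / real k)"
    unfolding sum_distrib_left greaterThanLessThan_conv_atLeastAtMost[symmetric] by (rule sum.cong) (use assms in auto)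
  then show ?thesis by (simp only: sum_recip)
qed

text \<open>The exponents (2, 1) are the smallest admissible ones, so this series, with its extra
  factor H m, dominates every depth two series below. Summing over k leaves H m H(m-1) /
  m^2.\<close>

lemma summable_chains2_base:
  "(\<lambda>(m, k). (1 / real m ^ 2) * (1 / real k) * H m) summable_on chains2"
proof -
  have "(\<lambda>m. 1 / real m ^ 2 * (H m * H (m - 1))) summable_on {0<..}"
  proof (rule summable_log_bounded[OF log_bounded_le[OF log_bounded_mult_H]])
    fix m :: nat
    show "\<bar>H m * H (m - 1)\<bar> \<le> \<bar>H m * H m\<bar>"
      by (auto simp: abs_mult intro!: mult_left_mono harm_mono harm_nonneg)
  qed auto
  also have "(\<lambda>m. 1 / real m ^ 2 * (H m * H (m - 1)))
    = (\<lambda>m. \<Sum>k\<in>{0<..<m}. (1 / real m ^ 2) * (1 / real k) * H m)"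
    by (intro ext, subst sum_cmult_recip[where c = "1 / real _ ^ 2 * H _"]) auto
  finally show ?thesis
  proof (rule has_sum_imp_summable[OF chains2_high[OF has_sum_infsum]])
    fix m k :: nat
    have "H m \<ge> 0" by (rule harm_nonneg)
    then show "(1 / real m ^ 2) * (1 / real k) * H m \<ge> 0" by simp
  qed
qed

lemma summable_chains3_base:
  "(\<lambda>(p, n, k). (1 / real p ^ 2) * (1 / real n) * (1 / real k)) summable_on chains3"
proof -
  have inner: "((\<lambda>k. (1 / real p ^ 2) * (1 / real n) * (1 / real k)) has_sum (1 / real p ^ 2) * (1 / real n) * H (n - 1)) {0<..<n}" for p n
    by (intro has_sum_finiteI sum_cmult_recip[symmetric]) auto
  have "(\<lambda>(p, n). (1 / real p ^ 2) * (1 / real n) * H (n - 1)) summable_on chains2"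
    by (rule summable_on_comparison_test[OF summable_chains2_base])
       (auto simp: chains2_def harm_nonneg intro!: divide_right_mono harm_mono)
  from has_sum_over_chains2[OF inner has_sum_infsum[OF this]] show ?thesis
    unfolding summable_on_def chains3_reindex(4) by (auto)
qed

lemma power_recip_le:
  assumes "a \<ge> b"
  shows "(1 / real m) ^ a \<le> 1 / real m ^ b"
proof (cases "m = 0")
  case False
  then show ?thesis using assms by (simp add: power_one_over frac_le power_increasing)
next
  case True
  \<comment> \<open>With 1/0 = 0 the left side vanishes unless a = 0, in which case b = 0 as well
    and both sides are 1.\<close>
  then show ?thesis by (cases a) (use assms in auto)
qed

lemma mzv2_has_sum:
  assumes "a \<ge> 2" "b \<ge> 1"
  shows "((\<lambda>(m, k). (1 / real m) ^ a * (1 / real k) ^ b) has_sum mzv [a, b]) chains2"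
proof -
  have "(\<lambda>(m, k). (1 / real m) ^ a * (1 / real k) ^ b) summable_on chains2"
  proof (rule summable_on_comparison_test[OF summable_chains2_base])
    fix x assume "x \<in> chains2"
    then obtain m k where x: "x = (m, k)" "0 < k" "k < m" by (auto simp: chains2_def)
    have "(1 / real m) ^ a * (1 / real k) ^ b \<le> (1 / real m ^ 2) * (1 / real k ^ 1)"
      by (intro mult_mono power_recip_le assms) auto
    also have "\<dots> \<le> (1 / real m ^ 2) * (1 / real k) * H m"
      using mult_left_mono[OF H_ge_1[of m], of "(1 / real m ^ 2) * (1 / real k)"] x by simp
    finally show "(case x of (m, k) \<Rightarrow> (1 / real m) ^ a * (1 / real k) ^ b) \<le> (case x of (m, k) \<Rightarrow> (1 / real m ^ 2) * (1 / real k) * H m)"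
      by (simp add: x)
  qed auto
  then have "((\<lambda>(m, k). (1 / real m) ^ a * (1 / real k) ^ b) has_sum (\<Sum>\<^sub>\<infinity>(m, k)\<in>chains2. (1 / real m) ^ a * (1 / real k) ^ b)) chains2"
    by (rule has_sum_infsum)
  also have "(\<Sum>\<^sub>\<infinity>(m, k)\<in>chains2. (1 / real m) ^ a * (1 / real k) ^ b) = mzv [a, b]"
    unfolding mzv_def
    by (rule infsum_reindex_bij_witness[of _ "\<lambda>ms. (ms ! 0, ms ! 1)" "\<lambda>(m, k). [m, k]"])
       (auto simp: chains2_def length_Suc_conv lessThan_Suc power_one_over)
  finally show ?thesis .
qed

lemma mzv3_has_sum:
  assumes "a \<ge> 2" "b \<ge> 1" "c \<ge> 1"
  shows "((\<lambda>(p, n, k). (1 / real p) ^ a * (1 / real n) ^ b * (1 / real k) ^ c) has_sum mzv [a, b, c]) chains3"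
proof -
  have "(\<lambda>(p, n, k). (1 / real p) ^ a * (1 / real n) ^ b * (1 / real k) ^ c) summable_on chains3"
  proof (rule summable_on_comparison_test[OF summable_chains3_base])
    fix x assume "x \<in> chains3"
    obtain p n k where x: "x = (p, n, k)" by (cases x)
    have "(1 / real p) ^ a * (1 / real n) ^ b * (1 / real k) ^ c \<le> (1 / real p ^ 2) * (1 / real n ^ 1) * (1 / real k ^ 1)"
      by (intro mult_mono power_recip_le assms) auto
    then show "(case x of (p, n, k) \<Rightarrow> (1 / real p) ^ a * (1 / real n) ^ b * (1 / real k) ^ c)
        \<le> (case x of (p, n, k) \<Rightarrow> (1 / real p ^ 2) * (1 / real n) * (1 / real k))"
      by (simp add: x)
  qed auto
  then have "((\<lambda>(p, n, k). (1 / real p) ^ a * (1 / real n) ^ b * (1 / real k) ^ c) has_sum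
      (\<Sum>\<^sub>\<infinity>(p, n, k)\<in>chains3. (1 / real p) ^ a * (1 / real n) ^ b * (1 / real k) ^ c)) chains3"
    by (rule has_sum_infsum)
  also have "(\<Sum>\<^sub>\<infinity>(p, n, k)\<in>chains3. (1 / real p) ^ a * (1 / real n) ^ b * (1 / real k) ^ c) = mzv [a, b, c]"
    unfolding mzv_def
    by (rule infsum_reindex_bij_witness[of _ "\<lambda>ms. (ms ! 0, ms ! 1, ms ! 2)" "\<lambda>(p, n, k). [p, n, k]"])
       (auto simp: chains3_def length_Suc_conv lessThan_Suc power_one_over numeral_2_eq_2)
  finally show ?thesis .
qed

lemma has_sum_sum:
  fixes f :: "'i \<Rightarrow> 'a \<Rightarrow> real"
  assumes "\<And>i. i \<in> I \<Longrightarrow> (f i has_sum s i) A"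
  shows "((\<lambda>x. \<Sum>i\<in>I. f i x) has_sum (\<Sum>i\<in>I. s i)) A"
  using assms by (induction I rule: infinite_finite_induct) (auto intro: has_sum_add has_sum_0)

lemma mzv_sum2_has_sum: "((\<lambda>(m, k). pow_sum2 l P (1 / real m) (1 / real k)) has_sum mzv_sum2 l P) chains2"
proof -
  have "((\<lambda>x. \<Sum>i\<in>{(a, b). a \<ge> 2 \<and> b \<ge> 1 \<and> a + b = l \<and> P a b}.
     (case i of (a, b) \<Rightarrow> \<lambda>(m, k). (1 / real m) ^ a * (1 / real k) ^ b) x) has_sum mzv_sum2 l P) chains2"
    unfolding mzv_sum2_def by (rule has_sum_sum) (auto intro!: mzv2_has_sum)
  then show ?thesis
    by (simp add: pow_sum2_def case_prod_unfold)
qed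

lemma mzv_sum3_has_sum:
  "((\<lambda>(p, n, k). pow_sum3 l P (1 / real p) (1 / real n) (1 / real k)) has_sum mzv_sum3 l P) chains3"
proof -
  have "((\<lambda>x. \<Sum>i\<in>{(a, b, c). a \<ge> 2 \<and> b \<ge> 1 \<and> c \<ge> 1 \<and> a + b + c = l \<and> P a b c}.
     (case i of (a, b, c) \<Rightarrow> \<lambda>(p, n, k). (1 / real p) ^ a * (1 / real n) ^ b * (1 / real k) ^ c) x)
       has_sum mzv_sum3 l P) chains3"
    unfolding mzv_sum3_def by (rule has_sum_sum) (auto intro!: mzv3_has_sum)
  then show ?thesis
    by (simp add: pow_sum3_def case_prod_unfold)
qed

lemma mzv_sum2_eqI:
  assumes "(f has_sum S) chains2"
    and "\<And>m k. 0 < k \<Longrightarrow> k < m \<Longrightarrow> f (m, k) = pow_sum2 l P (1 / real m) (1 / real k)"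
  shows "mzv_sum2 l P = S"
proof -
  have "((\<lambda>(m, k). pow_sum2 l P (1 / real m) (1 / real k)) has_sum S) chains2"
    using assms(1) by (rule has_sum_cong[THEN iffD1, rotated]) (use assms(2) in \<open>auto simp: chains2_def\<close>)
  then show ?thesis using mzv_sum2_has_sum by (rule has_sum_unique[symmetric])
qed

lemma mzv_sum3_eqI:
  assumes "(f has_sum S) chains3"
    and "\<And>p n k. 0 < k \<Longrightarrow> k < n \<Longrightarrow> n < p \<Longrightarrow> f (p, n, k) = pow_sum3 l P (1 / real p) (1 / real n) (1 / real k)"
  shows "mzv_sum3 l P = S"
proof -
  have "((\<lambda>(p, n, k). pow_sum3 l P (1 / real p) (1 / real n) (1 / real k)) has_sum S) chains3"
    using assms(1) by (rule has_sum_cong[THEN iffD1, rotated]) (use assms(2) in \<open>auto simp: chains3_def\<close>)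
  then show ?thesis using mzv_sum3_has_sum by (rule has_sum_unique[symmetric])
qed

lemma mzv_sum2_split:
  assumes "\<And>a b. a + b = l \<Longrightarrow> R a b \<longleftrightarrow> P a b \<or> Q a b" "\<And>a b. \<not> (P a b \<and> Q a b)"
  shows "mzv_sum2 l R = mzv_sum2 l P + mzv_sum2 l Q"
  unfolding mzv_sum2_def
  by (subst sum.union_disjoint[OF finite_mzv_sum2_index finite_mzv_sum2_index, symmetric])
     (use assms in \<open>auto intro!: sum.cong\<close>)

lemma mzv_sum3_split:
  assumes "\<And>a b c. a \<ge> 2 \<Longrightarrow> b \<ge> 1 \<Longrightarrow> c \<ge> 1 \<Longrightarrow> a + b + c = l \<Longrightarrow> R a b c \<longleftrightarrow> P a b c \<or> Q a b c"
    "\<And>a b c. \<not> (P a b c \<and> Q a b c)"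
  shows "mzv_sum3 l R = mzv_sum3 l P + mzv_sum3 l Q"
  unfolding mzv_sum3_def
  by (subst sum.union_disjoint[OF finite_mzv_sum3_index finite_mzv_sum3_index, symmetric])
     (use assms in \<open>auto intro!: sum.cong\<close>)

text \<open>Summing over the larger variable first leaves a tail of zeta(2); this is how residues of
  the form zeta(2) - \<open>harm2 k\<close> are recognised.\<close>

lemma has_sum_mzv_2:
  assumes "e \<ge> 2"
  shows "((\<lambda>k. 1 / real k ^ e * (zeta_val 2 - harm2 k)) has_sum mzv [2, e]) {0<..}"
proof -
  have "(\<lambda>k. 1 / real k ^ e * (zeta_val 2 - harm2 k)) summable_on {0<..}"
    by (intro summable_log_bounded log_bounded_intros assms)
  then have 1: "((\<lambda>k. 1 / real k ^ e * (zeta_val 2 - harm2 k)) has_sum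
      (\<Sum>\<^sub>\<infinity>k\<in>{0<..}. 1 / real k ^ e * (zeta_val 2 - harm2 k))) {0<..}"
    by (rule has_sum_infsum)
  have "((\<lambda>(m, k). 1 / real k ^ e * (1 / real m ^ 2)) has_sum
      (\<Sum>\<^sub>\<infinity>k\<in>{0<..}. 1 / real k ^ e * (zeta_val 2 - harm2 k))) chains2"
    by (rule chains2_low[OF has_sum_cmult_right[OF has_sum_recip_sq_tail] 1]) auto
  moreover have "((\<lambda>(m, k). 1 / real k ^ e * (1 / real m ^ 2)) has_sum mzv [2, e]) chains2"
    using mzv2_has_sum[of 2 e] assms by (simp add: power_one_over mult.commute)
  ultimately have "(\<Sum>\<^sub>\<infinity>k\<in>{0<..}. 1 / real k ^ e * (zeta_val 2 - harm2 k)) = mzv [2, e]"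
    by (rule has_sum_unique)
  with 1 show ?thesis by simp
qed

text \<open>Euler's sum formula. The two residues at k are H k and H (k - 1), which differ by
  1/k.\<close>

lemma mzv_sum2_all:
  assumes "l \<ge> 3"
  shows "mzv_sum2 l (\<lambda>_ _. True) = zeta_val l"
proof (rule mzv_sum2_eqI)
  let ?\<phi> = "\<lambda>k. 1 / real k ^ (l - 1)"
  have tel: "((\<lambda>m. 1 / (real m - real k) - 1 / real m) has_sum H k) {k<..}" for k
    using has_sum_telescope_tail[of k k 0] by simp
  have \<beta>: "(\<Sum>k\<in>{0<..<m}. 1 / (real m - real k)) = H (m - 1)" for m
  proof -
    have "(\<Sum>k\<in>{0<..<m}. 1 / (real m - real k)) = (\<Sum>k\<in>{0<..<m}. 1 / real (m - k))"
      by (rule sum.cong) (auto simp: of_nat_diff)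
    also have "\<dots> = H (m - 1)" by (subst sum_reflect) (simp only: greaterThanLessThan_conv_atLeastAtMost sum_recip)
    finally show ?thesis .
  qed
  have "((\<lambda>(m, k). ?\<phi> k * (1 / (real m - real k) - 1 / real m) - ?\<phi> m * (1 / (real m - real k))) has_sum
      (\<Sum>\<^sub>\<infinity>k\<in>{0<..}. ?\<phi> k * (H k - H (k - 1)))) chains2"
  proof (rule chains2_residues[OF _ _ _ tel \<beta>])
    show "(\<lambda>k. ?\<phi> k * H (k - 1)) summable_on {0<..}"
      using assms by (intro summable_log_bounded log_bounded_le[OF log_bounded_H]) (auto intro: harm_mono)
    show "(\<lambda>k. ?\<phi> k * H k) summable_on {0<..}"
      using assms by (intro summable_log_bounded log_bounded_H) auto
  qed (auto intro!: divide_left_mono)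
  also have "(\<Sum>\<^sub>\<infinity>k\<in>{0<..}. ?\<phi> k * (H k - H (k - 1))) = (\<Sum>\<^sub>\<infinity>k\<in>{0<..}. 1 / real k ^ l)"
  proof (rule infsum_cong)
    fix k :: nat assume "k \<in> {0<..}"
    then have "H k - H (k - 1) = 1 / real k" using H_conv_pred[of k] by simp
    moreover have "real k ^ l = real k ^ (l - 1) * real k" using assms by (intro power_minus_mult[symmetric]) simp
    ultimately show "?\<phi> k * (H k - H (k - 1)) = 1 / real k ^ l" by simp
  qed
  also have "\<dots> = zeta_val l"
    using assms by (intro infsumI has_sum_zeta_val) auto
  finally show "((\<lambda>(m, k). ?\<phi> k * (1 / (real m - real k) - 1 / real m) - ?\<phi> m * (1 / (real m - real k))) has_sum
    zeta_val l) chains2" .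
qed (use assms in \<open>auto simp: pow_sum2_all power_one_over right_diff_distrib diff_divide_distrib\<close>)

section \<open>Sum formulas of depth two and three\<close>

lemma has_sum_shift_at:
  fixes k :: nat
  assumes "((\<lambda>j. f (k + j)) has_sum S) {0<..}"
  shows "(f has_sum S) {k<..}"
  using assms by (subst has_sum_shift)

lemma power_real_split: "l \<ge> j \<Longrightarrow> real k ^ l = real k ^ (l - j) * real k ^ j"
  by (simp flip: power_add)

text \<open>The sum formula in depth three. The quadratic terms of the residues complete a square,
  leaving half of (H k - H(k-1))^2, and the \<open>harm2\<close> terms leave half of their
  increment: together 1/k^2.\<close>

lemma mzv_sum3_all:
  assumes "l \<ge> 4"
  shows "mzv_sum3 l (\<lambda>_ _ _. True) = zeta_val l"
proof (rule mzv_sum3_eqI)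
  let ?\<phi> = "\<lambda>k. 1 / real k ^ (l - 2)"
  let ?a = "\<lambda>p n k. (1 / (real p - real k) - 1 / real p) / (real n - real k)"
  let ?b = "\<lambda>p n k. (1 / (real p - real n) - 1 / real p) / (real n - real k)"
  let ?c = "\<lambda>p n k. 1 / ((real p - real k) * (real p - real n))"
  have reflect: "(\<Sum>k\<in>{0<..<m}. f (real m - real k)) = (\<Sum>k\<in>{0<..<m}. f (real k))" for m and f :: "real \<Rightarrow> real"
    using sum_reflect[of "\<lambda>k. f (real k)" m] by (auto simp: of_nat_diff intro!: sum.cong)
  have recips: "(\<Sum>k\<in>{0<..<m}. 1 / real k) = H (m - 1)" for m
    unfolding greaterThanLessThan_conv_atLeastAtMost by (rule sum_recip)
  have "((\<lambda>(p, n, k). ?\<phi> k * ?a p n k - ?\<phi> n * ?b p n k + ?\<phi> p * ?c p n k) has_sum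
     (\<Sum>\<^sub>\<infinity>k\<in>{0<..}. ?\<phi> k * ((H k ^ 2 + harm2 k) / 2 - H k * H (k - 1) + (H (k - 1) ^ 2 - harm2 (k - 1)) / 2))) chains3"
  proof (rule chains3_residues[where a' = "\<lambda>n k. (H n - H (n - k)) / (real n - real k)"
        and b' = "\<lambda>n k. H n / (real n - real k)"])
    fix n k :: nat assume "0 < k" "k < n"
    then show "((\<lambda>p. ?a p n k) has_sum (H n - H (n - k)) / (real n - real k)) {n<..}"
      using has_sum_cmult_right[OF has_sum_telescope_tail[of k n 0], of "1 / (real n - real k)"] by simp
    show "((\<lambda>p. ?b p n k) has_sum H n / (real n - real k)) {n<..}"
      using has_sum_cmult_right[OF has_sum_telescope_tail[of n n 0], of "1 / (real n - real k)"] by simp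
  next
    fix k :: nat assume "0 < k"
    show "((\<lambda>n. (H n - H (n - k)) / (real n - real k)) has_sum (H k ^ 2 + harm2 k) / 2) {k<..}"
      by (rule has_sum_shift_at) (use has_sum_H_diff_div[of k] in \<open>simp add: add.commute\<close>)
  next
    fix n :: nat
    show "(\<Sum>k\<in>{0<..<n}. H n / (real n - real k)) = H n * H (n - 1)"
      unfolding reflect[of "\<lambda>x. H n / x"] by (rule sum_cmult_recip) auto
  next
    fix p :: nat
    have "(\<Sum>n\<in>{0<..<p}. \<Sum>k\<in>{0<..<n}. ?c p n k) = (\<Sum>n\<in>{0<..<p}. (H (p - 1) - H (p - n)) / real (p - n))"
    proof (rule sum.cong[OF refl])
      fix n assume n: "n \<in> {0<..<p}"
      have "(\<Sum>k\<in>{0<..<n}. 1 / (real p - real k)) = (\<Sum>j=1..n-1. 1 / (real (p - n) + real j))"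
        by (rule sum.reindex_bij_witness[of _ "\<lambda>j. n - j" "\<lambda>j. n - j"]) (use n in \<open>auto simp: of_nat_diff\<close>)
      also have "\<dots> = H (p - 1) - H (p - n)"
        unfolding sum_recip_shift using n by simp
      finally show "(\<Sum>k\<in>{0<..<n}. ?c p n k) = (H (p - 1) - H (p - n)) / real (p - n)"
        using n by (simp add: of_nat_diff flip: divide_divide_eq_left sum_divide_distrib)
    qed
    also have "\<dots> = (\<Sum>n\<in>{0<..<p}. H (p - 1) * (1 / real n) - H n / real n)"
      using sum_reflect[of "\<lambda>n. (H (p - 1) - H n) / real n" p] by (simp add: diff_divide_distrib)
    also have "\<dots> = H (p - 1) * H (p - 1) - (H (p - 1) ^ 2 + harm2 (p - 1)) / 2"
      unfolding sum_subtractf sum_distrib_left[symmetric] recips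
      unfolding greaterThanLessThan_conv_atLeastAtMost sum_H_div ..
    also have "\<dots> = (H (p - 1) ^ 2 - harm2 (p - 1)) / 2"
      by (simp add: power2_eq_square field_simps)
    finally show "(\<Sum>n\<in>{0<..<p}. \<Sum>k\<in>{0<..<n}. ?c p n k) = (H (p - 1) ^ 2 - harm2 (p - 1)) / 2" .
  next
    have Hk: "log_bounded (\<lambda>k. H k ^ 2)" using log_bounded_mult_H by (simp add: power2_eq_square)
    show "(\<lambda>k. ?\<phi> k * ((H k ^ 2 + harm2 k) / 2)) summable_on {0<..}"
      using assms by (intro summable_log_bounded log_bounded_intros Hk) auto
    show "(\<lambda>k. ?\<phi> k * (H k * H (k - 1))) summable_on {0<..}"
      using assms by (intro summable_log_bounded log_bounded_le[OF log_bounded_mult_H])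
        (auto simp: abs_mult harm_nonneg intro!: mult_left_mono harm_mono)
    have "log_bounded (\<lambda>k. H (k - 1) ^ 2)"
      by (rule log_bounded_le[OF Hk]) (auto simp: harm_nonneg intro!: power_mono harm_mono)
    moreover have "log_bounded (\<lambda>k. harm2 (k - 1))"
      by (rule log_bounded_le[OF log_bounded_H])
         (auto simp: harm2_nonneg intro!: order_trans[OF harm2_le_H harm_mono])
    ultimately show "(\<lambda>k. ?\<phi> k * ((H (k - 1) ^ 2 - harm2 (k - 1)) / 2)) summable_on {0<..}"
      using assms by (intro summable_log_bounded log_bounded_intros) auto
  qed (auto intro!: divide_nonneg_nonneg divide_left_mono mult_pos_pos)
  also have "(\<Sum>\<^sub>\<infinity>k\<in>{0<..}. ?\<phi> k * ((H k ^ 2 + harm2 k) / 2 - H k * H (k - 1) + (H (k - 1) ^ 2 - harm2 (k - 1)) / 2))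
     = (\<Sum>\<^sub>\<infinity>k\<in>{0<..}. 1 / real k ^ l)"
  proof (rule infsum_cong)
    fix k :: nat assume "k \<in> {0<..}"
    then have "H (k - 1) = H k - 1 / real k" "harm2 (k - 1) = harm2 k - 1 / real k ^ 2"
      using H_conv_pred[of k] harm2_conv_pred[of k] by auto
    then have "(H k ^ 2 + harm2 k) / 2 - H k * H (k - 1) + (H (k - 1) ^ 2 - harm2 (k - 1)) / 2 = 1 / real k ^ 2"
      by (simp only:) (simp add: power2_eq_square algebra_simps add_divide_distrib diff_divide_distrib)
    then show "?\<phi> k * ((H k ^ 2 + harm2 k) / 2 - H k * H (k - 1) + (H (k - 1) ^ 2 - harm2 (k - 1)) / 2)
       = 1 / real k ^ l"
      using power_real_split[of 2 l k] assms by simp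
  qed
  also have "\<dots> = zeta_val l"
    using assms by (intro infsumI has_sum_zeta_val) auto
  finally show "((\<lambda>(p, n, k). ?\<phi> k * ?a p n k - ?\<phi> n * ?b p n k + ?\<phi> p * ?c p n k) has_sum zeta_val l) chains3" .
  fix p n k :: nat assume pnk: "0 < k" "k < n" "n < p"
  have e: "l - 1 - 1 = l - 2" by simp
  define u v w where "u = ?\<phi> k" and "v = ?\<phi> n" and "w = ?\<phi> p"
  have "pow_sum3 l (\<lambda>_ _ _. True) (1 / real p) (1 / real n) (1 / real k)
      = (((u - w) / (real p - real k) - 1 / real p * u) - ((v - w) / (real p - real n) - 1 / real p * v)) / (real n - real k)"
    using pow_sum3_split_low[of "real k" "real n" l "\<lambda>_ _. True" "1 / real p"] pnk assms
    by (simp only: pow_sum2_all of_nat_less_iff of_nat_0_less_iff e)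
       (simp add: pow_sum2_all u_def v_def w_def power_one_over numeral_2_eq_2)
  also have "\<dots> = u * ?a p n k - v * ?b p n k
      + w * ((1 / (real p - real n) - 1 / (real p - real k)) / (real n - real k))"
    by (simp add: diff_divide_distrib right_diff_distrib mult.commute)
  \<comment> \<open>The contributions - (1/p) u and + (1/p) v have already gone to k and n; what
    remains at p needs no regularising term, because its inner sums are finite.\<close>
  also have "(1 / (real p - real n) - 1 / (real p - real k)) / (real n - real k) = ?c p n k"
    using pnk by (simp add: divide_simps)
  finally show "(case (p, n, k) of (p, n, k) \<Rightarrow> ?\<phi> k * ?a p n k - ?\<phi> n * ?b p n k + ?\<phi> p * ?c p n k) =
      pow_sum3 l (\<lambda>_ _ _. True) (1 / real p) (1 / real n) (1 / real k)"
    by (simp add: u_def v_def w_def)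
qed

section \<open>The rearrangement relation and the evaluation of its harmonic side\<close>

lemma pow_sum2_nonneg: "x \<ge> 0 \<Longrightarrow> y \<ge> 0 \<Longrightarrow> pow_sum2 l P x y \<ge> 0"
  unfolding pow_sum2_def by (rule sum_nonneg) auto

lemma summable_pow_sum2_H:
  "(\<lambda>(m, k). pow_sum2 l P (1 / real m) (1 / real k) * H m) summable_on chains2"
proof -
  have "(\<lambda>x. \<Sum>i\<in>{(a, b). a \<ge> 2 \<and> b \<ge> 1 \<and> a + b = l \<and> P a b}.
     (case i of (a, b) \<Rightarrow> \<lambda>(m, k). (1 / real m) ^ a * (1 / real k) ^ b * H m) x) summable_on chains2"
  proof (rule has_sum_imp_summable[OF has_sum_sum[OF has_sum_infsum]], clarify)
    fix a b :: nat assume ab: "a \<ge> 2" "b \<ge> 1"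
    show "(\<lambda>(m, k). (1 / real m) ^ a * (1 / real k) ^ b * H m) summable_on chains2"
    proof (rule summable_on_comparison_test[OF summable_chains2_base], goal_cases)
      case (1 x)
      obtain m k where x: "x = (m, k)" by (cases x)
      have "(1 / real m) ^ a * (1 / real k) ^ b * H m \<le> (1 / real m ^ 2) * (1 / real k ^ 1) * H m"
        by (intro mult_mono power_recip_le ab) (auto simp: harm_nonneg)
      then show ?case by (simp add: x)
    qed (auto simp: harm_nonneg)
  qed
  then show ?thesis by (simp add: pow_sum2_def case_prod_unfold sum_distrib_right)
qed

text \<open>The weight H m - H (k - 1) is the sum of 1/i over k <= i <= m. For one pair (a, b) the
  right side is thus zeta(a+1, b) + zeta(a, b+1) + zeta(a, 1, b), while the left side splits b and a
  in all admissible ways. It follows by matching the summands of \<open>chains3_to_chains2\<close>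
  with the two splittings of \<open>pow_sum3\<close>.\<close>

lemma mzv_sum3_shuffle:
  "mzv_sum3 l (\<lambda>a b c. P a (b + c - 1)) + mzv_sum3 l (\<lambda>a b c. P (a + b - 1) c)
    = (\<Sum>\<^sub>\<infinity>(m, k)\<in>chains2. pow_sum2 (l - 1) P (1 / real m) (1 / real k) * (H m - H (k - 1)))"
proof -
  let ?F = "\<lambda>m k. pow_sum2 (l - 1) P (1 / real m) (1 / real k)"
  have "((\<lambda>(p, n, k). (?F p k - ?F p n) / (real n - real k)
             + (?F n k * (1 / (real p - real n) - 1 / real p) - ?F p k / (real p - real n)))
          has_sum (\<Sum>\<^sub>\<infinity>(m, k)\<in>chains2. ?F m k * (H m - H (k - 1)))) chains3"
    by (intro chains3_to_chains2 pow_sum2_nonneg summable_pow_sum2_H) auto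
  moreover have "((\<lambda>(p, n, k). pow_sum3 l (\<lambda>a b c. P a (b + c - 1)) (1 / real p) (1 / real n) (1 / real k)
      + pow_sum3 l (\<lambda>a b c. P (a + b - 1) c) (1 / real p) (1 / real n) (1 / real k))
      has_sum mzv_sum3 l (\<lambda>a b c. P a (b + c - 1)) + mzv_sum3 l (\<lambda>a b c. P (a + b - 1) c)) chains3"
    using has_sum_add[OF mzv_sum3_has_sum mzv_sum3_has_sum] by (simp add: case_prod_unfold)
  then have "((\<lambda>(p, n, k). (?F p k - ?F p n) / (real n - real k)
             + (?F n k * (1 / (real p - real n) - 1 / real p) - ?F p k / (real p - real n)))
      has_sum mzv_sum3 l (\<lambda>a b c. P a (b + c - 1)) + mzv_sum3 l (\<lambda>a b c. P (a + b - 1) c)) chains3"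
  proof (rule has_sum_cong[THEN iffD1, rotated], clarify)
    fix p n k assume "(p, n, k) \<in> chains3"
    then have pnk: "0 < real k" "real k < real n" "0 < real n" "real n < real p" by (auto simp: chains3_def)
    show "pow_sum3 l (\<lambda>a b c. P a (b + c - 1)) (1 / real p) (1 / real n) (1 / real k)
      + pow_sum3 l (\<lambda>a b c. P (a + b - 1) c) (1 / real p) (1 / real n) (1 / real k)
      = (?F p k - ?F p n) / (real n - real k)
             + (?F n k * (1 / (real p - real n) - 1 / real p) - ?F p k / (real p - real n))"
      by (rule arg_cong2[where f = "(+)", OF pow_sum3_split_low[where P = P, OF pnk(1,2)] pow_sum3_split_high[where P = P, OF pnk(3,4)]])
  qed
  ultimately show ?thesis by (rule has_sum_unique[symmetric])
qed

text \<open>Difference and sum of \<open>sum_H_minus\<close> and \<open>sum_H_plus\<close>; the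
  constants are 3/2 = 2 - 1/2 and 5/2 = 2 + 1/2.\<close>

lemma sum_H_kernel:
  assumes "m > 0"
  shows "(\<Sum>k\<in>{0<..<m}. (H m - H (k - 1)) * (1 / (real m - real k) - 1 / (real m + real k)))
           = harm2 m / 2 + H m / real m - 3 / (2 * real m ^ 2)"
    and "(\<Sum>k\<in>{0<..<m}. (H m - H (k - 1)) * (1 / (real m - real k) + 1 / (real m + real k)))
           = 3 * harm2 m / 2 + H m / real m - 5 / (2 * real m ^ 2)"
proof -
  define x where "x = 1 / real m ^ 2"
  have d: "c / real m ^ 2 = c * x" "c / (2 * real m ^ 2) = c * x / 2" for c
    by (simp_all add: x_def)
  note sums = sum_H_plus[OF assms, unfolded d] sum_H_minus[OF assms, unfolded d]
  have "(\<Sum>k\<in>{0<..<m}. (H m - H (k - 1)) * (1 / (real m - real k) - 1 / (real m + real k)))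
      = harm2 m + H m / real m - 2 * x - (harm2 m / 2 - 1 * x / 2)"
    unfolding sums[symmetric] sum_subtractf[symmetric] by (simp only: right_diff_distrib times_divide_eq_right mult_1_right)
  also have "\<dots> = harm2 m / 2 + H m / real m - 3 / (2 * real m ^ 2)"
    unfolding d by simp
  finally show "(\<Sum>k\<in>{0<..<m}. (H m - H (k - 1)) * (1 / (real m - real k) - 1 / (real m + real k)))
      = harm2 m / 2 + H m / real m - 3 / (2 * real m ^ 2)" .
  have "(\<Sum>k\<in>{0<..<m}. (H m - H (k - 1)) * (1 / (real m - real k) + 1 / (real m + real k)))
      = harm2 m + H m / real m - 2 * x + (harm2 m / 2 - 1 * x / 2)"
    unfolding sums[symmetric] sum.distrib[symmetric] by (simp only: distrib_left times_divide_eq_right mult_1_right)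
  also have "\<dots> = 3 * harm2 m / 2 + H m / real m - 5 / (2 * real m ^ 2)"
    unfolding d by simp
  finally show "(\<Sum>k\<in>{0<..<m}. (H m - H (k - 1)) * (1 / (real m - real k) + 1 / (real m + real k)))
      = 3 * harm2 m / 2 + H m / real m - 5 / (2 * real m ^ 2)" .
qed

lemma recip_diff_sq':
  assumes "real k < real m"
  shows "real k / (real m ^ 2 - real k ^ 2) = (1 / (real m - real k) - 1 / (real m + real k)) / 2"
    and "k > 0 \<Longrightarrow> 1 / (real m ^ 2 - real k ^ 2) = (1 / (real m - real k) - 1 / (real m + real k)) / (2 * real k)"
    and "real m / (real m ^ 2 - real k ^ 2) = (1 / (real m - real k) + 1 / (real m + real k)) / 2"
proof -
  have *: "real m ^ 2 - real k ^ 2 = (real m - real k) * (real m + real k)"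
    by (simp add: power2_eq_square algebra_simps)
  show "real k / (real m ^ 2 - real k ^ 2) = (1 / (real m - real k) - 1 / (real m + real k)) / 2"
    "k > 0 \<Longrightarrow> 1 / (real m ^ 2 - real k ^ 2) = (1 / (real m - real k) - 1 / (real m + real k)) / (2 * real k)"
    "real m / (real m ^ 2 - real k ^ 2) = (1 / (real m - real k) + 1 / (real m + real k)) / 2"
    unfolding * using assms by (auto simp: divide_simps)
qed

lemma diff_sq_pos: "k < m \<Longrightarrow> real m ^ 2 - real k ^ 2 > 0"
  by (simp add: power_strict_mono)

text \<open>The odd second exponent puts a factor k on the kernel, so summing over either variable
  meets the same kernel k / (m^2 - k^2). The harmonic terms then agree in both residues and only
  zeta(2) / 2 and 3 / (4 k^2) are left.\<close>

lemma infsum_pow_sum2_even_odd: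
  assumes "even l" "l \<ge> 4"
  shows "(\<Sum>\<^sub>\<infinity>(m, k)\<in>chains2. pow_sum2 (l - 1) (\<lambda>a b. even a \<and> odd b) (1 / real m) (1 / real k) * (H m - H (k - 1)))
     = 3/4 * zeta_val l + 1/2 * zeta_val 2 * zeta_val (l - 2)"
proof -
  let ?\<phi> = "\<lambda>k. 1 / real k ^ (l - 2)"
  let ?a = "\<lambda>m k. real k * (H m - H (k - 1)) / (real m ^ 2 - real k ^ 2)"
  have a: "?a m k = (H m - H (k - 1)) * (1 / (real m - real k) - 1 / (real m + real k)) / 2" if "k < m" for m k
  proof -
    have "?a m k = (H m - H (k - 1)) * (real k / (real m ^ 2 - real k ^ 2))" by simp
    also have "real k / (real m ^ 2 - real k ^ 2) = (1 / (real m - real k) - 1 / (real m + real k)) / 2"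
      using that by (intro recip_diff_sq') simp
    finally show ?thesis by (simp only: times_divide_eq_right)
  qed
  let ?\<alpha> = "\<lambda>k. (zeta_val 2 + harm2 k / 2 + H k / real k) / 2"
  let ?\<beta> = "\<lambda>k. (harm2 k / 2 + H k / real k - 3 / 2 * (1 / real k ^ 2)) / 2"
  have "((\<lambda>(m, k). ?\<phi> k * ?a m k - ?\<phi> m * ?a m k) has_sum (\<Sum>\<^sub>\<infinity>k\<in>{0<..}. ?\<phi> k * (?\<alpha> k - ?\<beta> k))) chains2"
  proof (rule chains2_residues)
    show "?a m k \<ge> 0" "?a m k \<ge> 0" if "0 < k" "k < m" for m k
      using that diff_sq_pos[of k m] by (auto intro!: divide_nonneg_nonneg mult_nonneg_nonneg harm_mono)
  next
    fix k :: nat assume "k > 0"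
    from has_sum_divide_const[OF has_sum_H_kernel[OF this], of 2]
    show "((\<lambda>m. ?a m k) has_sum ?\<alpha> k) {k<..}"
      by (rule has_sum_cong[THEN iffD1, rotated]) (use a in auto)
  next
    fix m :: nat assume "m > 0"
    have "(\<Sum>k\<in>{0<..<m}. ?a m k)
       = (\<Sum>k\<in>{0<..<m}. (H m - H (k - 1)) * (1 / (real m - real k) - 1 / (real m + real k)) / 2)"
      by (rule sum.cong) (use a in auto)
    then show "(\<Sum>k\<in>{0<..<m}. ?a m k) = ?\<beta> m"
      using sum_H_kernel(1)[OF \<open>m > 0\<close>] by (simp flip: sum_divide_distrib)
  next
    show "(\<lambda>k. ?\<phi> k * ?\<alpha> k) summable_on {0<..}" "(\<lambda>k. ?\<phi> k * ?\<beta> k) summable_on {0<..}"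
      using assms by (intro summable_log_bounded log_bounded_intros; simp)+
  qed auto
  also have "?this \<longleftrightarrow> ((\<lambda>(m, k). pow_sum2 (l - 1) (\<lambda>a b. even a \<and> odd b) (1 / real m) (1 / real k) * (H m - H (k - 1)))
      has_sum (\<Sum>\<^sub>\<infinity>k\<in>{0<..}. ?\<phi> k * (?\<alpha> k - ?\<beta> k))) chains2"
  proof (rule has_sum_cong, clarify)
    fix m k assume "(m, k) \<in> chains2"
    then have mk: "0 < k" "k < m" by (auto simp: chains2_def)
    have "pow_sum2 (l - 1) (\<lambda>a b. even a \<and> odd b) (1 / real m) (1 / real k)
       = real k * ((?\<phi> k - ?\<phi> m) / (real m ^ 2 - real k ^ 2))"
      using mk assms by (simp add: pow_sum2_even_odd pow_sum2_even_even power_one_over)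
    moreover have "u * (r * d / D) - v * (r * d / D) = r * ((u - v) / D) * d" for u v r d D :: real
      by (simp add: algebra_simps diff_divide_distrib)
    ultimately show "?\<phi> k * ?a m k - ?\<phi> m * ?a m k
       = pow_sum2 (l - 1) (\<lambda>a b. even a \<and> odd b) (1 / real m) (1 / real k) * (H m - H (k - 1))"
      by (simp only:)
  qed
  finally have "(\<Sum>\<^sub>\<infinity>(m, k)\<in>chains2. pow_sum2 (l - 1) (\<lambda>a b. even a \<and> odd b) (1 / real m) (1 / real k) * (H m - H (k - 1)))
      = (\<Sum>\<^sub>\<infinity>k\<in>{0<..}. ?\<phi> k * (?\<alpha> k - ?\<beta> k))"
    by (rule infsumI)
  also have "\<dots> = (\<Sum>\<^sub>\<infinity>k\<in>{0<..}. 3/4 * (1 / real k ^ l) + 1/2 * zeta_val 2 * (1 / real k ^ (l - 2)))"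
  proof (rule infsum_cong)
    fix k :: nat
    define c x where "c = ?\<phi> k" and "x = 1 / real k ^ 2"
    have "?\<alpha> k - ?\<beta> k = 3/4 * x + 1/2 * zeta_val 2" unfolding x_def by (simp add: field_simps)
    moreover have "1 / real k ^ l = c * x"
      using power_real_split[of 2 l k] assms by (simp add: c_def x_def)
    ultimately show "?\<phi> k * (?\<alpha> k - ?\<beta> k) = 3/4 * (1 / real k ^ l) + 1/2 * zeta_val 2 * (1 / real k ^ (l - 2))"
      unfolding c_def[symmetric] by (simp only:) (simp add: algebra_simps)
  qed
  also have "\<dots> = 3/4 * zeta_val l + 1/2 * zeta_val 2 * zeta_val (l - 2)"
    using assms by (intro infsumI has_sum_add has_sum_cmult_right has_sum_zeta_val) auto
  finally show ?thesis .
qed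

text \<open>Without the factor k, the partial fractions of 1/(m^2 - k^2) carry 1/(2k) with a minus
  sign when m varies but 1/(2m) with a plus sign when k varies. The \<open>harm2\<close> terms no
  longer cancel: 1/2 - 3/2 = -1 completes the tail zeta(2) - \<open>harm2 k\<close>, hence zeta(2,
  l-2).\<close>

lemma infsum_pow_sum2_even_even:
  assumes "odd l" "l \<ge> 5"
  shows "(\<Sum>\<^sub>\<infinity>(m, k)\<in>chains2. pow_sum2 (l - 1) (\<lambda>a b. even a \<and> even b) (1 / real m) (1 / real k) * (H m - H (k - 1)))
     = 5/4 * zeta_val l + 1/2 * mzv [2, l - 2]"
proof -
  let ?\<phi> = "\<lambda>k. 1 / real k ^ (l - 3)"
  let ?a = "\<lambda>m k. (H m - H (k - 1)) / (real m ^ 2 - real k ^ 2)"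
  let ?\<alpha> = "\<lambda>k. (zeta_val 2 + harm2 k / 2 + H k / real k) / 2 / real k"
  let ?\<beta> = "\<lambda>k. (3 / 2 * harm2 k + H k / real k - 5 / 2 * (1 / real k ^ 2)) / 2 / real k"
  have "((\<lambda>(m, k). ?\<phi> k * ?a m k - ?\<phi> m * ?a m k) has_sum (\<Sum>\<^sub>\<infinity>k\<in>{0<..}. ?\<phi> k * (?\<alpha> k - ?\<beta> k))) chains2"
  proof (rule chains2_residues)
    show "?a m k \<ge> 0" "?a m k \<ge> 0" if "0 < k" "k < m" for m k
      using that diff_sq_pos[of k m] by (auto intro!: divide_nonneg_nonneg harm_mono)
  next
    fix k :: nat assume k: "k > 0"
    have eq: "(H m - H (k - 1)) * (1 / (real m - real k) - 1 / (real m + real k)) / 2 / real k = ?a m k" if "k < m" for m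
    proof -
      have "?a m k = (H m - H (k - 1)) * (1 / (real m ^ 2 - real k ^ 2))" by simp
      also have "1 / (real m ^ 2 - real k ^ 2) = (1 / (real m - real k) - 1 / (real m + real k)) / (2 * real k)"
        using that k by (intro recip_diff_sq') auto
      finally show ?thesis by (simp only: times_divide_eq_right divide_divide_eq_left)
    qed
    from has_sum_divide_const[OF has_sum_divide_const[OF has_sum_H_kernel[OF k], of 2], of "real k"]
    show "((\<lambda>m. ?a m k) has_sum ?\<alpha> k) {k<..}"
      by (rule has_sum_cong[THEN iffD1, rotated]) (use eq in auto)
  next
    fix m :: nat assume m: "m > 0"
    have "(\<Sum>k\<in>{0<..<m}. ?a m k)
       = (\<Sum>k\<in>{0<..<m}. (H m - H (k - 1)) * (1 / (real m - real k) + 1 / (real m + real k)) / (2 * real m))"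
    proof (rule sum.cong[OF refl])
      fix k assume "k \<in> {0<..<m}"
      then have "1 / (real m ^ 2 - real k ^ 2) = (1 / (real m - real k) + 1 / (real m + real k)) / (2 * real m)"
        by (intro recip_diff_sq) auto
      then show "?a m k = (H m - H (k - 1)) * (1 / (real m - real k) + 1 / (real m + real k)) / (2 * real m)"
        by (metis mult.right_neutral times_divide_eq_right)
    qed
    also have "\<dots> = (3 * harm2 m / 2 + H m / real m - 5 / (2 * real m ^ 2)) / (2 * real m)"
      unfolding sum_divide_distrib[symmetric] sum_H_kernel(2)[OF m] ..
    finally show "(\<Sum>k\<in>{0<..<m}. ?a m k) = ?\<beta> m"
      by simp
  next
    show "(\<lambda>k. ?\<phi> k * ?\<alpha> k) summable_on {0<..}" "(\<lambda>k. ?\<phi> k * ?\<beta> k) summable_on {0<..}"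
      using assms by (intro summable_log_bounded log_bounded_intros; simp)+
  qed auto
  also have "?this \<longleftrightarrow> ((\<lambda>(m, k). pow_sum2 (l - 1) (\<lambda>a b. even a \<and> even b) (1 / real m) (1 / real k) * (H m - H (k - 1)))
      has_sum (\<Sum>\<^sub>\<infinity>k\<in>{0<..}. ?\<phi> k * (?\<alpha> k - ?\<beta> k))) chains2"
  proof (rule has_sum_cong, clarify)
    fix m k assume "(m, k) \<in> chains2"
    then have mk: "0 < k" "k < m" by (auto simp: chains2_def)
    have "l - 1 - 2 = l - 3" by simp
    then have "pow_sum2 (l - 1) (\<lambda>a b. even a \<and> even b) (1 / real m) (1 / real k)
       = (?\<phi> k - ?\<phi> m) / (real m ^ 2 - real k ^ 2)"
      using mk assms by (subst pow_sum2_even_even) (auto simp only: power_one_over of_nat_less_iff of_nat_0_less_iff, simp_all)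
    moreover have "u * (d / D) - v * (d / D) = (u - v) / D * d" for u v d D :: real
      by (simp add: algebra_simps diff_divide_distrib)
    ultimately show "?\<phi> k * ?a m k - ?\<phi> m * ?a m k
       = pow_sum2 (l - 1) (\<lambda>a b. even a \<and> even b) (1 / real m) (1 / real k) * (H m - H (k - 1))"
      by (simp only:)
  qed
  finally have "(\<Sum>\<^sub>\<infinity>(m, k)\<in>chains2. pow_sum2 (l - 1) (\<lambda>a b. even a \<and> even b) (1 / real m) (1 / real k) * (H m - H (k - 1)))
      = (\<Sum>\<^sub>\<infinity>k\<in>{0<..}. ?\<phi> k * (?\<alpha> k - ?\<beta> k))"
    by (rule infsumI)
  also have "\<dots> = (\<Sum>\<^sub>\<infinity>k\<in>{0<..}. 5/4 * (1 / real k ^ l) + 1/2 * (1 / real k ^ (l - 2) * (zeta_val 2 - harm2 k)))"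
  proof (rule infsum_cong)
    fix k :: nat
    define c x where "c = ?\<phi> k" and "x = 1 / real k"
    have "?\<alpha> k - ?\<beta> k = (zeta_val 2 + harm2 k / 2 + H k * x) / 2 * x - (3 / 2 * harm2 k + H k * x - 5 / 2 * x ^ 2) / 2 * x"
      by (simp add: x_def power_one_over)
    also have "\<dots> = x * (5/4 * x ^ 2 + 1/2 * (zeta_val 2 - harm2 k))"
      by (simp add: field_simps)
    finally have "?\<alpha> k - ?\<beta> k = x * (5/4 * x ^ 2 + 1/2 * (zeta_val 2 - harm2 k))" .
    moreover have "1 / real k ^ l = c * x ^ 3" "1 / real k ^ (l - 2) = c * x"
      using power_real_split[of 3 l k] power_real_split[of 1 "l - 2" k] assms by (simp_all add: c_def x_def power_one_over)
    ultimately show "?\<phi> k * (?\<alpha> k - ?\<beta> k) = 5/4 * (1 / real k ^ l) + 1/2 * (1 / real k ^ (l - 2) * (zeta_val 2 - harm2 k))"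
      unfolding c_def[symmetric] by (simp only:) (simp add: algebra_simps power2_eq_square power3_eq_cube)
  qed
  also have "\<dots> = 5/4 * zeta_val l + 1/2 * mzv [2, l - 2]"
    using assms by (intro infsumI has_sum_add has_sum_cmult_right has_sum_zeta_val has_sum_mzv_2) auto
  finally show ?thesis .
qed

section \<open>The all-even sum of depth three\<close>

lemma has_sum_recip_diff_sq_tail:
  assumes "0 < k" "k \<le> n"
  shows "((\<lambda>p. 1 / (real p ^ 2 - real k ^ 2)) has_sum (H (n + k) - H (n - k)) / (2 * real k)) {n<..}"
  using has_sum_divide_const[OF has_sum_telescope_tail[OF assms(2)], of k "2 * real k"]
  by (rule has_sum_cong[THEN iffD1, rotated]) (use assms in \<open>auto simp: recip_diff_sq'(2)\<close>)

text \<open>Putting n = k + j turns the numerator into H (j + 2k) - H j and the denominators into j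
  and j + 2k, so both earlier series apply with s = 2k.\<close>

lemma has_sum_H_symmetric_kernel:
  assumes "k > 0"
  shows "((\<lambda>n. (H (n + k) - H (n - k)) * (1 / (real n - real k) - 1 / (real n + real k))) has_sum
      (H (2 * k) ^ 2 + harm2 (2 * k)) / 2 - (zeta_val 2 - H (2 * k) / (2 * real k))) {k<..}"
    and "((\<lambda>n. (H (n + k) - H (n - k)) * (1 / (real n - real k) + 1 / (real n + real k))) has_sum
      (H (2 * k) ^ 2 + harm2 (2 * k)) / 2 + (zeta_val 2 - H (2 * k) / (2 * real k))) {k<..}"
proof -
  have k: "2 * k > 0" using assms by simp
  have e: "k + j + k = j + 2 * k" "k + j - k = j" "real (k + j) - real k = real j"
    "real (k + j) + real k = real j + real (2 * k)" for j by auto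
  have 1: "((\<lambda>n. (H (n + k) - H (n - k)) / (real n - real k)) has_sum (H (2 * k) ^ 2 + harm2 (2 * k)) / 2) {k<..}"
    by (rule has_sum_shift_at) (unfold e, rule has_sum_H_diff_div)
  have 2: "((\<lambda>n. (H (n + k) - H (n - k)) / (real n + real k)) has_sum zeta_val 2 - H (2 * k) / (2 * real k)) {k<..}"
    by (rule has_sum_shift_at) (unfold e, use has_sum_H_diff_div_shift[OF k] in simp)
  show "((\<lambda>n. (H (n + k) - H (n - k)) * (1 / (real n - real k) - 1 / (real n + real k))) has_sum
      (H (2 * k) ^ 2 + harm2 (2 * k)) / 2 - (zeta_val 2 - H (2 * k) / (2 * real k))) {k<..}"
    using has_sum_diff[OF 1 2] by (simp only: right_diff_distrib times_divide_eq_right mult_1_right)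
  show "((\<lambda>n. (H (n + k) - H (n - k)) * (1 / (real n - real k) + 1 / (real n + real k))) has_sum
      (H (2 * k) ^ 2 + harm2 (2 * k)) / 2 + (zeta_val 2 - H (2 * k) / (2 * real k))) {k<..}"
    using has_sum_add[OF 1 2] by (simp only: distrib_left times_divide_eq_right mult_1_right)
qed

lemma sum_pairs_less:
  fixes f :: "nat \<Rightarrow> real"
  shows "(\<Sum>n\<in>{0<..<p}. \<Sum>k\<in>{0<..<n}. f n * f k) = ((\<Sum>n\<in>{0<..<p}. f n) ^ 2 - (\<Sum>n\<in>{0<..<p}. f n ^ 2)) / 2"
proof (induction p)
  case (Suc p)
  show ?case
  proof (cases "p = 0")
    case False
    then have "{0<..<Suc p} = insert p {0<..<p}" by auto
    with Suc show ?thesis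
      by (simp add: power2_eq_square algebra_simps add_divide_distrib flip: sum_distrib_left)
  next
    case True
    then have "{0<..<Suc p} = {}" by auto
    then show ?thesis by simp
  qed
qed simp

lemma pow_sum3_even_even_even_residues:
  assumes "0 < k" "k < n" "n < p" "even l" "l \<ge> 4"
  shows "pow_sum3 l (\<lambda>a b c. even a \<and> even b \<and> even c) (1 / p) (1 / n) (1 / k)
    = (1 / k) ^ (l - 4) * (1 / ((p ^ 2 - k ^ 2) * (n ^ 2 - k ^ 2)))
      - (1 / n) ^ (l - 4) * (1 / ((p ^ 2 - n ^ 2) * (n ^ 2 - k ^ 2)))
      + (1 / p) ^ (l - 4) * (1 / ((p ^ 2 - k ^ 2) * (p ^ 2 - n ^ 2)))"
proof -
  define u v w where "u = (1 / k) ^ (l - 4)" and "v = (1 / n) ^ (l - 4)" and "w = (1 / p) ^ (l - 4)"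
  define A B C where "A = p ^ 2 - k ^ 2" and "B = p ^ 2 - n ^ 2" and "C = n ^ 2 - k ^ 2"
  have ABC: "A > 0" "B > 0" "C > 0" "A = B + C"
    using assms by (auto simp: A_def B_def C_def power_strict_mono)
  have "l - 2 - 2 = l - 4" by simp
  then have "pow_sum2 (l - 2) (\<lambda>a b. even a \<and> even b) (1 / p) (1 / k) = (u - w) / A"
    "pow_sum2 (l - 2) (\<lambda>a b. even a \<and> even b) (1 / p) (1 / n) = (v - w) / B"
    using assms by (simp_all add: pow_sum2_even_even u_def v_def w_def A_def B_def)
  then have "pow_sum3 l (\<lambda>a b c. even a \<and> even b \<and> even c) (1 / p) (1 / n) (1 / k) = ((u - w) / A - (v - w) / B) / C"
    using assms by (simp add: pow_sum3_even_even_even C_def)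
  also have "\<dots> = u * (1 / (A * C)) - v * (1 / (B * C)) + w * ((1 / B - 1 / A) / C)"
    by (simp add: diff_divide_distrib right_diff_distrib)
  \<comment> \<open>This uses A = B + C, that is A - B = C.\<close>
  also have "(1 / B - 1 / A) / C = 1 / (A * B)"
    using ABC(1-3) unfolding ABC(4) by (simp add: divide_simps)
  finally show ?thesis unfolding u_def v_def w_def A_def B_def C_def .
qed

lemma mzv_sum3_even_even_even:
  assumes "even l" "l \<ge> 4"
  shows "mzv_sum3 l (\<lambda>a b c. even a \<and> even b \<and> even c) = 5/8 * zeta_val l - 1/4 * (zeta_val (l - 2) * zeta_val 2)"
proof (rule mzv_sum3_eqI)
  \<comment> \<open>Partial fractions give exponent l - 4, too small for convergence at l = 4. The
    square of the fixed integer is moved into each kernel, whose sums are then only of size (log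
    k)^2.\<close>
  let ?\<phi> = "\<lambda>k. 1 / real k ^ (l - 2)"
  let ?a = "\<lambda>p n k. real k ^ 2 * (1 / ((real p ^ 2 - real k ^ 2) * (real n ^ 2 - real k ^ 2)))"
  let ?b = "\<lambda>p n k. real n ^ 2 * (1 / ((real p ^ 2 - real n ^ 2) * (real n ^ 2 - real k ^ 2)))"
  let ?c = "\<lambda>p n k. real p ^ 2 * (1 / ((real p ^ 2 - real k ^ 2) * (real p ^ 2 - real n ^ 2)))"
  let ?\<alpha> = "\<lambda>k. ((H (2 * k) ^ 2 + harm2 (2 * k)) / 2 - (zeta_val 2 - H (2 * k) / real k / 2)) / 4"
  let ?\<beta> = "\<lambda>k. (H (2 * k) ^ 2 - 3 / 2 * (H (2 * k) / real k)) / 4"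
  let ?\<gamma> = "\<lambda>k. (H (2 * k) ^ 2 - 4 * (H (2 * k) / real k) + 5 * (1 / real k ^ 2) - harm2 (2 * k)) / 8"
  have "((\<lambda>(p, n, k). ?\<phi> k * ?a p n k - ?\<phi> n * ?b p n k + ?\<phi> p * ?c p n k) has_sum
     (\<Sum>\<^sub>\<infinity>k\<in>{0<..}. ?\<phi> k * (?\<alpha> k - ?\<beta> k + ?\<gamma> k))) chains3"
  proof (rule chains3_residues[where a' = "\<lambda>n k. (H (n + k) - H (n - k)) * (1 / (real n - real k) - 1 / (real n + real k)) / 4"
        and b' = "\<lambda>n k. real n * H (2 * n) / 2 * (1 / (real n ^ 2 - real k ^ 2))"])
    fix p n k :: nat assume "0 < k" "k < n" "n < p"
    then show "?a p n k \<ge> 0" "?b p n k \<ge> 0" "?c p n k \<ge> 0"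
      using diff_sq_pos[of k n] diff_sq_pos[of n p] diff_sq_pos[of k p] by auto
  next
    fix n k :: nat assume kn: "0 < k" "k < n"
    have "((\<lambda>p. real k ^ 2 * (1 / (real n ^ 2 - real k ^ 2)) * (1 / (real p ^ 2 - real k ^ 2))) has_sum
        real k ^ 2 * (1 / (real n ^ 2 - real k ^ 2)) * ((H (n + k) - H (n - k)) / (2 * real k))) {n<..}"
      using kn by (intro has_sum_cmult_right has_sum_recip_diff_sq_tail) auto
    also have "real k ^ 2 * (1 / (real n ^ 2 - real k ^ 2)) * ((H (n + k) - H (n - k)) / (2 * real k))
       = (H (n + k) - H (n - k)) * (1 / (real n - real k) - 1 / (real n + real k)) / 4"
      using kn by (subst recip_diff_sq'(2)) (auto simp: power2_eq_square)
    finally show "((\<lambda>p. ?a p n k) has_sum (H (n + k) - H (n - k)) * (1 / (real n - real k) - 1 / (real n + real k)) / 4) {n<..}"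
      by (simp add: mult.commute)
    have "((\<lambda>p. real n ^ 2 * (1 / (real n ^ 2 - real k ^ 2)) * (1 / (real p ^ 2 - real n ^ 2))) has_sum
        real n ^ 2 * (1 / (real n ^ 2 - real k ^ 2)) * ((H (n + n) - H (n - n)) / (2 * real n))) {n<..}"
      using kn by (intro has_sum_cmult_right has_sum_recip_diff_sq_tail) auto
    also have "real n ^ 2 * (1 / (real n ^ 2 - real k ^ 2)) * ((H (n + n) - H (n - n)) / (2 * real n))
       = real n * H (2 * n) / 2 * (1 / (real n ^ 2 - real k ^ 2))"
    proof -
      have "y ^ 2 * X * (Y / (2 * y)) = y * Y / 2 * X" if "y > 0" for X Y y :: real
        using that by (simp add: power2_eq_square)
      from this[of "real n" "1 / (real n ^ 2 - real k ^ 2)" "H (2 * n)"] kn show ?thesis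
        by (simp only: mult_2 diff_self_eq_0 H_0 diff_zero of_nat_0_less_iff)
    qed
    finally show "((\<lambda>p. ?b p n k) has_sum real n * H (2 * n) / 2 * (1 / (real n ^ 2 - real k ^ 2))) {n<..}"
      by (simp add: mult.commute)
  next
    fix k :: nat assume k: "0 < k"
    from has_sum_divide_const[OF has_sum_H_symmetric_kernel(1)[OF k], of 4]
    show "((\<lambda>n. (H (n + k) - H (n - k)) * (1 / (real n - real k) - 1 / (real n + real k)) / 4) has_sum ?\<alpha> k) {k<..}"
      by (simp add: mult.commute)
  next
    fix n :: nat assume n: "n > 0"
    have "(\<Sum>k\<in>{0<..<n}. real n * H (2 * n) / 2 * (1 / (real n ^ 2 - real k ^ 2)))
       = real n * H (2 * n) / 2 * ((H (2 * n) - 3 / (2 * real n)) / (2 * real n))"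
      unfolding sum_distrib_left[symmetric] sum_recip_diff_sq[OF n] ..
    also have "\<dots> = ?\<beta> n"
      using n by (simp add: field_simps power2_eq_square)
    finally show "(\<Sum>k\<in>{0<..<n}. real n * H (2 * n) / 2 * (1 / (real n ^ 2 - real k ^ 2))) = ?\<beta> n" .
  next
    fix p :: nat assume p: "p > 0"
    have "(\<Sum>n\<in>{0<..<p}. \<Sum>k\<in>{0<..<n}. ?c p n k)
       = real p ^ 2 * (\<Sum>n\<in>{0<..<p}. \<Sum>k\<in>{0<..<n}. (1 / (real p ^ 2 - real n ^ 2)) * (1 / (real p ^ 2 - real k ^ 2)))"
      unfolding sum_distrib_left by (simp add: mult.commute)
    also have "\<dots> = real p ^ 2 * ((((H (2 * p) - 3 / (2 * real p)) / (2 * real p)) ^ 2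
       - (harm2 (2 * p) - 5 / (4 * real p ^ 2) + (H (2 * p) - 3 / (2 * real p)) / real p) / (4 * real p ^ 2)) / 2)"
      unfolding sum_pairs_less sum_recip_diff_sq[OF p] sum_recip_diff_sq_sq[OF p] ..
    also have "\<dots> = ((H (2 * p) - 3 / (2 * real p)) ^ 2
       - (harm2 (2 * p) - 5 / (4 * real p ^ 2) + (H (2 * p) - 3 / (2 * real p)) / real p)) / 8"
    proof -
      have "r ^ 2 * (((A / (2 * r)) ^ 2 - B / (4 * r ^ 2)) / 2) = (A ^ 2 - B) / 8" if "r > 0" for r A B :: real
        using that by (simp add: power_divide power_mult_distrib field_simps)
      then show ?thesis using p by simp
    qed
    also have "\<dots> = ?\<gamma> p"
      by (simp add: power2_eq_square algebra_simps diff_divide_distrib add_divide_distrib)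
    finally show "(\<Sum>n\<in>{0<..<p}. \<Sum>k\<in>{0<..<n}. ?c p n k) = ?\<gamma> p" .
  next
    show "(\<lambda>k. ?\<phi> k * ?\<alpha> k) summable_on {0<..}" "(\<lambda>k. ?\<phi> k * ?\<beta> k) summable_on {0<..}"
      "(\<lambda>k. ?\<phi> k * ?\<gamma> k) summable_on {0<..}"
      using assms by (intro summable_log_bounded log_bounded_intros; simp)+
  qed auto
  also have "(\<Sum>\<^sub>\<infinity>k\<in>{0<..}. ?\<phi> k * (?\<alpha> k - ?\<beta> k + ?\<gamma> k))
      = (\<Sum>\<^sub>\<infinity>k\<in>{0<..}. 5/8 * (1 / real k ^ l) - 1/4 * zeta_val 2 * (1 / real k ^ (l - 2)))"
  proof (rule infsum_cong)
    fix k :: nat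
    define c x where "c = ?\<phi> k" and "x = 1 / real k ^ 2"
    \<comment> \<open>All terms at 2k cancel: the squares as 1/8 - 1/4 + 1/8, \<open>harm2\<close>
      as 1/8 - 1/8, and H(2k)/k as 1/8 + 3/8 - 1/2. This is the origin of 5/8 and 1/4.\<close>
    have "?\<alpha> k - ?\<beta> k + ?\<gamma> k = 5/8 * x - 1/4 * zeta_val 2" unfolding x_def by (simp add: field_simps)
    moreover have "1 / real k ^ l = c * x"
      using power_real_split[of 2 l k] assms by (simp add: c_def x_def)
    ultimately show "?\<phi> k * (?\<alpha> k - ?\<beta> k + ?\<gamma> k) = 5/8 * (1 / real k ^ l) - 1/4 * zeta_val 2 * (1 / real k ^ (l - 2))"
      unfolding c_def[symmetric] by (simp only:) (simp add: algebra_simps)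
  qed
  also have "\<dots> = 5/8 * zeta_val l - 1/4 * zeta_val 2 * zeta_val (l - 2)"
    using assms by (intro infsumI has_sum_diff has_sum_cmult_right has_sum_zeta_val) auto
  also have "\<dots> = 5/8 * zeta_val l - 1/4 * (zeta_val (l - 2) * zeta_val 2)" by simp
  finally show "((\<lambda>(p, n, k). ?\<phi> k * ?a p n k - ?\<phi> n * ?b p n k + ?\<phi> p * ?c p n k) has_sum
     5/8 * zeta_val l - 1/4 * (zeta_val (l - 2) * zeta_val 2)) chains3" .
  fix p n k :: nat assume pnk: "0 < k" "k < n" "n < p"
  have e: "(1 / real i) ^ (l - 4) = ?\<phi> i * real i ^ 2" if "i > 0" for i
    using power_real_split[of 2 "l - 2" i] that assms by (simp add: power_one_over)
  show "(case (p, n, k) of (p, n, k) \<Rightarrow> ?\<phi> k * ?a p n k - ?\<phi> n * ?b p n k + ?\<phi> p * ?c p n k) =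
      pow_sum3 l (\<lambda>a b c. even a \<and> even b \<and> even c) (1 / real p) (1 / real n) (1 / real k)"
    using pnk assms by (simp only: pow_sum3_even_even_even_residues of_nat_less_iff of_nat_0_less_iff e prod.case mult.assoc)
qed

section \<open>Parity-restricted sums in odd weight\<close>

text \<open>The residues are kept unsimplified because H(k) - H(2k) survives here; only the
  combination with the depth three sum removes it.\<close>

lemma mzv_sum2_odd_even_residues:
  assumes "odd l" "l \<ge> 5"
  shows "((\<lambda>k. 1 / real k ^ (l - 3) * ((2 * H k - H (2 * k)) / 2 / real k ^ 2 - (H (2 * k) - 3 / 2 * (1 / real k)) / 2 / real k ^ 2))
           has_sum mzv_sum2 l (\<lambda>a b. odd a \<and> even b)) {0<..}"
proof -
  let ?\<phi> = "\<lambda>k. 1 / real k ^ (l - 3)"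
  let ?a = "\<lambda>m k. 1 / real m * (1 / (real m ^ 2 - real k ^ 2))"
  let ?\<alpha> = "\<lambda>k. (2 * H k - H (2 * k)) / 2 / real k ^ 2"
  let ?\<beta> = "\<lambda>k. (H (2 * k) - 3 / 2 * (1 / real k)) / 2 / real k ^ 2"
  have "((\<lambda>(m, k). ?\<phi> k * ?a m k - ?\<phi> m * ?a m k) has_sum (\<Sum>\<^sub>\<infinity>k\<in>{0<..}. ?\<phi> k * (?\<alpha> k - ?\<beta> k))) chains2"
  proof (rule chains2_residues)
    show "?a m k \<ge> 0" "?a m k \<ge> 0" if "0 < k" "k < m" for m k
      using that diff_sq_pos[of k m] by auto
  next
    fix k :: nat assume k: "k > 0"
    \<comment> \<open>The partial fractions of 1/(m (m^2 - k^2)) have the term -2/m; giving one half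
      to each neighbour makes two convergent telescoping series.\<close>
    have "((\<lambda>m. ((1 / (real m - real k) - 1 / (real m + real 0)) - (1 / (real m - real 0) - 1 / (real m + real k))) / (2 * real k ^ 2))
      has_sum ((H (k + 0) - H (k - k)) - (H (k + k) - H (k - 0))) / (2 * real k ^ 2)) {k<..}"
      by (intro has_sum_divide_const has_sum_diff has_sum_telescope_tail) auto
    also have "((H (k + 0) - H (k - k)) - (H (k + k) - H (k - 0))) / (2 * real k ^ 2) = ?\<alpha> k"
      unfolding mult_2[of k, symmetric] by simp
    finally show "((\<lambda>m. ?a m k) has_sum ?\<alpha> k) {k<..}"
    proof (rule has_sum_cong[THEN iffD1, rotated])
      fix m assume "m \<in> {k<..}"
      then have km: "real k < real m" "real m > 0" by auto
      have *: "real m ^ 2 - real k ^ 2 = (real m - real k) * (real m + real k)"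
        by (simp add: power2_eq_square algebra_simps)
      show "((1 / (real m - real k) - 1 / (real m + real 0)) - (1 / (real m - real 0) - 1 / (real m + real k))) / (2 * real k ^ 2) = ?a m k"
        unfolding * using km k by (simp add: divide_simps power2_eq_square) (simp add: algebra_simps)
    qed
  next
    fix m :: nat assume m: "m > 0"
    show "(\<Sum>k\<in>{0<..<m}. ?a m k) = ?\<beta> m"
      unfolding sum_distrib_left[symmetric] sum_recip_diff_sq[OF m] by (simp add: power2_eq_square)
  next
    show "(\<lambda>k. ?\<phi> k * ?\<alpha> k) summable_on {0<..}" "(\<lambda>k. ?\<phi> k * ?\<beta> k) summable_on {0<..}"
      using assms by (intro summable_log_bounded log_bounded_intros; simp)+
  qed auto
  then have "mzv_sum2 l (\<lambda>a b. odd a \<and> even b) = (\<Sum>\<^sub>\<infinity>k\<in>{0<..}. ?\<phi> k * (?\<alpha> k - ?\<beta> k))"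
  proof (rule mzv_sum2_eqI)
    fix m k :: nat assume mk: "0 < k" "k < m"
    have "l - 1 - 2 = l - 3" by simp
    then have "pow_sum2 (l - 1) (\<lambda>a b. even a \<and> even b) (1 / real m) (1 / real k)
       = (?\<phi> k - ?\<phi> m) / (real m ^ 2 - real k ^ 2)"
      using mk assms by (subst pow_sum2_even_even) (auto simp only: power_one_over of_nat_less_iff of_nat_0_less_iff, simp_all)
    moreover have "u * (r * (1 / D)) - v * (r * (1 / D)) = r * ((u - v) / D)" for u v r D :: real
      by (simp add: algebra_simps diff_divide_distrib)
    ultimately show "(case (m, k) of (m, k) \<Rightarrow> ?\<phi> k * ?a m k - ?\<phi> m * ?a m k) = pow_sum2 l (\<lambda>a b. odd a \<and> even b) (1 / real m) (1 / real k)"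
      by (simp only: pow_sum2_odd_even prod.case)
  qed
  moreover have "(\<lambda>k. ?\<phi> k * (?\<alpha> k - ?\<beta> k)) summable_on {0<..}"
    using assms by (intro summable_log_bounded log_bounded_intros; simp)
  ultimately show ?thesis by (simp only: has_sum_infsum)
qed

text \<open>The partial fractions are those of the all-even sum of weight l + 1, times the middle
  variable n. This factor joins n^2 - k^2 in the first kernel, giving a plus sign in its partial
  fractions, and p^2 - n^2 in the third, giving the nested sum of
  \<open>sum_nested_diff_sq\<close>.\<close>

lemma mzv_sum3_even_odd_even_residues:
  assumes "odd l" "l \<ge> 5"
  shows "((\<lambda>k. 1 / real k ^ (l - 3) * (((H (2 * k) ^ 2 + harm2 (2 * k)) / 2 + (zeta_val 2 - H (2 * k) / real k / 2)) / 4 / real k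
      - (H (2 * k) ^ 2 - 3 / 2 * (H (2 * k) / real k)) / 4 / real k
      + ((H (2 * k) ^ 2 - harm2 (2 * k)) / 2 - harm2 k + H (2 * k) / real k - 2 * H k / real k + 1 / real k ^ 2) / 4 / real k))
     has_sum mzv_sum3 l (\<lambda>a b c. even a \<and> odd b \<and> even c)) {0<..}"
proof -
  let ?\<phi> = "\<lambda>k. 1 / real k ^ (l - 3)"
  let ?a = "\<lambda>p n k. real n * (1 / ((real p ^ 2 - real k ^ 2) * (real n ^ 2 - real k ^ 2)))"
  let ?b = "\<lambda>p n k. real n * (1 / ((real p ^ 2 - real n ^ 2) * (real n ^ 2 - real k ^ 2)))"
  let ?c = "\<lambda>p n k. real n * (1 / ((real p ^ 2 - real k ^ 2) * (real p ^ 2 - real n ^ 2)))"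
  let ?\<alpha> = "\<lambda>k. ((H (2 * k) ^ 2 + harm2 (2 * k)) / 2 + (zeta_val 2 - H (2 * k) / real k / 2)) / 4 / real k"
  let ?\<beta> = "\<lambda>k. (H (2 * k) ^ 2 - 3 / 2 * (H (2 * k) / real k)) / 4 / real k"
  let ?\<gamma> = "\<lambda>k. ((H (2 * k) ^ 2 - harm2 (2 * k)) / 2 - harm2 k + H (2 * k) / real k - 2 * H k / real k + 1 / real k ^ 2) / 4 / real k"
  have "((\<lambda>(p, n, k). ?\<phi> k * ?a p n k - ?\<phi> n * ?b p n k + ?\<phi> p * ?c p n k) has_sum
     (\<Sum>\<^sub>\<infinity>k\<in>{0<..}. ?\<phi> k * (?\<alpha> k - ?\<beta> k + ?\<gamma> k))) chains3"
  proof (rule chains3_residues[where a' = "\<lambda>n k. (H (n + k) - H (n - k)) * (1 / (real n - real k) + 1 / (real n + real k)) / 4 / real k"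
        and b' = "\<lambda>n k. H (2 * n) / 2 * (1 / (real n ^ 2 - real k ^ 2))"])
    fix p n k :: nat assume "0 < k" "k < n" "n < p"
    then show "?a p n k \<ge> 0" "?b p n k \<ge> 0" "?c p n k \<ge> 0"
      using diff_sq_pos[of k n] diff_sq_pos[of n p] diff_sq_pos[of k p] by auto
  next
    fix n k :: nat assume kn: "0 < k" "k < n"
    have "((\<lambda>p. real n / (real n ^ 2 - real k ^ 2) * (1 / (real p ^ 2 - real k ^ 2))) has_sum
        real n / (real n ^ 2 - real k ^ 2) * ((H (n + k) - H (n - k)) / (2 * real k))) {n<..}"
      using kn by (intro has_sum_cmult_right has_sum_recip_diff_sq_tail) auto
    also have "real n / (real n ^ 2 - real k ^ 2) * ((H (n + k) - H (n - k)) / (2 * real k))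
       = (H (n + k) - H (n - k)) * (1 / (real n - real k) + 1 / (real n + real k)) / 4 / real k"
      using kn by (subst recip_diff_sq'(3)) auto
    finally show "((\<lambda>p. ?a p n k) has_sum (H (n + k) - H (n - k)) * (1 / (real n - real k) + 1 / (real n + real k)) / 4 / real k) {n<..}"
      by (simp only: divide_divide_eq_left times_divide_eq_right mult_1_right mult.commute)
    have "((\<lambda>p. real n * (1 / (real n ^ 2 - real k ^ 2)) * (1 / (real p ^ 2 - real n ^ 2))) has_sum
        real n * (1 / (real n ^ 2 - real k ^ 2)) * ((H (n + n) - H (n - n)) / (2 * real n))) {n<..}"
      using kn by (intro has_sum_cmult_right has_sum_recip_diff_sq_tail) auto
    also have "real n * (1 / (real n ^ 2 - real k ^ 2)) * ((H (n + n) - H (n - n)) / (2 * real n))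
       = H (2 * n) / 2 * (1 / (real n ^ 2 - real k ^ 2))"
    proof -
      have "y * X * (Y / (2 * y)) = Y / 2 * X" if "y > 0" for X Y y :: real
        using that by simp
      from this[of "real n" "1 / (real n ^ 2 - real k ^ 2)" "H (2 * n)"] kn show ?thesis
        by (simp only: mult_2 diff_self_eq_0 H_0 diff_zero of_nat_0_less_iff)
    qed
    finally show "((\<lambda>p. ?b p n k) has_sum H (2 * n) / 2 * (1 / (real n ^ 2 - real k ^ 2))) {n<..}"
      by (simp add: mult.commute)
  next
    fix k :: nat assume k: "0 < k"
    from has_sum_divide_const[OF has_sum_divide_const[OF has_sum_H_symmetric_kernel(2)[OF k], of 4], of "real k"]
    show "((\<lambda>n. (H (n + k) - H (n - k)) * (1 / (real n - real k) + 1 / (real n + real k)) / 4 / real k) has_sum ?\<alpha> k) {k<..}"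
      by (simp only: divide_divide_eq_left mult.commute)
  next
    fix n :: nat assume n: "n > 0"
    have "(\<Sum>k\<in>{0<..<n}. H (2 * n) / 2 * (1 / (real n ^ 2 - real k ^ 2)))
       = H (2 * n) / 2 * ((H (2 * n) - 3 / (2 * real n)) / (2 * real n))"
      unfolding sum_distrib_left[symmetric] sum_recip_diff_sq[OF n] ..
    also have "\<dots> = ?\<beta> n"
      using n by (simp add: field_simps power2_eq_square)
    finally show "(\<Sum>k\<in>{0<..<n}. H (2 * n) / 2 * (1 / (real n ^ 2 - real k ^ 2))) = ?\<beta> n" .
  next
    fix p :: nat assume p: "p > 0"
    have "(\<Sum>n\<in>{0<..<p}. \<Sum>k\<in>{0<..<n}. ?c p n k)
       = (\<Sum>n\<in>{0<..<p}. (1 / (real p - real n) - 1 / (real p + real n)) *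
           (\<Sum>k\<in>{0<..<n}. 1 / (real p - real k) + 1 / (real p + real k)) / (4 * real p))"
    proof (rule sum.cong[OF refl])
      fix n assume n: "n \<in> {0<..<p}"
      have "(\<Sum>k\<in>{0<..<n}. ?c p n k) = (\<Sum>k\<in>{0<..<n}. real n / (real p ^ 2 - real n ^ 2) * (1 / (real p ^ 2 - real k ^ 2)))"
        by (simp add: mult.commute)
      also have "\<dots> = (\<Sum>k\<in>{0<..<n}. (1 / (real p - real n) - 1 / (real p + real n)) / 2 *
          ((1 / (real p - real k) + 1 / (real p + real k)) / (2 * real p)))"
      proof (rule sum.cong[OF refl])
        fix k assume "k \<in> {0<..<n}"
        then have "real k < real p" "real n < real p" using n by auto
        then show "real n / (real p ^ 2 - real n ^ 2) * (1 / (real p ^ 2 - real k ^ 2))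
          = (1 / (real p - real n) - 1 / (real p + real n)) / 2 * ((1 / (real p - real k) + 1 / (real p + real k)) / (2 * real p))"
          by (simp only: recip_diff_sq recip_diff_sq'(1))
      qed
      also have "\<dots> = (1 / (real p - real n) - 1 / (real p + real n)) *
           (\<Sum>k\<in>{0<..<n}. 1 / (real p - real k) + 1 / (real p + real k)) / (4 * real p)"
        unfolding sum_distrib_left[symmetric] sum_divide_distrib[symmetric] by simp
      finally show "(\<Sum>k\<in>{0<..<n}. ?c p n k) = (1 / (real p - real n) - 1 / (real p + real n)) *
           (\<Sum>k\<in>{0<..<n}. 1 / (real p - real k) + 1 / (real p + real k)) / (4 * real p)" .
    qed
    also have "\<dots> = ?\<gamma> p"
      unfolding sum_divide_distrib[symmetric] sum_nested_diff_sq[OF p] by simp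
    finally show "(\<Sum>n\<in>{0<..<p}. \<Sum>k\<in>{0<..<n}. ?c p n k) = ?\<gamma> p" .
  next
    show "(\<lambda>k. ?\<phi> k * ?\<alpha> k) summable_on {0<..}" "(\<lambda>k. ?\<phi> k * ?\<beta> k) summable_on {0<..}"
      "(\<lambda>k. ?\<phi> k * ?\<gamma> k) summable_on {0<..}"
      using assms by (intro summable_log_bounded log_bounded_intros; simp)+
  qed auto
  then have "mzv_sum3 l (\<lambda>a b c. even a \<and> odd b \<and> even c) = (\<Sum>\<^sub>\<infinity>k\<in>{0<..}. ?\<phi> k * (?\<alpha> k - ?\<beta> k + ?\<gamma> k))"
  proof (rule mzv_sum3_eqI)
    fix p n k :: nat assume pnk: "0 < k" "k < n" "n < p"
    have l: "even (l + 1)" "l + 1 \<ge> 4" "l + 1 - 4 = l - 3" using assms by auto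
    have "pow_sum3 l (\<lambda>a b c. even a \<and> odd b \<and> even c) (1 / real p) (1 / real n) (1 / real k)
       = pow_sum3 (l + 1) (\<lambda>a b c. even a \<and> even b \<and> even c) (1 / real p) (1 / real n) (1 / real k) * real n"
      using pnk by (subst pow_sum3_even_odd_even) auto
    also have "\<dots> = ((1 / real k) ^ (l - 3) * (1 / ((real p ^ 2 - real k ^ 2) * (real n ^ 2 - real k ^ 2)))
      - (1 / real n) ^ (l - 3) * (1 / ((real p ^ 2 - real n ^ 2) * (real n ^ 2 - real k ^ 2)))
      + (1 / real p) ^ (l - 3) * (1 / ((real p ^ 2 - real k ^ 2) * (real p ^ 2 - real n ^ 2)))) * real n"
      by (subst pow_sum3_even_even_even_residues[OF _ _ _ l(1,2)]) (use pnk l(3) in auto)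
    also have "\<dots> = ?\<phi> k * ?a p n k - ?\<phi> n * ?b p n k + ?\<phi> p * ?c p n k"
    proof -
      have "(A * X - B * Y + C * Z) * r = A * (r * X) - B * (r * Y) + C * (r * Z)" for A B C X Y Z r :: real
        by (simp add: algebra_simps)
      then show ?thesis unfolding power_one_over .
    qed
    finally show "(case (p, n, k) of (p, n, k) \<Rightarrow> ?\<phi> k * ?a p n k - ?\<phi> n * ?b p n k + ?\<phi> p * ?c p n k)
       = pow_sum3 l (\<lambda>a b c. even a \<and> odd b \<and> even c) (1 / real p) (1 / real n) (1 / real k)" by simp
  qed
  moreover have "(\<lambda>k. ?\<phi> k * (?\<alpha> k - ?\<beta> k + ?\<gamma> k)) summable_on {0<..}"
    using assms by (intro summable_log_bounded log_bounded_intros; simp)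
  ultimately show ?thesis by (simp only: has_sum_infsum)
qed

text \<open>After the prefactor, the triple sum has the remainder (H(2k) - H(k)) / (2 k^2), and the
  double sum has (H(k) - H(2k)) / k^2; the weight 1/2 balances them. The constant is 5/8 = 1/4 +
  3/8, one part from each sum.\<close>

lemma mzv_sum3_even_odd_even:
  assumes "odd l" "l \<ge> 5"
  shows "mzv_sum3 l (\<lambda>a b c. even a \<and> odd b \<and> even c) + 1/2 * mzv_sum2 l (\<lambda>a b. odd a \<and> even b)
    = 5/8 * zeta_val l + 1/4 * mzv [2, l - 2]"
proof (rule has_sum_unique)
  show "((\<lambda>k. 5/8 * (1 / real k ^ l) + 1/4 * (1 / real k ^ (l - 2) * (zeta_val 2 - harm2 k))) has_sum
     5/8 * zeta_val l + 1/4 * mzv [2, l - 2]) {0<..}"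
    using assms by (intro has_sum_add has_sum_cmult_right has_sum_zeta_val has_sum_mzv_2) auto
  show "((\<lambda>k. 5/8 * (1 / real k ^ l) + 1/4 * (1 / real k ^ (l - 2) * (zeta_val 2 - harm2 k))) has_sum
     mzv_sum3 l (\<lambda>a b c. even a \<and> odd b \<and> even c) + 1/2 * mzv_sum2 l (\<lambda>a b. odd a \<and> even b)) {0<..}"
    using has_sum_add[OF mzv_sum3_even_odd_even_residues[OF assms]
        has_sum_cmult_right[OF mzv_sum2_odd_even_residues[OF assms], of "1/2"]]
  proof (rule has_sum_cong[THEN iffD1, rotated], goal_cases)
    case (1 k)
    define c x where "c = 1 / real k ^ (l - 3)" and "x = 1 / real k"
    have d: "a / real k = a * x" "a / real k ^ 2 = a * x ^ 2" for a
      by (simp_all add: x_def power_one_over)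
    have p: "1 / real k ^ l = c * x ^ 3" "1 / real k ^ (l - 2) = c * x"
      using power_real_split[of 3 l k] power_real_split[of 1 "l - 2" k] assms by (simp_all add: c_def x_def power_one_over)
    show ?case
      unfolding c_def[symmetric] d p
      by (simp add: algebra_simps power2_eq_square power3_eq_cube add_divide_distrib diff_divide_distrib)
  qed
qed

theorem theorem3:
  fixes l :: nat
  assumes "l \<ge> 4"
  shows "(even l \<longrightarrow>
      mzv_sum3 l (\<lambda>l1 l2 l3. even l1 \<and> even l2 \<and> even l3)
        = 5/8 * zeta_val l - 1/4 * (zeta_val (l - 2) * zeta_val 2)
    \<and> mzv_sum3 l (\<lambda>l1 l2 l3. even l1 \<and> odd l2 \<and> odd l3)
        + mzv_sum3 l (\<lambda>l1 l2 l3. even l2 \<and> odd l1 \<and> odd l3)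
        + mzv_sum3 l (\<lambda>l1 l2 l3. even l3 \<and> odd l1 \<and> odd l2)
        = 3/8 * zeta_val l + 1/4 * (zeta_val (l - 2) * zeta_val 2)
    \<and> mzv_sum3 l (\<lambda>l1 l2 l3. even l1 \<and> odd l2 \<and> odd l3)
        - mzv_sum3 l (\<lambda>l1 l2 l3. even l3 \<and> odd l1 \<and> odd l2)
        = - 1/4 * zeta_val l + 1/2 * (zeta_val (l - 2) * zeta_val 2))
  \<and> (odd l \<longrightarrow>
      mzv_sum3 l (\<lambda>l1 l2 l3. odd l1 \<and> odd l2 \<and> odd l3)
        + 1/2 * mzv_sum2 l (\<lambda>l1 l2. even l2 \<and> odd l1)
        = 3/8 * zeta_val l - 1/4 * mzv [2, l - 2]
    \<and> mzv_sum3 l (\<lambda>l1 l2 l3. even l1 \<and> even l3 \<and> odd l2)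
        + 1/2 * mzv_sum2 l (\<lambda>l1 l2. even l2 \<and> odd l1)
        = 5/8 * zeta_val l + 1/4 * mzv [2, l - 2]
    \<and> mzv_sum3 l (\<lambda>l1 l2 l3. even l1 \<and> even l2 \<and> odd l3)
        + mzv_sum3 l (\<lambda>l1 l2 l3. even l2 \<and> even l3 \<and> odd l1)
        + mzv_sum2 l (\<lambda>l1 l2. even l1 \<and> odd l2)
        = zeta_val l)"
proof (intro conjI[of "_ \<longrightarrow> _"] impI)
  assume l: "even l"
  let ?eee = "mzv_sum3 l (\<lambda>l1 l2 l3. even l1 \<and> even l2 \<and> even l3)"
  let ?eoo = "mzv_sum3 l (\<lambda>l1 l2 l3. even l1 \<and> odd l2 \<and> odd l3)"
  let ?oeo = "mzv_sum3 l (\<lambda>l1 l2 l3. even l2 \<and> odd l1 \<and> odd l3)"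
  let ?ooe = "mzv_sum3 l (\<lambda>l1 l2 l3. even l3 \<and> odd l1 \<and> odd l2)"
  let ?P = "\<lambda>a b. even a \<and> odd (b :: nat)"
  have EEE: "?eee = 5/8 * zeta_val l - 1/4 * (zeta_val (l - 2) * zeta_val 2)"
    using l assms by (rule mzv_sum3_even_even_even)
  have "zeta_val l = mzv_sum3 l (\<lambda>_ _ _. True)"
    using mzv_sum3_all[OF assms] ..
  also have "\<dots> = ?eee + mzv_sum3 l (\<lambda>a b c. \<not> (even a \<and> even b \<and> even c))"
    by (rule mzv_sum3_split) auto
  also have "mzv_sum3 l (\<lambda>a b c. \<not> (even a \<and> even b \<and> even c))
      = ?eoo + mzv_sum3 l (\<lambda>a b c. odd a \<and> \<not> (even b \<and> even c))"
    using l by (intro mzv_sum3_split; auto; presburger)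
  also have "mzv_sum3 l (\<lambda>a b c. odd a \<and> \<not> (even b \<and> even c)) = ?oeo + ?ooe"
    using l by (intro mzv_sum3_split; auto; presburger)
  finally have total: "zeta_val l = ?eee + (?eoo + (?oeo + ?ooe))" .
  \<comment> \<open>The pair condition reads off parities: b + c - 1 is odd exactly when b and c
    have equal parity, and a + b - 1 is even exactly when a and b have opposite parity.\<close>
  have "mzv_sum3 l (\<lambda>a b c. ?P a (b + c - 1)) = ?eee + ?eoo"
    using l by (intro mzv_sum3_split; auto; presburger)
  moreover have "mzv_sum3 l (\<lambda>a b c. ?P (a + b - 1) c) = ?eoo + ?oeo"
    using l by (intro mzv_sum3_split; auto; presburger)
  ultimately have X: "(?eee + ?eoo) + (?eoo + ?oeo) = 3/4 * zeta_val l + 1/2 * zeta_val 2 * zeta_val (l - 2)"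
    using mzv_sum3_shuffle[of l ?P] infsum_pow_sum2_even_odd[OF l assms] by simp
  show "?eee = 5/8 * zeta_val l - 1/4 * (zeta_val (l - 2) * zeta_val 2)
    \<and> ?eoo + ?oeo + ?ooe = 3/8 * zeta_val l + 1/4 * (zeta_val (l - 2) * zeta_val 2)
    \<and> ?eoo - ?ooe = - 1/4 * zeta_val l + 1/2 * (zeta_val (l - 2) * zeta_val 2)"
    \<comment> \<open>The third identity is X minus the full sum formula: (eee + 2 eoo + oeo) - (eee
      + eoo + oeo + ooe) = eoo - ooe.\<close>
    using EEE total X by (simp add: algebra_simps)
next
  assume l: "odd l"
  \<comment> \<open>The residue lemmas in odd weight use the prefactor 1 / k^(l-3), whose exponent
    is at least 2 exactly from l = 5 on.\<close>
  with assms have l5: "l \<ge> 5" by (cases "l = 4") auto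
  let ?ooo = "mzv_sum3 l (\<lambda>l1 l2 l3. odd l1 \<and> odd l2 \<and> odd l3)"
  let ?eoe = "mzv_sum3 l (\<lambda>l1 l2 l3. even l1 \<and> even l3 \<and> odd l2)"
  let ?eeo = "mzv_sum3 l (\<lambda>l1 l2 l3. even l1 \<and> even l2 \<and> odd l3)"
  let ?oee = "mzv_sum3 l (\<lambda>l1 l2 l3. even l2 \<and> even l3 \<and> odd l1)"
  let ?oe = "mzv_sum2 l (\<lambda>l1 l2. even l2 \<and> odd l1)"
  let ?eo = "mzv_sum2 l (\<lambda>l1 l2. even l1 \<and> odd l2)"
  let ?P = "\<lambda>a b. even a \<and> even (b :: nat)"
  have EOE: "?eoe + 1/2 * ?oe = 5/8 * zeta_val l + 1/4 * mzv [2, l - 2]"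
    using mzv_sum3_even_odd_even[OF l l5] by (simp add: conj_ac)
  have "zeta_val l = mzv_sum2 l (\<lambda>_ _. True)"
    using mzv_sum2_all[of l] assms by simp
  also have "\<dots> = ?oe + ?eo"
    using l by (intro mzv_sum2_split) auto
  finally have total2: "zeta_val l = ?oe + ?eo" .
  have "zeta_val l = mzv_sum3 l (\<lambda>_ _ _. True)"
    using mzv_sum3_all[OF assms] ..
  also have "\<dots> = ?ooo + mzv_sum3 l (\<lambda>a b c. \<not> (odd a \<and> odd b \<and> odd c))"
    by (rule mzv_sum3_split) auto
  also have "mzv_sum3 l (\<lambda>a b c. \<not> (odd a \<and> odd b \<and> odd c))
      = ?oee + mzv_sum3 l (\<lambda>a b c. even a \<and> \<not> (odd b \<and> odd c))"
    using l by (intro mzv_sum3_split; auto; presburger)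
  also have "mzv_sum3 l (\<lambda>a b c. even a \<and> \<not> (odd b \<and> odd c)) = ?eoe + ?eeo"
    using l by (intro mzv_sum3_split; auto; presburger)
  finally have total: "zeta_val l = ?ooo + (?oee + (?eoe + ?eeo))" .
  have "mzv_sum3 l (\<lambda>a b c. ?P a (b + c - 1)) = ?eeo + ?eoe"
    using l by (intro mzv_sum3_split; auto; presburger)
  moreover have "mzv_sum3 l (\<lambda>a b c. ?P (a + b - 1) c) = ?oee + ?eoe"
    using l by (intro mzv_sum3_split; auto; presburger)
  ultimately have Y: "(?eeo + ?eoe) + (?oee + ?eoe) = 5/4 * zeta_val l + 1/2 * mzv [2, l - 2]"
    using mzv_sum3_shuffle[of l ?P] infsum_pow_sum2_even_even[OF l l5] by simp
  show "?ooo + 1/2 * ?oe = 3/8 * zeta_val l - 1/4 * mzv [2, l - 2]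
    \<and> ?eoe + 1/2 * ?oe = 5/8 * zeta_val l + 1/4 * mzv [2, l - 2]
    \<and> ?eeo + ?oee + ?eo = zeta_val l"
    \<comment> \<open>The sum of type (odd, odd, odd) is the total minus Y plus eoe. The last
      identity is Y + \<open>total2\<close> - 2 EOE, in which zeta(2, l-2) drops out.\<close>
    using EOE total2 total Y by (intro conjI) (linarith+)
qed

end
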